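(* The category of games $\mathbf{Game}$ has the following properties: (i) $\mathbf{Game}$ is locally finitely presentable; in particular, it has all small limits and colimits. (ii) The forgetful functor $U\colon\mathbf{Game}\to\mathbf{Set}$, $(X,\to)\mapsto X$, is comonadic; in particular, it preserves, reflects, and strictly creates all small colimits. (iii) $\mathbf{Game}$ has a subobject classifier.
   Context: A game is a pair $\mathbb{X}=(X,\to)$ of a (possibly infinite) set $X$ and a relation ${\to}\subset X\times X$ such that (finite options) for every $x\in X$ the set $\{x'\in X\mid x\to x'\}$ is finite, and (finite time) there is no infinite path $x_0\to x_1\to x_2\to\cdots$. A game morphism $f\colon (X,\to_{\mathbb{X}})\to (Y,\to_{\mathbb{Y}})$ is a function $f\colon X\to Y$ such that (1) $x\to_{\mathbb{X}} x'$ implies $f(x)\to_{\mathbb{Y}} f(x')$, and (2) (path-lifting) if $f(x)\to_{\mathbb{Y}} y$ then there is $x'\in X$ with $x\to_{\mathbb{X}}x'$ and $f(x')=y$. $\mathbf{Game}$ is the category of games and game morphisms. *)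

theory Defs
  imports Main "HOL-Library.FuncSet"
begin

unbundle cardinal_syntax

section \<open>Smallness\<close>

text \<open>
  HOL has no type of all sets, so \<open>Set\<close> is the category of small sets of a Grothendieck
  universe. The universe is a type \<open>'u\<close> whose cardinality is strongly inaccessible;
  a set, of whatever element type, is small if it has fewer elements than \<open>'u\<close>.
  The small subsets of \<open>'u\<close> are then, up to bijection, all the small sets.
\<close>

definition small :: "'u itself \<Rightarrow> 'x set \<Rightarrow> bool" where
  "small _ A \<longleftrightarrow> |A| <o |UNIV :: 'u set|"

definition universe :: "'u itself \<Rightarrow> bool" where
  "universe U \<longleftrightarrow>
     (\<exists>A :: 'u set. infinite A \<and> small U A) \<and>
     (\<forall>A :: 'u set. small U A \<longrightarrow> small U (Pow A)) \<and>
     (\<forall>(I :: 'u set) (A :: 'u \<Rightarrow> 'u set).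
        small U I \<and> (\<forall>i\<in>I. small U (A i)) \<longrightarrow> small U (\<Union>i\<in>I. A i))"


section \<open>Categories, functors, natural transformations\<close>

text \<open>\<open>cmp C g f\<close> is the composite of \<open>g\<close> after \<open>f\<close>.\<close>

record ('o, 'a) cat =
  Ob :: "'o set"
  Ar :: "'a set"
  src :: "'a \<Rightarrow> 'o"
  tgt :: "'a \<Rightarrow> 'o"
  idn :: "'o \<Rightarrow> 'a"
  cmp :: "'a \<Rightarrow> 'a \<Rightarrow> 'a"

definition hom :: "('o, 'a) cat \<Rightarrow> 'o \<Rightarrow> 'o \<Rightarrow> 'a set" where
  "hom C x y = {f \<in> Ar C. src C f = x \<and> tgt C f = y}"

definition category :: "('o, 'a) cat \<Rightarrow> bool" where
  "category C \<longleftrightarrow>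
     (\<forall>f\<in>Ar C. src C f \<in> Ob C \<and> tgt C f \<in> Ob C) \<and>
     (\<forall>x\<in>Ob C. idn C x \<in> hom C x x) \<and>
     (\<forall>x y z. \<forall>f\<in>hom C x y. \<forall>g\<in>hom C y z. cmp C g f \<in> hom C x z) \<and>
     (\<forall>x y. \<forall>f\<in>hom C x y. cmp C f (idn C x) = f \<and> cmp C (idn C y) f = f) \<and>
     (\<forall>w x y z. \<forall>f\<in>hom C w x. \<forall>g\<in>hom C x y. \<forall>h\<in>hom C y z.
        cmp C h (cmp C g f) = cmp C (cmp C h g) f)"

record ('o, 'a, 'p, 'b) func =
  omap :: "'o \<Rightarrow> 'p"
  amap :: "'a \<Rightarrow> 'b"

definition is_functor :: "('o, 'a) cat \<Rightarrow> ('p, 'b) cat \<Rightarrow> ('o, 'a, 'p, 'b) func \<Rightarrow> bool" where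
  "is_functor C D F \<longleftrightarrow>
     category C \<and> category D \<and>
     (\<forall>x\<in>Ob C. omap F x \<in> Ob D) \<and>
     (\<forall>x y. \<forall>f\<in>hom C x y. amap F f \<in> hom D (omap F x) (omap F y)) \<and>
     (\<forall>x\<in>Ob C. amap F (idn C x) = idn D (omap F x)) \<and>
     (\<forall>x y z. \<forall>f\<in>hom C x y. \<forall>g\<in>hom C y z.
        amap F (cmp C g f) = cmp D (amap F g) (amap F f))"

definition id_func :: "('o, 'a, 'o, 'a) func" where
  "id_func = \<lparr>omap = (\<lambda>x. x), amap = (\<lambda>f. f)\<rparr>"

definition comp_func ::
  "('p, 'b, 'q, 'c) func \<Rightarrow> ('o, 'a, 'p, 'b) func \<Rightarrow> ('o, 'a, 'q, 'c) func" where
  "comp_func G F = \<lparr>omap = (\<lambda>x. omap G (omap F x)), amap = (\<lambda>f. amap G (amap F f))\<rparr>"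

definition is_nat_trans ::
  "('o, 'a) cat \<Rightarrow> ('p, 'b) cat \<Rightarrow> ('o, 'a, 'p, 'b) func \<Rightarrow> ('o, 'a, 'p, 'b) func \<Rightarrow>
   ('o \<Rightarrow> 'b) \<Rightarrow> bool" where
  "is_nat_trans C D F G t \<longleftrightarrow>
     is_functor C D F \<and> is_functor C D G \<and>
     (\<forall>x\<in>Ob C. t x \<in> hom D (omap F x) (omap G x)) \<and>
     (\<forall>x y. \<forall>f\<in>hom C x y. cmp D (t y) (amap F f) = cmp D (amap G f) (t x))"

definition is_iso :: "('o, 'a) cat \<Rightarrow> 'a \<Rightarrow> bool" where
  "is_iso C f \<longleftrightarrow> f \<in> Ar C \<and>
     (\<exists>g\<in>hom C (tgt C f) (src C f).
        cmp C g f = idn C (src C f) \<and> cmp C f g = idn C (tgt C f))"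

definition is_nat_iso ::
  "('o, 'a) cat \<Rightarrow> ('p, 'b) cat \<Rightarrow> ('o, 'a, 'p, 'b) func \<Rightarrow> ('o, 'a, 'p, 'b) func \<Rightarrow>
   ('o \<Rightarrow> 'b) \<Rightarrow> bool" where
  "is_nat_iso C D F G t \<longleftrightarrow> is_nat_trans C D F G t \<and> (\<forall>x\<in>Ob C. is_iso D (t x))"

definition is_equivalence :: "('o, 'a) cat \<Rightarrow> ('p, 'b) cat \<Rightarrow> ('o, 'a, 'p, 'b) func \<Rightarrow> bool" where
  "is_equivalence C D F \<longleftrightarrow>
     is_functor C D F \<and>
     (\<exists>G. is_functor D C G \<and>
        (\<exists>s. is_nat_iso C C id_func (comp_func G F) s) \<and>
        (\<exists>t. is_nat_iso D D (comp_func F G) id_func t))"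


section \<open>Comonadic functors\<close>

text \<open>\<open>L\<close> is left adjoint to \<open>R\<close>, with unit \<open>e\<close> and counit \<open>c\<close>.\<close>

definition is_adjunction ::
  "('o, 'a) cat \<Rightarrow> ('p, 'b) cat \<Rightarrow> ('o, 'a, 'p, 'b) func \<Rightarrow> ('p, 'b, 'o, 'a) func \<Rightarrow>
   ('o \<Rightarrow> 'a) \<Rightarrow> ('p \<Rightarrow> 'b) \<Rightarrow> bool" where
  "is_adjunction C D L R e c \<longleftrightarrow>
     is_functor C D L \<and> is_functor D C R \<and>
     is_nat_trans C C id_func (comp_func R L) e \<and>
     is_nat_trans D D (comp_func L R) id_func c \<and>
     (\<forall>x\<in>Ob C. cmp D (c (omap L x)) (amap L (e x)) = idn D (omap L x)) \<and>
     (\<forall>y\<in>Ob D. cmp C (amap R (c y)) (e (omap R y)) = idn C (omap R y))"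

text \<open>
  The category of coalgebras of a comonad with underlying endofunctor \<open>T\<close>, counit \<open>c\<close> and
  comultiplication \<open>d\<close>. An arrow carries its source and target coalgebras.
\<close>

definition coalg_cat ::
  "('p, 'b) cat \<Rightarrow> ('p, 'b, 'p, 'b) func \<Rightarrow> ('p \<Rightarrow> 'b) \<Rightarrow> ('p \<Rightarrow> 'b) \<Rightarrow>
   ('p \<times> 'b, ('p \<times> 'b) \<times> ('p \<times> 'b) \<times> 'b) cat" where
  "coalg_cat D T c d =
    (let coalgs = {(A, h). A \<in> Ob D \<and> h \<in> hom D A (omap T A) \<and>
                     cmp D (c A) h = idn D A \<and>
                     cmp D (d A) h = cmp D (amap T h) h}
     in \<lparr>Ob = coalgs,
         Ar = {((A, h), (B, k), f). (A, h) \<in> coalgs \<and> (B, k) \<in> coalgs \<and>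
                 f \<in> hom D A B \<and> cmp D k f = cmp D (amap T f) h},
         src = (\<lambda>(X, Y, f). X),
         tgt = (\<lambda>(X, Y, f). Y),
         idn = (\<lambda>X. (X, X, idn D (fst X))),
         cmp = (\<lambda>(Y', Z, g) (X, Y, f). (X, Z, cmp D g f))\<rparr>)"

definition comparison_func ::
  "('o, 'a) cat \<Rightarrow> ('o, 'a, 'p, 'b) func \<Rightarrow> ('o \<Rightarrow> 'a) \<Rightarrow>
   ('o, 'a, 'p \<times> 'b, ('p \<times> 'b) \<times> ('p \<times> 'b) \<times> 'b) func" where
  "comparison_func C L e =
    (let K = (\<lambda>x. (omap L x, amap L (e x)))
     in \<lparr>omap = K, amap = (\<lambda>f. (K (src C f), K (tgt C f), amap L f))\<rparr>)"

definition comonadic :: "('o, 'a) cat \<Rightarrow> ('p, 'b) cat \<Rightarrow> ('o, 'a, 'p, 'b) func \<Rightarrow> bool" where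
  "comonadic C D L \<longleftrightarrow>
     (\<exists>R e c. is_adjunction C D L R e c \<and>
        is_equivalence C
          (coalg_cat D (comp_func L R) c (\<lambda>y. amap L (e (omap R y))))
          (comparison_func C L e))"


section \<open>Limits and colimits\<close>

definition is_cocone ::
  "('i, 'j) cat \<Rightarrow> ('o, 'a) cat \<Rightarrow> ('i, 'j, 'o, 'a) func \<Rightarrow> 'o \<Rightarrow> ('i \<Rightarrow> 'a) \<Rightarrow> bool" where
  "is_cocone J C D l c \<longleftrightarrow>
     l \<in> Ob C \<and>
     (\<forall>i\<in>Ob J. c i \<in> hom C (omap D i) l) \<and>
     (\<forall>i j. \<forall>u\<in>hom J i j. cmp C (c j) (amap D u) = c i)"

definition is_colimit ::
  "('i, 'j) cat \<Rightarrow> ('o, 'a) cat \<Rightarrow> ('i, 'j, 'o, 'a) func \<Rightarrow> 'o \<Rightarrow> ('i \<Rightarrow> 'a) \<Rightarrow> bool" where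
  "is_colimit J C D l c \<longleftrightarrow>
     is_cocone J C D l c \<and>
     (\<forall>m d. is_cocone J C D m d \<longrightarrow>
        (\<exists>!h. h \<in> hom C l m \<and> (\<forall>i\<in>Ob J. cmp C h (c i) = d i)))"

definition is_cone ::
  "('i, 'j) cat \<Rightarrow> ('o, 'a) cat \<Rightarrow> ('i, 'j, 'o, 'a) func \<Rightarrow> 'o \<Rightarrow> ('i \<Rightarrow> 'a) \<Rightarrow> bool" where
  "is_cone J C D l c \<longleftrightarrow>
     l \<in> Ob C \<and>
     (\<forall>i\<in>Ob J. c i \<in> hom C l (omap D i)) \<and>
     (\<forall>i j. \<forall>u\<in>hom J i j. cmp C (amap D u) (c i) = c j)"

definition is_limit ::
  "('i, 'j) cat \<Rightarrow> ('o, 'a) cat \<Rightarrow> ('i, 'j, 'o, 'a) func \<Rightarrow> 'o \<Rightarrow> ('i \<Rightarrow> 'a) \<Rightarrow> bool" where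
  "is_limit J C D l c \<longleftrightarrow>
     is_cone J C D l c \<and>
     (\<forall>m d. is_cone J C D m d \<longrightarrow>
        (\<exists>!h. h \<in> hom C m l \<and> (\<forall>i\<in>Ob J. cmp C (c i) h = d i)))"

text \<open>Every small category is isomorphic to one whose objects and arrows are elements of \<open>'u\<close>.\<close>

definition small_category :: "'u itself \<Rightarrow> ('u, 'u) cat \<Rightarrow> bool" where
  "small_category U J \<longleftrightarrow> category J \<and> small U (Ob J) \<and> small U (Ar J)"

definition has_small_limits :: "'u itself \<Rightarrow> ('o, 'a) cat \<Rightarrow> bool" where
  "has_small_limits U C \<longleftrightarrow>
     (\<forall>J D. small_category U J \<and> is_functor J C D \<longrightarrow> (\<exists>l c. is_limit J C D l c))"

definition has_small_colimits :: "'u itself \<Rightarrow> ('o, 'a) cat \<Rightarrow> bool" where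
  "has_small_colimits U C \<longleftrightarrow>
     (\<forall>J D. small_category U J \<and> is_functor J C D \<longrightarrow> (\<exists>l c. is_colimit J C D l c))"

definition preserves_colimits ::
  "('i, 'j) cat \<Rightarrow> ('o, 'a) cat \<Rightarrow> ('p, 'b) cat \<Rightarrow> ('o, 'a, 'p, 'b) func \<Rightarrow> bool" where
  "preserves_colimits J C E F \<longleftrightarrow>
     (\<forall>D l c. is_functor J C D \<and> is_colimit J C D l c \<longrightarrow>
        is_colimit J E (comp_func F D) (omap F l) (\<lambda>i. amap F (c i)))"

definition reflects_colimits ::
  "('i, 'j) cat \<Rightarrow> ('o, 'a) cat \<Rightarrow> ('p, 'b) cat \<Rightarrow> ('o, 'a, 'p, 'b) func \<Rightarrow> bool" where
  "reflects_colimits J C E F \<longleftrightarrow>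
     (\<forall>D l c. is_functor J C D \<and> is_cocone J C D l c \<and>
        is_colimit J E (comp_func F D) (omap F l) (\<lambda>i. amap F (c i)) \<longrightarrow>
        is_colimit J C D l c)"

text \<open>
  Strict creation: every colimit cocone \<open>(m, d)\<close> under the image of a diagram has exactly one
  lift to a cocone under the diagram, on the nose, and this lift is a colimit cocone.
\<close>

definition strictly_creates_colimits ::
  "('i, 'j) cat \<Rightarrow> ('o, 'a) cat \<Rightarrow> ('p, 'b) cat \<Rightarrow> ('o, 'a, 'p, 'b) func \<Rightarrow> bool" where
  "strictly_creates_colimits J C E F \<longleftrightarrow>
     (\<forall>D m d. is_functor J C D \<and> is_colimit J E (comp_func F D) m d \<longrightarrow>
        (\<exists>l c. is_colimit J C D l c \<and> omap F l = m \<and> (\<forall>i\<in>Ob J. amap F (c i) = d i) \<and>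
           (\<forall>l' c'. is_cocone J C D l' c' \<and> omap F l' = m \<and> (\<forall>i\<in>Ob J. amap F (c' i) = d i) \<longrightarrow>
              l' = l \<and> (\<forall>i\<in>Ob J. c' i = c i))))"


section \<open>The category of small sets\<close>

text \<open>
  The element type \<open>'x\<close> need not be \<open>'u\<close>: hom functors take values in sets of arrows.
  An arrow is a triple of domain, codomain and a function that is \<open>undefined\<close> off the domain.
\<close>

definition set_cat :: "'u itself \<Rightarrow> ('x set, 'x set \<times> 'x set \<times> ('x \<Rightarrow> 'x)) cat" where
  "set_cat U =
     \<lparr>Ob = {A. small U A},
      Ar = {(A, B, f). small U A \<and> small U B \<and> f \<in> A \<rightarrow>\<^sub>E B},
      src = (\<lambda>(A, B, f). A),
      tgt = (\<lambda>(A, B, f). B),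
      idn = (\<lambda>A. (A, A, \<lambda>x\<in>A. x)),
      cmp = (\<lambda>(B', E, g) (A, B, f). (A, E, compose A g f))\<rparr>"

definition hom_func ::
  "('o, 'a) cat \<Rightarrow> 'o \<Rightarrow> ('o, 'a, 'a set, 'a set \<times> 'a set \<times> ('a \<Rightarrow> 'a)) func" where
  "hom_func C k =
     \<lparr>omap = (\<lambda>x. hom C k x),
      amap = (\<lambda>f. (hom C k (src C f), hom C k (tgt C f), \<lambda>g\<in>hom C k (src C f). cmp C f g))\<rparr>"


section \<open>Locally finitely presentable categories\<close>

definition filtered :: "('i, 'j) cat \<Rightarrow> bool" where
  "filtered J \<longleftrightarrow>
     Ob J \<noteq> {} \<and>
     (\<forall>i\<in>Ob J. \<forall>j\<in>Ob J. \<exists>k\<in>Ob J. hom J i k \<noteq> {} \<and> hom J j k \<noteq> {}) \<and>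
     (\<forall>i j. \<forall>u\<in>hom J i j. \<forall>v\<in>hom J i j. \<exists>k\<in>Ob J. \<exists>w\<in>hom J j k. cmp J w u = cmp J w v)"

definition locally_small :: "'u itself \<Rightarrow> ('o, 'a) cat \<Rightarrow> bool" where
  "locally_small U C \<longleftrightarrow> (\<forall>x\<in>Ob C. \<forall>y\<in>Ob C. small U (hom C x y))"

definition finitely_presentable :: "'u itself \<Rightarrow> ('o, 'a) cat \<Rightarrow> 'o \<Rightarrow> bool" where
  "finitely_presentable U C k \<longleftrightarrow>
     k \<in> Ob C \<and>
     (\<forall>J. small_category U J \<and> filtered J \<longrightarrow>
        preserves_colimits J C (set_cat U) (hom_func C k))"

definition locally_finitely_presentable :: "'u itself \<Rightarrow> ('o, 'a) cat \<Rightarrow> bool" where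
  "locally_finitely_presentable U C \<longleftrightarrow>
     category C \<and> locally_small U C \<and> has_small_colimits U C \<and>
     (\<exists>S. small U S \<and> (\<forall>k\<in>S. finitely_presentable U C k) \<and>
        (\<forall>x\<in>Ob C. \<exists>J D c. small_category U J \<and> filtered J \<and> is_functor J C D \<and>
           (\<forall>i\<in>Ob J. omap D i \<in> S) \<and> is_colimit J C D x c))"


section \<open>Subobject classifiers\<close>

definition is_terminal :: "('o, 'a) cat \<Rightarrow> 'o \<Rightarrow> bool" where
  "is_terminal C t \<longleftrightarrow> t \<in> Ob C \<and> (\<forall>x\<in>Ob C. \<exists>!f. f \<in> hom C x t)"

definition is_mono :: "('o, 'a) cat \<Rightarrow> 'a \<Rightarrow> bool" where
  "is_mono C m \<longleftrightarrow> m \<in> Ar C \<and>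
     (\<forall>x. \<forall>f\<in>hom C x (src C m). \<forall>g\<in>hom C x (src C m). cmp C m f = cmp C m g \<longrightarrow> f = g)"

text \<open>The square \<open>f \<circ> p = g \<circ> q\<close> is a pullback.\<close>

definition is_pullback :: "('o, 'a) cat \<Rightarrow> 'a \<Rightarrow> 'a \<Rightarrow> 'a \<Rightarrow> 'a \<Rightarrow> bool" where
  "is_pullback C p q f g \<longleftrightarrow>
     (\<exists>w x y z. p \<in> hom C w x \<and> q \<in> hom C w y \<and> f \<in> hom C x z \<and> g \<in> hom C y z \<and>
        cmp C f p = cmp C g q \<and>
        (\<forall>v. \<forall>a\<in>hom C v x. \<forall>b\<in>hom C v y. cmp C f a = cmp C g b \<longrightarrow>
           (\<exists>!h. h \<in> hom C v w \<and> cmp C p h = a \<and> cmp C q h = b)))"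

definition is_subobject_classifier :: "('o, 'a) cat \<Rightarrow> 'o \<Rightarrow> 'o \<Rightarrow> 'a \<Rightarrow> bool" where
  "is_subobject_classifier C t om tru \<longleftrightarrow>
     is_terminal C t \<and> om \<in> Ob C \<and> tru \<in> hom C t om \<and>
     (\<forall>x y. \<forall>m\<in>hom C x y. is_mono C m \<longrightarrow>
        (\<exists>!chi. chi \<in> hom C y om \<and> (\<exists>b\<in>hom C x t. is_pullback C m b chi tru)))"

definition has_subobject_classifier :: "('o, 'a) cat \<Rightarrow> bool" where
  "has_subobject_classifier C \<longleftrightarrow> (\<exists>t om tru. is_subobject_classifier C t om tru)"


section \<open>Games\<close>

type_synonym 'x game = "'x set \<times> ('x \<times> 'x) set"

definition is_game :: "'x game \<Rightarrow> bool" where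
  "is_game = (\<lambda>(X, R).
     R \<subseteq> X \<times> X \<and>
     (\<forall>x\<in>X. finite {x'. (x, x') \<in> R}) \<and>
     \<not> (\<exists>s :: nat \<Rightarrow> 'x. \<forall>n. (s n, s (Suc n)) \<in> R))"

definition is_game_morphism :: "'x game \<Rightarrow> 'x game \<Rightarrow> ('x \<Rightarrow> 'x) \<Rightarrow> bool" where
  "is_game_morphism = (\<lambda>(X, R) (Y, S) f.
     f \<in> X \<rightarrow>\<^sub>E Y \<and>
     (\<forall>x x'. (x, x') \<in> R \<longrightarrow> (f x, f x') \<in> S) \<and>
     (\<forall>x\<in>X. \<forall>y. (f x, y) \<in> S \<longrightarrow> (\<exists>x'. (x, x') \<in> R \<and> f x' = y)))"

definition game_cat :: "'u itself \<Rightarrow> ('u game, 'u game \<times> 'u game \<times> ('u \<Rightarrow> 'u)) cat" where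
  "game_cat U =
    (let games = {G. is_game G \<and> small U (fst G)}
     in \<lparr>Ob = games,
         Ar = {(G, H, f). G \<in> games \<and> H \<in> games \<and> is_game_morphism G H f},
         src = (\<lambda>(G, H, f). G),
         tgt = (\<lambda>(G, H, f). H),
         idn = (\<lambda>G. (G, G, \<lambda>x\<in>fst G. x)),
         cmp = (\<lambda>(H', K, g) (G, H, f). (G, K, compose (fst G) g f))\<rparr>)"

definition forgetful ::
  "('u game, 'u game \<times> 'u game \<times> ('u \<Rightarrow> 'u), 'u set, 'u set \<times> 'u set \<times> ('u \<Rightarrow> 'u)) func" where
  "forgetful = \<lparr>omap = fst, amap = (\<lambda>(G, H, f). (fst G, fst H, f))\<rparr>"

end

theory Submission
  imports Defs "HOL-Library.FSet"
begin

text \<open>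
  Games are the well-founded coalgebras of the finite powerset functor. The cofree game on a set \<open>A\<close>
  consists of the hereditarily finite trees with labels in \<open>A\<close>: a labelling of a game extends
  uniquely to trees by well-founded recursion. This gives the right adjoint, and a coalgebra
  \<open>h\<close> on \<open>A\<close> is a game by pulling back the moves between the trees \<open>h a\<close>; coassociativity makes
  \<open>h\<close> path-lifting. Limits and the subobject classifier are closed parts of cofree games. Colimits
  are those of sets, because the zigzag relation of a diagram is a bisimulation. Finitely
  presentable games are the finite ones, and every game is the directed union of its finite
  closed parts, by well-foundedness and finite branching.
\<close>

section \<open>Closure properties of smallness\<close>

text \<open>All positions of objects of \<open>game_cat U\<close> have type \<open>'u\<close>, while
  trees, compatible families, kernel pairs and zigzag classes live on other types. Smallness
  supplies an injection into \<open>'u\<close> for each of them; hence the two-typed morphisms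
  \<open>gmor\<close> and the transport by \<open>image_game\<close>. The forgetful functor does not
  preserve limits: already the terminal game consists of all hereditarily finite trees with a single
  label. So limits cannot be built on limits of sets, and trees labelled by compatible families
  provide the positions that are missing there. Comonadicity needs no Beck criterion. Labels recover
  positions from their unfoldings, so the comparison functor turns out to be bijective on objects
  and on hom-sets. For finite presentability the obstacle is that a function chosen vertex by vertex
  into a stage of a filtered diagram respects moves only up to equality in the colimit. Finite
  branching of the stage, together with finiteness of the domain, leaves finitely many defects, and
  one later stage repairs them all.\<close>

locale small_universe =
  fixes U :: "'u itself"
  assumes universe: "universe U"
begin

lemma infinite_UNIV: "infinite (UNIV :: 'u set)"
  using universe unfolding universe_def by (metis finite_subset subset_UNIV)

text \<open>The universe axioms bound unions of subsets of \<open>'u\<close>, not disjoint unions.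
  An injective pairing on \<open>'u\<close> encodes \<open>Sigma A F\<close> inside such a union;
  stability then carries smallness to \<open>Sigma\<close> over arbitrary element types.\<close>

lemma stable_universe: "stable |UNIV :: 'u set|"
  unfolding stable_def
proof (intro allI impI)
  fix A :: "'u set" and F :: "'u \<Rightarrow> 'u set"
  assume AF: "|A| <o |UNIV :: 'u set| \<and> (\<forall>a\<in>A. |F a| <o |UNIV :: 'u set| )"
  have "|(UNIV :: 'u set) \<times> (UNIV :: 'u set)| =o |UNIV :: 'u set|"
    by (rule card_of_Times_same_infinite[OF infinite_UNIV])
  then obtain p :: "'u \<times> 'u \<Rightarrow> 'u" where "bij_betw p (UNIV \<times> UNIV) UNIV"
    unfolding card_of_ordIso[symmetric] by (elim exE)
  then have p: "inj p" by (simp add: bij_betw_def)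
  let ?G = "\<lambda>a. (\<lambda>b. p (a, b)) ` F a"
  have "\<forall>a\<in>A. small U (?G a)"
    using AF ordLeq_ordLess_trans[OF card_of_image] unfolding small_def by fast
  then have small: "small U (\<Union>a\<in>A. ?G a)"
    by (intro universe[unfolded universe_def, THEN conjunct2, THEN conjunct2, rule_format] conjI)
      (use AF in \<open>auto simp: small_def\<close>)
  have "p ` Sigma A F \<subseteq> (\<Union>a\<in>A. ?G a)" by auto
  moreover have "inj_on p (Sigma A F)" by (rule inj_on_subset[OF p subset_UNIV])
  ultimately have "|Sigma A F| \<le>o |\<Union>a\<in>A. ?G a|"
    by (intro card_of_ordLeq[THEN iffD1] exI conjI)
  then show "|Sigma A F| <o |UNIV :: 'u set|"
    using small ordLeq_ordLess_trans unfolding small_def by blast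
qed

lemma small_inj: "inj_on f A \<Longrightarrow> f ` A \<subseteq> B \<Longrightarrow> small U B \<Longrightarrow> small U A"
  unfolding small_def using card_of_ordLeq[of A B] ordLeq_ordLess_trans[of "|A|" "|B|"] by blast

lemma small_subset: "A \<subseteq> B \<Longrightarrow> small U B \<Longrightarrow> small U A"
  by (rule small_inj[of id]) auto

lemma small_image: "small U A \<Longrightarrow> small U (f ` A)"
  unfolding small_def by (rule ordLeq_ordLess_trans[OF card_of_image])

lemma small_finite:
  assumes "finite A" shows "small U A"
  unfolding small_def
  by (rule finite_ordLess_infinite[OF card_of_Well_order card_of_Well_order])
    (use assms infinite_UNIV in \<open>simp_all add: Field_card_of\<close>)

lemma small_Sigma: "small U A \<Longrightarrow> (\<And>a. a \<in> A \<Longrightarrow> small U (F a)) \<Longrightarrow> small U (Sigma A F)"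
  unfolding small_def using stable_elim[OF stable_universe] by blast

lemma small_UN:
  assumes "small U A" "\<And>a. a \<in> A \<Longrightarrow> small U (F a)"
  shows "small U (\<Union>a\<in>A. F a)"
  using small_image[OF small_Sigma[OF assms], where f = snd]
  by (simp add: snd_image_Sigma)

lemma ex_small_inj:
  assumes "small U A"
  obtains f :: "'a \<Rightarrow> 'u" where "inj_on f A"
  using assms[unfolded small_def, THEN ordLess_imp_ordLeq] unfolding card_of_ordLeq[symmetric] by blast

lemma small_Pow:
  assumes "small U A" shows "small U (Pow A)"
proof -
  obtain f :: "'a \<Rightarrow> 'u" where f: "inj_on f A" using ex_small_inj assms by blast
  have "small U (Pow (f ` A))"
    using universe small_image[OF assms, of f] unfolding universe_def by blast
  moreover have "inj_on ((`) f) (Pow A)" using f by (simp add: inj_on_image_Pow)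
  ultimately show ?thesis by (elim small_inj[rotated 2]) auto
qed

text \<open>An extensional function is determined by its graph, a subset of
  \<open>Sigma A B\<close>, so closure under power sets suffices.\<close>

lemma small_PiE:
  assumes "small U A" "\<And>a. a \<in> A \<Longrightarrow> small U (B a)" shows "small U (Pi\<^sub>E A B)"
proof -
  have "small U (Pow (Sigma A B))" using assms small_Sigma small_Pow by blast
  moreover have "inj_on (\<lambda>f. (\<lambda>a. (a, f a)) ` A) (Pi\<^sub>E A B)"
  proof (rule inj_onI)
    fix f g assume fg: "f \<in> Pi\<^sub>E A B" "g \<in> Pi\<^sub>E A B" "(\<lambda>a. (a, f a)) ` A = (\<lambda>a. (a, g a)) ` A"
    have "f a = g a" if "a \<in> A" for a
    proof -
      have "(a, f a) \<in> (\<lambda>a. (a, g a)) ` A" using that fg(3) by blast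
      then show ?thesis by blast
    qed
    then show "f = g" by (rule PiE_ext[OF fg(1,2)])
  qed
  ultimately show ?thesis by (elim small_inj[rotated 2]) (auto simp: PiE_iff)
qed

text \<open>The infinity axiom of the universe, in the form needed for countable unions such as the
  stages of the tree construction.\<close>

lemma small_nat: "small U (UNIV :: nat set)"
proof -
  obtain A :: "'u set" where A: "infinite A" "small U A"
    using universe unfolding universe_def by blast
  then show ?thesis
    unfolding small_def using infinite_iff_card_of_nat[of A] ordLeq_ordLess_trans by blast
qed

end


section \<open>Labelled trees\<close>

text \<open>With options in an \<open>fset\<close>, order and multiplicity are invisible, so
  bisimilar trees are equal. This is what makes unfoldings unique.\<close>

datatype 'a tree = Node (lab: 'a) (opts: "'a tree fset")

context small_universe
begin

text \<open>Trees have finite height, so countably many stages exhaust those over \<open>A\<close>,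
  each stage being a power-set step over the previous one.\<close>

lemma small_trees:
  assumes "small U A" shows "small U {t. set_tree t \<subseteq> A}"
proof -
  \<comment> \<open>\<open>T n\<close> contains the trees over \<open>A\<close> of height at most
    \<open>n\<close>, leaves having height 1. For infinite \<open>B\<close> the value
    \<open>Abs_fset B\<close> is unspecified; the extra trees are harmless, since only a small
    superset is wanted.\<close>
  define T where "T = rec_nat {} (\<lambda>_ T. (\<lambda>(a, B). Node a (Abs_fset B)) ` (A \<times> Pow T))"
  have [simp]: "T 0 = {}"
    and T_Suc [simp]: "T (Suc n) = (\<lambda>(a, B). Node a (Abs_fset B)) ` (A \<times> Pow (T n))" for n
    by (simp_all add: T_def)
  have "small U (T n)" for n
    by (induct n) (auto intro: small_finite intro!: small_image small_Sigma small_Pow assms)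
  then have "small U (\<Union>n. T n)" using small_UN small_nat by blast
  moreover have mono: "T n \<subseteq> T m" if "n \<le> m" for n m
  proof -
    have "T n \<subseteq> T (Suc n)" for n
    proof (induct n)
      case (Suc n)
      then have "A \<times> Pow (T n) \<subseteq> A \<times> Pow (T (Suc n))" by blast
      then show ?case unfolding T_Suc by (rule image_mono)
    qed simp
    then show ?thesis using that lift_Suc_mono_le[of T] by blast
  qed
  have "t \<in> (\<Union>n. T n)" if "set_tree t \<subseteq> A" for t
    using that
  proof (induct t)
    case (Node a F)
    then have "\<forall>s\<in>fset F. \<exists>n. s \<in> T n" by fastforce
    then obtain n where n: "s \<in> T (n s)" if "s \<in> fset F" for s by metis
    \<comment> \<open>Finitely many options enter at stages \<open>n s\<close>, and by monotonicity
      the largest stage holds them all. For a leaf this maximum is unspecified, but then no option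
      has to be covered.\<close>
    have "fset F \<subseteq> T (Max (n ` fset F))"
    proof
      fix s assume s: "s \<in> fset F"
      then have "n s \<le> Max (n ` fset F)" by simp
      then show "s \<in> T (Max (n ` fset F))" using n[OF s] mono by blast
    qed
    then have "Node a F \<in> T (Suc (Max (n ` fset F)))"
      using Node.prems by (auto intro!: image_eqI[of _ _ "(a, fset F)"] simp: fset_inverse)
    then show ?case by blast
  qed
  ultimately show ?thesis by (elim small_subset[rotated]) auto
qed

end

section \<open>Games and path-lifting maps\<close>

lemma is_game_iff:
  "is_game G \<longleftrightarrow>
     snd G \<subseteq> fst G \<times> fst G \<and> (\<forall>x\<in>fst G. finite {x'. (x, x') \<in> snd G}) \<and> wf ((snd G)\<inverse>)"
  unfolding is_game_def wf_iff_no_infinite_down_chain by (simp add: case_prod_beta)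

lemma game_edge:
  assumes "is_game G" "(x, y) \<in> snd G" shows "x \<in> fst G" "y \<in> fst G"
  using assms by (auto simp: is_game_iff)

lemma game_finite:
  assumes "is_game G" shows "finite {y. (x, y) \<in> snd G}"
proof (cases "x \<in> fst G")
  case False
  then have "{y. (x, y) \<in> snd G} = {}" using game_edge(1)[OF assms] by auto
  then show ?thesis by simp
qed (use assms in \<open>simp add: is_game_iff\<close>)

lemma game_induct [consumes 2, case_names step]:
  assumes "is_game G" "x \<in> fst G"
    and step: "\<And>x. x \<in> fst G \<Longrightarrow> (\<And>y. (x, y) \<in> snd G \<Longrightarrow> P y) \<Longrightarrow> P x"
  shows "P x"
proof -
  have "wf ((snd G)\<inverse>)" using assms(1) by (simp add: is_game_iff)
  then have "x \<in> fst G \<longrightarrow> P x"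
  proof (induct x)
    case (less x)
    then show ?case using step game_edge(2)[OF assms(1)] by blast
  qed
  then show ?thesis using assms(2) by blast
qed

text \<open>
  Unlike \<^const>\<open>is_game_morphism\<close>, this allows different vertex types, and
  the values outside the domain are irrelevant.
\<close>

definition gmor :: "'x game \<Rightarrow> 'y game \<Rightarrow> ('x \<Rightarrow> 'y) \<Rightarrow> bool" where
  "gmor G H f \<longleftrightarrow>
     (\<forall>x\<in>fst G. f x \<in> fst H) \<and>
     (\<forall>x x'. (x, x') \<in> snd G \<longrightarrow> (f x, f x') \<in> snd H) \<and>
     (\<forall>x\<in>fst G. \<forall>y. (f x, y) \<in> snd H \<longrightarrow> (\<exists>x'. (x, x') \<in> snd G \<and> f x' = y))"

lemma is_game_morphism_iff:
  "is_game_morphism G H f \<longleftrightarrow> gmor G H f \<and> f \<in> extensional (fst G)"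
  unfolding is_game_morphism_def gmor_def by (auto simp: case_prod_beta PiE_def)

lemma gmorI:
  assumes "\<And>x. x \<in> fst G \<Longrightarrow> f x \<in> fst H"
    and "\<And>x x'. (x, x') \<in> snd G \<Longrightarrow> (f x, f x') \<in> snd H"
    and "\<And>x y. x \<in> fst G \<Longrightarrow> (f x, y) \<in> snd H \<Longrightarrow> \<exists>x'. (x, x') \<in> snd G \<and> f x' = y"
  shows "gmor G H f"
  using assms unfolding gmor_def by blast

lemma gmor_in: "gmor G H f \<Longrightarrow> x \<in> fst G \<Longrightarrow> f x \<in> fst H"
  unfolding gmor_def by blast

lemma gmor_edge: "gmor G H f \<Longrightarrow> (x, x') \<in> snd G \<Longrightarrow> (f x, f x') \<in> snd H"
  unfolding gmor_def by blast

lemma gmor_lift: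
  assumes "gmor G H f" "x \<in> fst G" "(f x, y) \<in> snd H"
  obtains x' where "(x, x') \<in> snd G" "f x' = y"
  using assms unfolding gmor_def by blast

text \<open>Path-lifting repeated along a path. It turns conditions on everything reachable from
  \<open>f x\<close> into conditions on values of \<open>f\<close>.\<close>

lemma gmor_lift_rtrancl:
  assumes "is_game G" "gmor G H f" "x \<in> fst G" "(f x, y) \<in> (snd H)\<^sup>*"
  obtains x' where "(x, x') \<in> (snd G)\<^sup>*" "x' \<in> fst G" "y = f x'"
proof -
  have "\<exists>x'. (x, x') \<in> (snd G)\<^sup>* \<and> x' \<in> fst G \<and> y = f x'"
    using assms(4)
  proof (induct rule: rtrancl_induct)
    case (step y z)
    then obtain x' where x': "(x, x') \<in> (snd G)\<^sup>*" "x' \<in> fst G" "y = f x'" by blast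
    then obtain x'' where "(x', x'') \<in> snd G" "f x'' = z"
      using gmor_lift[OF assms(2)] step(2) by metis
    then show ?case using x'(1) game_edge(2)[OF assms(1)] by (metis rtrancl.rtrancl_into_rtrancl)
  qed (use assms(3) in blast)
  then show thesis using that by blast
qed

lemma gmor_cong:
  assumes "is_game G" "\<And>x. x \<in> fst G \<Longrightarrow> f x = g x" "gmor G H f"
  shows "gmor G H g"
proof (rule gmorI)
  fix x y assume "x \<in> fst G" "(g x, y) \<in> snd H"
  then show "\<exists>x'. (x, x') \<in> snd G \<and> g x' = y"
    using assms gmor_lift[OF assms(3)] game_edge[OF assms(1)] by metis
qed (use assms game_edge[OF assms(1)] gmor_in gmor_edge in metis)+

lemma gmor_comp:
  assumes "gmor F G f" "gmor G H g" shows "gmor F H (\<lambda>x. g (f x))"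
proof (rule gmorI)
  fix x y assume x: "x \<in> fst F" "(g (f x), y) \<in> snd H"
  then obtain z where "(f x, z) \<in> snd G" "g z = y" using assms gmor_lift gmor_in by metis
  then show "\<exists>x'. (x, x') \<in> snd F \<and> g (f x') = y" using assms gmor_lift x by metis
qed (use assms gmor_in gmor_edge in metis)+

lemma gmor_ident: "gmor G G (\<lambda>x. x)"
  unfolding gmor_def by blast

text \<open>A move at \<open>p = f x\<close> lifts along \<open>f\<close> to a move at
  \<open>x\<close>, where the composite is already known to behave, and lifts along the composite
  are pushed forward by \<open>f\<close>. Thus the legs of a covering cocone detect
  morphisms.\<close>

lemma gmor_jointly_surjective:
  assumes G: "is_game G"
    and cover: "\<And>p. p \<in> fst G \<Longrightarrow>
      \<exists>(F :: 'z game) f x. gmor F G f \<and> gmor F H (\<lambda>x. h (f x)) \<and> x \<in> fst F \<and> f x = p"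
  shows "gmor G H h"
proof (rule gmorI)
  fix p assume "p \<in> fst G"
  from cover[OF this] obtain F :: "'z game" and f x where "gmor F H (\<lambda>x. h (f x))" "x \<in> fst F" "f x = p" by blast
  then show "h p \<in> fst H" using gmor_in by fastforce
next
  fix p q assume pq: "(p, q) \<in> snd G"
  from cover[OF game_edge(1)[OF G pq]] obtain F :: "'z game" and f x where
    f: "gmor F G f" "gmor F H (\<lambda>x. h (f x))" "x \<in> fst F" "f x = p" by blast
  with pq obtain x' where "(x, x') \<in> snd F" "f x' = q" using gmor_lift[OF f(1)] by metis
  then show "(h p, h q) \<in> snd H" using gmor_edge[OF f(2)] f(4) by metis
next
  fix p y assume p: "p \<in> fst G" "(h p, y) \<in> snd H"
  from cover[OF this(1)] obtain F :: "'z game" and f x where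
    f: "gmor F G f" "gmor F H (\<lambda>x. h (f x))" "x \<in> fst F" "f x = p" by blast
  with p obtain x' where "(x, x') \<in> snd F" "h (f x') = y" using gmor_lift[OF f(2)] by metis
  then show "\<exists>q. (p, q) \<in> snd G \<and> h q = y" using gmor_edge[OF f(1)] f(4) by metis
qed

text \<open>An infinite play in \<open>R\<close> would map to one in \<open>H\<close>:
  well-foundedness pulls back along any edge-preserving map, and only branching remains to be
  checked.\<close>

lemma is_game_over:
  assumes "is_game H" "R \<subseteq> X \<times> X" "\<And>x. x \<in> X \<Longrightarrow> finite {y. (x, y) \<in> R}"
    and "\<And>x y. (x, y) \<in> R \<Longrightarrow> (f x, f y) \<in> snd H"
  shows "is_game (X, R)"
proof -
  have "wf (inv_image ((snd H)\<inverse>) f)" using assms(1) by (simp add: is_game_iff)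
  then have "wf (R\<inverse>)"
    by (rule wf_subset) (use assms(4) in \<open>auto simp: inv_image_def\<close>)
  then show ?thesis using assms by (simp add: is_game_iff)
qed

text \<open>Path-lifting of the identity reflects edges. This is the source of strict uniqueness
  when colimits are created.\<close>

lemma gmor_unique_edges:
  assumes "is_game G" "is_game H" "fst G = fst H" "gmor G H (\<lambda>x. x)" shows "G = H"
proof -
  have "snd H \<subseteq> snd G"
  proof (rule subrelI)
    fix x y assume "(x, y) \<in> snd H"
    then show "(x, y) \<in> snd G" using assms(3) game_edge(1)[OF assms(2)] gmor_lift[OF assms(4)] by metis
  qed
  moreover have "snd G \<subseteq> snd H" by (rule subrelI) (rule gmor_edge[OF assms(4)])
  ultimately show ?thesis using assms(3) by (simp add: prod_eq_iff)
qed

text \<open>The subcoalgebras: closure under options is what makes the inclusion of \<open>E\<close>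
  path-lifting.\<close>

definition closed_in :: "'x game \<Rightarrow> 'x set \<Rightarrow> bool" where
  "closed_in G E \<longleftrightarrow> E \<subseteq> fst G \<and> (\<forall>x y. x \<in> E \<longrightarrow> (x, y) \<in> snd G \<longrightarrow> y \<in> E)"

definition subgame :: "'x game \<Rightarrow> 'x set \<Rightarrow> 'x game" where
  "subgame G E = (E, {(x, y) \<in> snd G. x \<in> E})"

lemma fst_subgame [simp]: "fst (subgame G E) = E"
  by (simp add: subgame_def)

lemma is_game_subgame:
  assumes "is_game G" "closed_in G E" shows "is_game (subgame G E)"
  unfolding subgame_def
proof (rule is_game_over[OF assms(1), where f = "\<lambda>x. x"])
  fix x show "finite {y. (x, y) \<in> {(x, y). (x, y) \<in> snd G \<and> x \<in> E}}"
    using finite_subset[OF _ game_finite[OF assms(1), of x]] by auto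
qed (use assms in \<open>auto simp: closed_in_def\<close>)

lemma gmor_subgame: "closed_in G E \<Longrightarrow> gmor (subgame G E) G (\<lambda>x. x)"
  unfolding gmor_def subgame_def closed_in_def by auto

lemma gmor_into_subgame:
  assumes "is_game Y" "gmor Y G f" "\<And>y. y \<in> fst Y \<Longrightarrow> f y \<in> E"
  shows "gmor Y (subgame G E) f"
  using assms game_edge(1)[OF assms(1)] unfolding gmor_def subgame_def by auto

lemma closed_in_image:
  assumes "is_game Y" "gmor Y G f" shows "closed_in G (f ` fst Y)"
  unfolding closed_in_def
proof (intro conjI allI impI)
  fix p q assume "p \<in> f ` fst Y" "(p, q) \<in> snd G"
  then obtain x x' where "p = f x" "(x, x') \<in> snd Y" "f x' = q"
    using gmor_lift[OF assms(2)] by blast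
  then show "q \<in> f ` fst Y" using game_edge(2)[OF assms(1)] by blast
qed (use gmor_in[OF assms(2)] in auto)

text \<open>Used with injective \<phi> only, to move a game from an auxiliary type into
  \<open>'u\<close>, or onto a prescribed set of names.\<close>

definition image_game :: "('x \<Rightarrow> 'y) \<Rightarrow> 'x game \<Rightarrow> 'y game" where
  "image_game \<phi> G = (\<phi> ` fst G, map_prod \<phi> \<phi> ` snd G)"

lemma fst_image_game [simp]: "fst (image_game \<phi> G) = \<phi> ` fst G"
  by (simp add: image_game_def)

context
  fixes G :: "'x game" and \<phi> :: "'x \<Rightarrow> 'y"
  assumes G: "is_game G" and inj: "inj_on \<phi> (fst G)"
begin

lemma image_game_edgeD:
  assumes "(p, q) \<in> snd (image_game \<phi> G)"
  shows "(inv_into (fst G) \<phi> p, inv_into (fst G) \<phi> q) \<in> snd G"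
proof -
  obtain x y where "(x, y) \<in> snd G" "p = \<phi> x" "q = \<phi> y" using assms by (auto simp: image_game_def)
  then show ?thesis using game_edge[OF G] inj by (metis inv_into_f_f)
qed

lemma is_game_image_game: "is_game (image_game \<phi> G)"
  unfolding image_game_def
proof (rule is_game_over[OF G, where f = "inv_into (fst G) \<phi>"])
  fix p assume "p \<in> \<phi> ` fst G"
  then obtain x where x: "x \<in> fst G" "p = \<phi> x" by blast
  have "{q. (p, q) \<in> map_prod \<phi> \<phi> ` snd G} \<subseteq> \<phi> ` {y. (x, y) \<in> snd G}"
    using x inj game_edge[OF G] by (auto simp: inj_on_eq_iff)
  then show "finite {q. (p, q) \<in> map_prod \<phi> \<phi> ` snd G}"
    using game_finite[OF G] finite_subset finite_imageI by metis
qed (use game_edge[OF G] image_game_edgeD in \<open>auto simp: image_game_def\<close>)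

lemma gmor_image_game: "gmor G (image_game \<phi> G) \<phi>"
proof (rule gmorI)
  fix x y assume "x \<in> fst G" "(\<phi> x, y) \<in> snd (image_game \<phi> G)"
  then show "\<exists>x'. (x, x') \<in> snd G \<and> \<phi> x' = y"
    using inj game_edge[OF G] by (auto simp: image_game_def inj_on_eq_iff)
qed (auto simp: image_game_def)

lemma gmor_image_game_inv: "gmor (image_game \<phi> G) G (inv_into (fst G) \<phi>)"
proof (rule gmorI)
  fix p y assume "p \<in> fst (image_game \<phi> G)" "(inv_into (fst G) \<phi> p, y) \<in> snd G"
  then have "(p, \<phi> y) \<in> snd (image_game \<phi> G)"
    by (force simp: image_game_def f_inv_into_f intro: image_eqI[where x = "(inv_into (fst G) \<phi> p, y)"])
  moreover have "inv_into (fst G) \<phi> (\<phi> y) = y"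
    using inj game_edge(2)[OF G \<open>(_, y) \<in> snd G\<close>] by simp
  ultimately show "\<exists>q. (p, q) \<in> snd (image_game \<phi> G) \<and> inv_into (fst G) \<phi> q = y" by blast
qed (use image_game_edgeD in \<open>auto simp: inv_into_into\<close>)

end


section \<open>Cofree games\<close>

definition tree_game :: "'a set \<Rightarrow> 'a tree game" where
  "tree_game A =
     ({t. set_tree t \<subseteq> A}, {(t, s). set_tree t \<subseteq> A \<and> s |\<in>| opts t})"

lemma set_tree_opts: "s |\<in>| opts t \<Longrightarrow> set_tree s \<subseteq> set_tree t"
  by (cases t) auto

lemma size_opts: "s |\<in>| opts t \<Longrightarrow> size s < size t"
proof (cases t)
  case (Node a F)
  moreover assume "s |\<in>| opts t"
  ultimately have "Suc (size s) \<le> (\<Sum>x\<in>fset F. Suc (size x))"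
    by (intro member_le_sum) auto
  then show ?thesis using Node by (simp add: size_fset_overloaded_simps)
qed

lemma is_game_tree_game: "is_game (tree_game A)"
proof -
  have "{(t, s). set_tree t \<subseteq> A \<and> s |\<in>| opts t}\<inverse> \<subseteq> measure size"
    using size_opts by auto
  then have "wf ({(t, s). set_tree t \<subseteq> A \<and> s |\<in>| opts t}\<inverse>)" using wf_subset wf_measure by blast
  then show ?thesis
    using set_tree_opts by (fastforce simp: is_game_iff tree_game_def)
qed

text \<open>Well-founded recursion along moves: finite branching makes the set of subtrees already
  computed a legitimate \<open>fset\<close>.\<close>

lemma tree_game_unfold:
  assumes Y: "is_game Y" and f: "\<And>y. y \<in> fst Y \<Longrightarrow> f y \<in> A"
  shows "\<exists>u. gmor Y (tree_game A) u \<and> (\<forall>y\<in>fst Y. lab (u y) = f y)"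
proof -
  let ?F = "\<lambda>u y. Node (f y) (Abs_fset (u ` {z. (y, z) \<in> snd Y}))"
  define u where "u = wfrec ((snd Y)\<inverse>) ?F"
  have "wf ((snd Y)\<inverse>)" using Y by (simp add: is_game_iff)
  then have "u y = ?F (cut u ((snd Y)\<inverse>) y) y" for y unfolding u_def by (rule wfrec)
  \<comment> \<open>\<open>wfrec\<close> only provides the values at options of \<open>y\<close>; as
    \<open>?F\<close> consults no others, \<open>cut\<close> disappears.\<close>
  moreover have "cut u ((snd Y)\<inverse>) y ` {z. (y, z) \<in> snd Y} = u ` {z. (y, z) \<in> snd Y}" for y
    by (rule image_cong) (simp_all add: cut_apply)
  ultimately have u: "u y = ?F u y" for y by metis
  then have opts: "s |\<in>| opts (u y) \<longleftrightarrow> s \<in> u ` {z. (y, z) \<in> snd Y}" for s y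
  proof -
    have "opts (u y) = Abs_fset (u ` {z. (y, z) \<in> snd Y})" by (subst u) simp
    then show ?thesis using game_finite[OF Y, of y] by (simp add: Abs_fset_inverse)
  qed
  have set: "set_tree (u y) = insert (f y) (\<Union>z\<in>{z. (y, z) \<in> snd Y}. set_tree (u z))" for y
    using opts[of _ y] by (subst u) (auto simp: u[of y])
  have in_A: "set_tree (u y) \<subseteq> A" if "y \<in> fst Y" for y
    using Y that
  proof (induct y rule: game_induct)
    case (step y)
    then show ?case using f[of y] by (subst set) auto
  qed
  have "gmor Y (tree_game A) u"
    by (rule gmorI) (use in_A game_edge(1)[OF Y] opts in \<open>auto simp: tree_game_def\<close>)
  moreover have "lab (u y) = f y" for y by (subst u) simp
  ultimately show ?thesis by blast
qed

text \<open>Edge preservation and path-lifting together force the options of \<open>u y\<close> to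
  be exactly the images of the options of \<open>y\<close>. Induction along moves and extensionality
  of \<open>fset\<close> do the rest.\<close>

lemma tree_game_unique:
  assumes Y: "is_game Y" and u: "gmor Y (tree_game A) u" and v: "gmor Y (tree_game A) v"
    and lab: "\<And>y. y \<in> fst Y \<Longrightarrow> lab (u y) = lab (v y)"
    and "y \<in> fst Y"
  shows "u y = v y"
  using Y \<open>y \<in> fst Y\<close>
proof (induct y rule: game_induct)
  case (step y)
  have opts: "fset (opts (w y)) = w ` {z. (y, z) \<in> snd Y}" if "gmor Y (tree_game A) w" for w
  proof -
    have "s |\<in>| opts (w y) \<longleftrightarrow> (w y, s) \<in> snd (tree_game A)" for s
      using gmor_in[OF that step(1)] by (simp add: tree_game_def)
    then show ?thesis using gmor_edge[OF that] gmor_lift[OF that step(1)] by blast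
  qed
  have "fset (opts (u y)) = fset (opts (v y))"
    unfolding opts[OF u] opts[OF v] using step(2) by (intro image_cong) auto
  then show ?case using lab[OF step(1)] by (simp add: tree.expand fset_inject)
qed

context small_universe
begin

definition Game_ob :: "'u game \<Rightarrow> bool" where
  "Game_ob G \<longleftrightarrow> is_game G \<and> small U (fst G)"

text \<open>The couniversal arrow from the forgetful functor to \<open>A\<close>. Uniqueness is
  stated pointwise on \<open>fst Y\<close>, because \<open>u\<close> and \<open>v\<close> are raw
  functions with arbitrary values elsewhere.\<close>

definition cofree :: "'u set \<Rightarrow> 'u game \<Rightarrow> ('u \<Rightarrow> 'u) \<Rightarrow> bool" where
  "cofree A G c \<longleftrightarrow> Game_ob G \<and> c \<in> fst G \<rightarrow>\<^sub>E A \<and>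
     (\<forall>Y f. Game_ob Y \<longrightarrow> f \<in> fst Y \<rightarrow> A \<longrightarrow>
        (\<exists>u. gmor Y G u \<and> (\<forall>y\<in>fst Y. c (u y) = f y))) \<and>
     (\<forall>Y u v. Game_ob Y \<longrightarrow> gmor Y G u \<longrightarrow> gmor Y G v \<longrightarrow>
        (\<forall>y\<in>fst Y. c (u y) = c (v y)) \<longrightarrow> (\<forall>y\<in>fst Y. u y = v y))"

text \<open>The tree game has the universal property but lives on \<open>'u tree\<close>. Its vertex
  set is small, so an injection moves it into \<open>'u\<close>, and labels are read through the
  inverse.\<close>

lemma ex_cofree:
  assumes "small U A" shows "\<exists>G c. cofree A G c"
proof -
  let ?T = "tree_game A"
  have small: "small U (fst ?T)" using small_trees[OF assms] by (simp add: tree_game_def)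
  then obtain \<phi> :: "'u tree \<Rightarrow> 'u" where \<phi>: "inj_on \<phi> (fst ?T)" using ex_small_inj by blast
  let ?inv = "inv_into (fst ?T) \<phi>"
  let ?G = "image_game \<phi> ?T"
  define c where "c = restrict (lab \<circ> ?inv) (fst ?G)"
  note tree_game = is_game_tree_game[of A]
  note forth = gmor_image_game[OF tree_game \<phi>]
  note inv = gmor_image_game_inv[OF tree_game \<phi>]
  have c: "c (\<phi> t) = lab t" if "t \<in> fst ?T" for t
    using that \<phi> by (simp add: c_def)
  have "lab t \<in> A" if "t \<in> fst ?T" for t
    using that tree.set_sel(1)[of t] by (auto simp: tree_game_def)
  then have "c \<in> fst ?G \<rightarrow>\<^sub>E A" using \<phi> by (auto simp: c_def)
  moreover have "Game_ob ?G"
    using small is_game_image_game[OF tree_game \<phi>] by (simp add: Game_ob_def small_image)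
  moreover have "\<exists>u. gmor Y ?G u \<and> (\<forall>y\<in>fst Y. c (u y) = f y)"
    if "Game_ob Y" "f \<in> fst Y \<rightarrow> A" for Y f
  proof -
    obtain u where u: "gmor Y ?T u" "\<forall>y\<in>fst Y. lab (u y) = f y"
      using tree_game_unfold[of Y f A] \<open>Game_ob Y\<close> \<open>f \<in> fst Y \<rightarrow> A\<close> by (auto simp: Game_ob_def)
    then have "gmor Y ?G (\<lambda>y. \<phi> (u y))" "\<forall>y\<in>fst Y. c (\<phi> (u y)) = f y"
      using gmor_comp[OF u(1) forth] c gmor_in[OF u(1)] by auto
    then show ?thesis by blast
  qed
  moreover have "\<forall>y\<in>fst Y. u y = v y"
    if "Game_ob Y" and uv: "gmor Y ?G u" "gmor Y ?G v" and c: "\<forall>y\<in>fst Y. c (u y) = c (v y)" for Y u v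
  proof
    fix y assume y: "y \<in> fst Y"
    have "lab (?inv (u y)) = lab (?inv (v y))" if "y \<in> fst Y" for y
      using bspec[OF c that] gmor_in[OF uv(1) that] gmor_in[OF uv(2) that] unfolding c_def
      by (auto simp del: fst_image_game)
    then have "?inv (u y) = ?inv (v y)"
      using tree_game_unique[OF _ gmor_comp[OF uv(1) inv] gmor_comp[OF uv(2) inv]]
        \<open>Game_ob Y\<close> y by (simp add: Game_ob_def)
    then show "u y = v y"
      using gmor_in[OF uv(1) y] gmor_in[OF uv(2) y] by (simp add: inv_into_injective)
  qed
  ultimately show ?thesis unfolding cofree_def by blast
qed

end

section \<open>The categories of sets and of games\<close>

abbreviation fn :: "'a \<times> 'b \<times> 'c \<Rightarrow> 'c" where
  "fn a \<equiv> snd (snd a)"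

text \<open>Restriction picks the extensional representative that an arrow must carry, so arrows can
  be built from raw functions; likewise for \<open>garr\<close>.\<close>

definition sarr :: "'x set \<Rightarrow> 'x set \<Rightarrow> ('x \<Rightarrow> 'x) \<Rightarrow> 'x set \<times> 'x set \<times> ('x \<Rightarrow> 'x)" where
  "sarr A B f = (A, B, restrict f A)"

definition garr :: "'x game \<Rightarrow> 'x game \<Rightarrow> ('x \<Rightarrow> 'x) \<Rightarrow> 'x game \<times> 'x game \<times> ('x \<Rightarrow> 'x)" where
  "garr G H f = (G, H, restrict f (fst G))"

lemma categoryI:
  assumes "\<And>f. f \<in> Ar C \<Longrightarrow> src C f \<in> Ob C \<and> tgt C f \<in> Ob C"
    and "\<And>x. x \<in> Ob C \<Longrightarrow> idn C x \<in> hom C x x"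
    and "\<And>x y z f g. f \<in> hom C x y \<Longrightarrow> g \<in> hom C y z \<Longrightarrow> cmp C g f \<in> hom C x z"
    and "\<And>x y f. f \<in> hom C x y \<Longrightarrow> cmp C f (idn C x) = f \<and> cmp C (idn C y) f = f"
    and "\<And>w x y z f g h. f \<in> hom C w x \<Longrightarrow> g \<in> hom C x y \<Longrightarrow> h \<in> hom C y z \<Longrightarrow>
      cmp C h (cmp C g f) = cmp C (cmp C h g) f"
  shows "category C"
  using assms unfolding category_def by blast

lemma category_hom_Ob: "category C \<Longrightarrow> f \<in> hom C x y \<Longrightarrow> x \<in> Ob C \<and> y \<in> Ob C"
  unfolding category_def hom_def by blast

lemma category_cmp: "category C \<Longrightarrow> f \<in> hom C x y \<Longrightarrow> g \<in> hom C y z \<Longrightarrow> cmp C g f \<in> hom C x z"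
  unfolding category_def by blast

lemma category_idn: "category C \<Longrightarrow> x \<in> Ob C \<Longrightarrow> idn C x \<in> hom C x x"
  unfolding category_def by blast

lemma category_unit:
  assumes "category C" "f \<in> hom C x y"
  shows "cmp C f (idn C x) = f" "cmp C (idn C y) f = f"
  using assms unfolding category_def by blast+

lemma category_assoc:
  assumes "category C" "f \<in> hom C w x" "g \<in> hom C x y" "h \<in> hom C y z"
  shows "cmp C h (cmp C g f) = cmp C (cmp C h g) f"
  using assms unfolding category_def by blast

lemma functorI:
  assumes "category C" "category D" "\<And>x. x \<in> Ob C \<Longrightarrow> omap F x \<in> Ob D"
    and "\<And>x y f. f \<in> hom C x y \<Longrightarrow> amap F f \<in> hom D (omap F x) (omap F y)"
    and "\<And>x. x \<in> Ob C \<Longrightarrow> amap F (idn C x) = idn D (omap F x)"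
    and "\<And>x y z f g. f \<in> hom C x y \<Longrightarrow> g \<in> hom C y z \<Longrightarrow>
      amap F (cmp C g f) = cmp D (amap F g) (amap F f)"
  shows "is_functor C D F"
  using assms unfolding is_functor_def by blast

lemma functor_idn: "is_functor C D F \<Longrightarrow> x \<in> Ob C \<Longrightarrow> amap F (idn C x) = idn D (omap F x)"
  unfolding is_functor_def by blast

lemma functor_hom: "is_functor C D F \<Longrightarrow> f \<in> hom C x y \<Longrightarrow> amap F f \<in> hom D (omap F x) (omap F y)"
  unfolding is_functor_def by blast

lemma functor_Ob: "is_functor C D F \<Longrightarrow> x \<in> Ob C \<Longrightarrow> omap F x \<in> Ob D"
  unfolding is_functor_def by blast

lemma functor_cmp:
  "is_functor C D F \<Longrightarrow> f \<in> hom C x y \<Longrightarrow> g \<in> hom C y z \<Longrightarrow>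
     amap F (cmp C g f) = cmp D (amap F g) (amap F f)"
  unfolding is_functor_def by blast

lemma functor_category: "is_functor C D F \<Longrightarrow> category C" "is_functor C D F \<Longrightarrow> category D"
  unfolding is_functor_def by blast+

lemma functor_comp:
  assumes "is_functor B C F" "is_functor C D G" shows "is_functor B D (comp_func G F)"
proof (rule functorI)
  show "amap (comp_func G F) (idn B x) = idn D (omap (comp_func G F) x)" if "x \<in> Ob B" for x
    using that functor_idn[OF assms(1)] functor_idn[OF assms(2) functor_Ob[OF assms(1)]]
    by (simp add: comp_func_def)
  show "amap (comp_func G F) (cmp B g f) = cmp D (amap (comp_func G F) g) (amap (comp_func G F) f)"
    if f: "f \<in> hom B x y" and g: "g \<in> hom B y z" for x y z f g
    using functor_cmp[OF assms(1) f g]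
      functor_cmp[OF assms(2) functor_hom[OF assms(1) f] functor_hom[OF assms(1) g]]
    by (simp add: comp_func_def)
qed (auto simp: comp_func_def intro: functor_category[OF assms(1)] functor_category[OF assms(2)]
    functor_Ob[OF assms(2)] functor_Ob[OF assms(1)] functor_hom[OF assms(2)] functor_hom[OF assms(1)])

lemma comp_func_simps [simp]:
  "omap (comp_func G F) x = omap G (omap F x)" "amap (comp_func G F) f = amap G (amap F f)"
  by (simp_all add: comp_func_def)

context small_universe
begin

section \<open>Elementwise reasoning in the category of sets\<close>

lemma hom_set:
  "a \<in> hom (set_cat U) A B \<longleftrightarrow>
     a = (A, B, fn a) \<and> small U A \<and> small U B \<and> fn a \<in> A \<rightarrow>\<^sub>E B"
  unfolding hom_def set_cat_def by auto

lemma hom_setD: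
  assumes "a \<in> hom (set_cat U) A B"
  shows "small U A" "small U B" "\<And>x. x \<in> A \<Longrightarrow> fn a x \<in> B"
  using assms unfolding hom_set by auto

lemma Ob_set: "Ob (set_cat U) = {A. small U A}"
  by (simp add: set_cat_def)

lemma hom_set_eqI:
  assumes "a \<in> hom (set_cat U) A B" "b \<in> hom (set_cat U) A B" "\<And>x. x \<in> A \<Longrightarrow> fn a x = fn b x"
  shows "a = b"
  using assms PiE_ext[of "fn a" A "\<lambda>_. B" "fn b"] unfolding hom_set by metis

lemma sarr_hom:
  assumes "small U A" "small U B" "\<And>x. x \<in> A \<Longrightarrow> f x \<in> B"
  shows "sarr A B f \<in> hom (set_cat U) A B"
  using assms unfolding hom_set sarr_def by auto

lemma fn_sarr [simp]: "x \<in> A \<Longrightarrow> fn (sarr A B f) x = f x"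
  by (simp add: sarr_def)

lemma idn_set: "idn (set_cat U) A = sarr A A (\<lambda>x. x)"
  by (simp add: set_cat_def sarr_def)

lemma fn_idn_set [simp]: "x \<in> A \<Longrightarrow> fn (idn (set_cat U) A) x = x"
  by (simp add: idn_set)

lemma cmp_set_hom:
  assumes "a \<in> hom (set_cat U) A B" "b \<in> hom (set_cat U) B C"
  shows "cmp (set_cat U) b a \<in> hom (set_cat U) A C"
  using assms unfolding hom_set by (cases a; cases b) (auto simp: set_cat_def compose_def)

lemma fn_cmp_set:
  assumes "a \<in> hom (set_cat U) A B" "x \<in> A"
  shows "fn (cmp (set_cat U) b a) x = fn b (fn a x)"
  using assms unfolding hom_set by (cases a; cases b) (auto simp: set_cat_def compose_eq)

lemma category_set: "category (set_cat U)"
proof (rule categoryI)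
  show "src (set_cat U) f \<in> Ob (set_cat U) \<and> tgt (set_cat U) f \<in> Ob (set_cat U)" if "f \<in> Ar (set_cat U)" for f
    using that by (auto simp: set_cat_def)
  have id: "idn (set_cat U) A \<in> hom (set_cat U) A A" if "small U A" for A
    using that by (simp add: idn_set sarr_hom)
  show "idn (set_cat U) A \<in> hom (set_cat U) A A" if "A \<in> Ob (set_cat U)" for A
    using that id by (simp add: Ob_set)
  show "cmp (set_cat U) f (idn (set_cat U) A) = f \<and> cmp (set_cat U) (idn (set_cat U) B) f = f"
    if f: "f \<in> hom (set_cat U) A B" for A B f
  proof
    note small = hom_setD(1,2)[OF f]
    show "cmp (set_cat U) f (idn (set_cat U) A) = f"
      by (rule hom_set_eqI[OF cmp_set_hom[OF id f] f])
        (simp_all add: small fn_cmp_set[OF id])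
    show "cmp (set_cat U) (idn (set_cat U) B) f = f"
      by (rule hom_set_eqI[OF cmp_set_hom[OF f id] f])
        (simp_all add: small fn_cmp_set[OF f] hom_setD(3)[OF f])
  qed
  show "cmp (set_cat U) h (cmp (set_cat U) g f) = cmp (set_cat U) (cmp (set_cat U) h g) f"
    if f: "f \<in> hom (set_cat U) A B" and g: "g \<in> hom (set_cat U) B C"
      and h: "h \<in> hom (set_cat U) C E" for A B C E f g h
    by (rule hom_set_eqI[OF cmp_set_hom[OF cmp_set_hom[OF f g] h] cmp_set_hom[OF f cmp_set_hom[OF g h]]])
      (simp add: fn_cmp_set[OF cmp_set_hom[OF f g]] fn_cmp_set[OF f] fn_cmp_set[OF g] hom_setD(3)[OF f])
qed (use cmp_set_hom in auto)

section \<open>Elementwise reasoning in the category of games\<close>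

lemma Ob_game: "Ob (game_cat U) = {G. Game_ob G}"
  by (simp add: game_cat_def Let_def Game_ob_def)

lemma Game_obD: "Game_ob G \<Longrightarrow> is_game G" "Game_ob G \<Longrightarrow> small U (fst G)"
  by (simp_all add: Game_ob_def)

lemma hom_game:
  "a \<in> hom (game_cat U) G H \<longleftrightarrow>
     a = (G, H, fn a) \<and> Game_ob G \<and> Game_ob H \<and> gmor G H (fn a) \<and> fn a \<in> extensional (fst G)"
  by (cases a) (auto simp: hom_def game_cat_def Let_def Game_ob_def is_game_morphism_iff)

lemma hom_gameD:
  assumes "a \<in> hom (game_cat U) G H"
  shows "Game_ob G" "Game_ob H" "gmor G H (fn a)" "\<And>x. x \<in> fst G \<Longrightarrow> fn a x \<in> fst H"
  using assms gmor_in[of G H "fn a"] unfolding hom_game by blast+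

lemma hom_game_eqI:
  assumes "a \<in> hom (game_cat U) G H" "b \<in> hom (game_cat U) G H"
    and "\<And>x. x \<in> fst G \<Longrightarrow> fn a x = fn b x"
  shows "a = b"
  using assms extensionalityI[of "fn a" "fst G" "fn b"] unfolding hom_game by metis

lemma garr_hom:
  assumes "Game_ob G" "Game_ob H" "gmor G H f"
  shows "garr G H f \<in> hom (game_cat U) G H"
  using assms gmor_cong[OF Game_obD(1)[OF assms(1)] _ assms(3), of "restrict f (fst G)"]
  unfolding hom_game garr_def by auto

lemma fn_garr [simp]: "x \<in> fst G \<Longrightarrow> fn (garr G H f) x = f x"
  by (simp add: garr_def)

lemma idn_game: "idn (game_cat U) G = garr G G (\<lambda>x. x)"
  by (simp add: game_cat_def garr_def Let_def)

lemma fn_idn_game [simp]: "x \<in> fst G \<Longrightarrow> fn (idn (game_cat U) G) x = x"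
  by (simp add: idn_game)

lemma fn_cmp_game:
  assumes "a \<in> hom (game_cat U) G H" "x \<in> fst G"
  shows "fn (cmp (game_cat U) b a) x = fn b (fn a x)"
  using assms unfolding hom_game by (cases a; cases b) (auto simp: game_cat_def Let_def compose_eq)

lemma cmp_game_hom:
  assumes a: "a \<in> hom (game_cat U) G H" and b: "b \<in> hom (game_cat U) H K"
  shows "cmp (game_cat U) b a \<in> hom (game_cat U) G K"
proof -
  have "gmor G K (\<lambda>x. fn b (fn a x))" using a b gmor_comp hom_gameD(3) by blast
  then have "garr G K (\<lambda>x. fn b (fn a x)) \<in> hom (game_cat U) G K"
    by (rule garr_hom[OF hom_gameD(1)[OF a] hom_gameD(2)[OF b]])
  moreover have "cmp (game_cat U) b a = garr G K (\<lambda>x. fn b (fn a x))"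
    using a b unfolding hom_game
    by (cases a; cases b) (auto simp: game_cat_def Let_def garr_def compose_def)
  ultimately show ?thesis by simp
qed

lemma category_game: "category (game_cat U)"
proof (rule categoryI)
  show "src (game_cat U) f \<in> Ob (game_cat U) \<and> tgt (game_cat U) f \<in> Ob (game_cat U)" if "f \<in> Ar (game_cat U)" for f
    using that by (auto simp: game_cat_def Let_def)
  have id: "idn (game_cat U) G \<in> hom (game_cat U) G G" if "Game_ob G" for G
    using that by (simp add: idn_game garr_hom gmor_ident)
  show "idn (game_cat U) G \<in> hom (game_cat U) G G" if "G \<in> Ob (game_cat U)" for G
    using that id by (simp add: Ob_game)
  show "cmp (game_cat U) f (idn (game_cat U) A) = f \<and> cmp (game_cat U) (idn (game_cat U) B) f = f"
    if f: "f \<in> hom (game_cat U) A B" for A B f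
  proof
    note ob = hom_gameD(1,2)[OF f]
    show "cmp (game_cat U) f (idn (game_cat U) A) = f"
      by (rule hom_game_eqI[OF cmp_game_hom[OF id f] f])
        (simp_all add: ob fn_cmp_game[OF id])
    show "cmp (game_cat U) (idn (game_cat U) B) f = f"
      by (rule hom_game_eqI[OF cmp_game_hom[OF f id] f])
        (simp_all add: ob fn_cmp_game[OF f] hom_gameD(4)[OF f])
  qed
  show "cmp (game_cat U) h (cmp (game_cat U) g f) = cmp (game_cat U) (cmp (game_cat U) h g) f"
    if f: "f \<in> hom (game_cat U) A B" and g: "g \<in> hom (game_cat U) B C"
      and h: "h \<in> hom (game_cat U) C E" for A B C E f g h
    by (rule hom_game_eqI[OF cmp_game_hom[OF cmp_game_hom[OF f g] h] cmp_game_hom[OF f cmp_game_hom[OF g h]]])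
      (simp add: fn_cmp_game[OF cmp_game_hom[OF f g]] fn_cmp_game[OF f] fn_cmp_game[OF g] hom_gameD(4)[OF f])
qed (use cmp_game_hom in auto)

section \<open>The forgetful functor\<close>

lemma omap_forgetful [simp]: "omap forgetful G = fst G"
  and fn_forgetful [simp]: "fn (amap forgetful a) = fn a"
  by (simp_all add: forgetful_def case_prod_beta)

lemma forgetful_hom:
  "a \<in> hom (game_cat U) G H \<Longrightarrow> amap forgetful a \<in> hom (set_cat U) (fst G) (fst H)"
  by (cases a) (auto simp: hom_game hom_set forgetful_def Game_ob_def gmor_in[simplified] PiE_iff)

lemma forgetful_garr: "amap forgetful (garr G H f) = sarr (fst G) (fst H) f"
  by (simp add: forgetful_def garr_def sarr_def)

lemma forgetful_cmp:
  assumes a: "a \<in> hom (game_cat U) G H" and b: "b \<in> hom (game_cat U) H K"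
  shows "amap forgetful (cmp (game_cat U) b a) =
    cmp (set_cat U) (amap forgetful b) (amap forgetful a)"
  by (rule hom_set_eqI[OF forgetful_hom[OF cmp_game_hom[OF a b]]
        cmp_set_hom[OF forgetful_hom[OF a] forgetful_hom[OF b]]])
    (simp add: fn_cmp_game[OF a] fn_cmp_set[OF forgetful_hom[OF a]])

lemma functor_forgetful: "is_functor (game_cat U) (set_cat U) forgetful"
  unfolding is_functor_def
  by (auto simp: category_game category_set Ob_game Ob_set Game_obD forgetful_hom forgetful_cmp
      idn_game idn_set forgetful_garr)


end


section \<open>Colimits\<close>

text \<open>The equivalence relation generated by the diagram on the disjoint union of its sets; the
  quotient by it is the colimit of sets.\<close>

definition zigzag :: "('i, 'j) cat \<Rightarrow> ('i, 'j, 'x set, 'x set \<times> 'x set \<times> ('x \<Rightarrow> 'x)) func \<Rightarrow>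
    (('i \<times> 'x) \<times> ('i \<times> 'x)) set" where
  "zigzag J D =
     (let S = {((i, x), (j, fn (amap D u) x)) | i j u x. u \<in> hom J i j \<and> x \<in> omap D i} in (S \<union> S\<inverse>)\<^sup>*)"

lemma zigzag_refl: "(p, p) \<in> zigzag J D"
  by (simp add: zigzag_def Let_def)

lemma zigzag_arrow:
  assumes "u \<in> hom J i j" "x \<in> omap D i"
  shows "((i, x), (j, fn (amap D u) x)) \<in> zigzag J D"
  unfolding zigzag_def Let_def by (rule r_into_rtrancl) (use assms in blast)

lemma zigzag_sym: "(p, q) \<in> zigzag J D \<Longrightarrow> (q, p) \<in> zigzag J D"
proof -
  have "sym (zigzag J D)" unfolding zigzag_def Let_def by (intro sym_rtrancl sym_Un_converse)
  then show "(p, q) \<in> zigzag J D \<Longrightarrow> (q, p) \<in> zigzag J D" by (rule symD)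
qed

lemma zigzag_trans: "(p, q) \<in> zigzag J D \<Longrightarrow> (q, r) \<in> zigzag J D \<Longrightarrow> (p, r) \<in> zigzag J D"
  unfolding zigzag_def Let_def by (rule rtrancl_trans)

lemma zigzag_induct [consumes 1, case_names refl fwd bwd]:
  assumes "((i, x), (j, y)) \<in> zigzag J D"
    and refl: "P i x"
    and fwd: "\<And>j y k u. P j y \<Longrightarrow> u \<in> hom J j k \<Longrightarrow> y \<in> omap D j \<Longrightarrow> P k (fn (amap D u) y)"
    and bwd: "\<And>j k z u. P j (fn (amap D u) z) \<Longrightarrow> u \<in> hom J k j \<Longrightarrow> z \<in> omap D k \<Longrightarrow> P k z"
  shows "P j y"
proof -
  have "P (fst q) (snd q)" if "((i, x), q) \<in> zigzag J D" for q
    using that unfolding zigzag_def Let_def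
    by (induct rule: rtrancl_induct) (auto intro: refl fwd bwd)
  then show ?thesis using assms(1) by fastforce
qed

text \<open>Joint surjectivity and \<open>kernel_zigzag\<close> together identify a cocone of sets
  with the quotient by zigzags. This elementwise form of the colimit property is what passes between
  sets and games.\<close>

definition jointly_surjective where
  "jointly_surjective J D l c \<longleftrightarrow> (\<forall>p\<in>l. \<exists>i\<in>Ob J. \<exists>x\<in>omap D i. fn (c i) x = p)"

definition kernel_zigzag where
  "kernel_zigzag J D c \<longleftrightarrow>
     (\<forall>i\<in>Ob J. \<forall>j\<in>Ob J. \<forall>x\<in>omap D i. \<forall>y\<in>omap D j.
        fn (c i) x = fn (c j) y \<longrightarrow> ((i, x), (j, y)) \<in> zigzag J D)"

lemma functor_cocone:
  assumes D: "is_functor J C D" and F: "is_functor C E F" and l: "is_cocone J C D l c"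
  shows "is_cocone J E (comp_func F D) (omap F l) (\<lambda>i. amap F (c i))"
  unfolding is_cocone_def
proof (intro conjI ballI allI)
  have c: "c i \<in> hom C (omap D i) l" if "i \<in> Ob J" for i
    using that l unfolding is_cocone_def by blast
  then show "amap F (c i) \<in> hom E (omap (comp_func F D) i) (omap F l)" if "i \<in> Ob J" for i
    using that functor_hom[OF F] by simp
  show "omap F l \<in> Ob E" using l functor_Ob[OF F] unfolding is_cocone_def by blast
  fix i j u assume u: "u \<in> hom J i j"
  then have "j \<in> Ob J" using category_hom_Ob functor_category(1)[OF D] by metis
  then show "cmp E (amap F (c j)) (amap (comp_func F D) u) = amap F (c i)"
    using functor_cmp[OF F functor_hom[OF D u] c] l u unfolding is_cocone_def by simp
qed

context small_universe
begin

section \<open>Colimits of sets\<close>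

lemma set_cocone_step:
  assumes "is_functor J (set_cat U) D" "is_cocone J (set_cat U) D l c" "u \<in> hom J i j" "x \<in> omap D i"
  shows "fn (c j) (fn (amap D u) x) = fn (c i) x"
  using fn_cmp_set[OF functor_hom[OF assms(1,3)] assms(4), of "c j"] assms(2,3)
  unfolding is_cocone_def by metis

lemma set_cocone_zigzag:
  assumes "is_functor J (set_cat U) D" "is_cocone J (set_cat U) D l c"
    and "((i, x), (j, y)) \<in> zigzag J D"
  shows "fn (c i) x = fn (c j) y"
  using assms(3)
  by (induct rule: zigzag_induct) (simp_all add: set_cocone_step[OF assms(1,2)])

text \<open>A mediating map is defined on representatives; since identified representatives are
  joined by a zigzag, every cocone agrees on them. The element type is arbitrary so that the lemma
  also covers diagrams of hom-sets.\<close>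

lemma set_colimitI:
  assumes D: "is_functor J (set_cat U) D" and l: "is_cocone J (set_cat U) D l c"
    and surj: "jointly_surjective J D l c" and ker: "kernel_zigzag J D c"
  shows "is_colimit J (set_cat U) D l c"
  unfolding is_colimit_def
proof (intro conjI allI impI l)
  fix m d assume m: "is_cocone J (set_cat U) D m d"
  have c: "c i \<in> hom (set_cat U) (omap D i) l" and d: "d i \<in> hom (set_cat U) (omap D i) m"
    if "i \<in> Ob J" for i
    using that l m unfolding is_cocone_def by auto
  have small: "small U l" "small U m" using l m unfolding is_cocone_def Ob_set by auto
  obtain I X where IX: "I p \<in> Ob J" "X p \<in> omap D (I p)" "fn (c (I p)) (X p) = p" if "p \<in> l" for p
    using surj unfolding jointly_surjective_def by metis
  define h where "h = sarr l m (\<lambda>p. fn (d (I p)) (X p))"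
  have h: "h \<in> hom (set_cat U) l m"
    unfolding h_def using small IX hom_setD(3)[OF d] by (intro sarr_hom) auto
  have "cmp (set_cat U) h (c i) = d i" if i: "i \<in> Ob J" for i
  proof (rule hom_set_eqI[OF cmp_set_hom[OF c[OF i] h] d[OF i]])
    fix x assume x: "x \<in> omap D i"
    let ?p = "fn (c i) x"
    have p: "?p \<in> l" using hom_setD(3)[OF c[OF i] x] .
    then have "((I ?p, X ?p), (i, x)) \<in> zigzag J D"
      using ker IX[OF p] i x unfolding kernel_zigzag_def by blast
    then show "fn (cmp (set_cat U) h (c i)) x = fn (d i) x"
      using set_cocone_zigzag[OF D m] p by (simp add: fn_cmp_set[OF c[OF i] x] h_def)
  qed
  moreover have "k = h" if k: "k \<in> hom (set_cat U) l m"
    and kd: "\<forall>i\<in>Ob J. cmp (set_cat U) k (c i) = d i" for k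
  proof (rule hom_set_eqI[OF k h])
    fix p assume p: "p \<in> l"
    then show "fn k p = fn h p"
      using fn_cmp_set[OF c[OF IX(1)[OF p]] IX(2)[OF p], of k] IX[OF p] kd by (simp add: h_def)
  qed
  ultimately show "\<exists>!h. h \<in> hom (set_cat U) l m \<and> (\<forall>i\<in>Ob J. cmp (set_cat U) h (c i) = d i)"
    using h by blast
qed

text \<open>The quotient of the disjoint union by zigzags. Its classes form a small set, so they are
  renamed into \<open>'u\<close> by an injection; this fixes the element type.\<close>

lemma ex_set_colimit:
  fixes D :: "('u, 'u, 'u set, 'u set \<times> 'u set \<times> ('u \<Rightarrow> 'u)) func"
  assumes J: "small_category U J" and D: "is_functor J (set_cat U) D"
  shows "\<exists>l c. is_cocone J (set_cat U) D l c \<and> jointly_surjective J D l c \<and> kernel_zigzag J D c"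
proof -
  define q where "q p = zigzag J D `` {p}" for p
  have q_eq: "q p = q p' \<longleftrightarrow> (p, p') \<in> zigzag J D" for p p'
  proof
    assume "q p = q p'"
    moreover have "p' \<in> q p'" by (simp add: q_def zigzag_refl)
    ultimately have "p' \<in> q p" by (rule ssubst)
    then show "(p, p') \<in> zigzag J D" by (simp add: q_def)
  next
    assume p: "(p, p') \<in> zigzag J D"
    show "q p = q p'"
      unfolding q_def using zigzag_trans[OF p] zigzag_trans[OF zigzag_sym[OF p]] by auto
  qed
  define Q where "Q = q ` Sigma (Ob J) (omap D)"
  have D_small: "small U (omap D i)" if "i \<in> Ob J" for i
    using functor_Ob[OF D that] by (simp add: Ob_set)
  then have "small U Q"
    unfolding Q_def using J by (intro small_image small_Sigma) (auto simp: small_category_def)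
  then obtain \<phi> :: "('u \<times> 'u) set \<Rightarrow> 'u" where \<phi>: "inj_on \<phi> Q" using ex_small_inj by blast
  define l where "l = \<phi> ` Q"
  define c where "c i = sarr (omap D i) l (\<lambda>x. \<phi> (q (i, x)))" for i
  have l: "small U l" unfolding l_def by (rule small_image) fact
  have Q: "q (i, x) \<in> Q" if "i \<in> Ob J" "x \<in> omap D i" for i x
    using that by (auto simp: Q_def)
  have c: "c i \<in> hom (set_cat U) (omap D i) l" if "i \<in> Ob J" for i
    unfolding c_def using that D_small l Q by (intro sarr_hom) (auto simp: l_def)
  have "is_cocone J (set_cat U) D l c"
    unfolding is_cocone_def
  proof (intro conjI allI ballI)
    fix i j u assume u: "u \<in> hom J i j"
    then have ij: "i \<in> Ob J" "j \<in> Ob J" using category_hom_Ob functor_category(1)[OF D] by metis+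
    note Du = functor_hom[OF D u]
    show "cmp (set_cat U) (c j) (amap D u) = c i"
    proof (rule hom_set_eqI[OF cmp_set_hom[OF Du c[OF ij(2)]] c[OF ij(1)]])
      fix x assume x: "x \<in> omap D i"
      then have "q (j, fn (amap D u) x) = q (i, x)"
        using zigzag_sym[OF zigzag_arrow[OF u x]] q_eq by simp
      then show "fn (cmp (set_cat U) (c j) (amap D u)) x = fn (c i) x"
        using x hom_setD(3)[OF Du x] by (simp add: fn_cmp_set[OF Du x] c_def)
    qed
  qed (simp_all add: l Ob_set c)
  moreover have "jointly_surjective J D l c"
    unfolding jointly_surjective_def l_def Q_def by (auto simp: c_def)
  moreover have "kernel_zigzag J D c"
    unfolding kernel_zigzag_def using Q \<phi> q_eq by (auto simp: c_def inj_on_eq_iff)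
  ultimately show ?thesis by blast
qed

text \<open>Comparison with the explicit quotient: the mediating map \<open>h\<close> into it forces
  the kernel, and its left inverse \<open>k\<close> carries joint surjectivity back.\<close>

lemma set_colimitD:
  fixes D :: "('u, 'u, 'u set, 'u set \<times> 'u set \<times> ('u \<Rightarrow> 'u)) func"
  assumes J: "small_category U J" and D: "is_functor J (set_cat U) D"
    and l: "is_colimit J (set_cat U) D l c"
  shows "jointly_surjective J D l c" "kernel_zigzag J D c"
proof -
  obtain l' c' where l': "is_cocone J (set_cat U) D l' c'" "jointly_surjective J D l' c'"
      "kernel_zigzag J D c'"
    using ex_set_colimit[OF J D] by blast
  note colim' = set_colimitI[OF D l']
  have cocone: "is_cocone J (set_cat U) D l c" using l unfolding is_colimit_def by blast
  have c: "c i \<in> hom (set_cat U) (omap D i) l" and c': "c' i \<in> hom (set_cat U) (omap D i) l'"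
    if "i \<in> Ob J" for i
    using that cocone l'(1) unfolding is_cocone_def by auto
  obtain h where h: "h \<in> hom (set_cat U) l l'" "\<forall>i\<in>Ob J. cmp (set_cat U) h (c i) = c' i"
    using l l'(1) unfolding is_colimit_def by blast
  obtain k where k: "k \<in> hom (set_cat U) l' l" "\<forall>i\<in>Ob J. cmp (set_cat U) k (c' i) = c i"
    using colim' cocone unfolding is_colimit_def by blast
  have hc: "fn h (fn (c i) x) = fn (c' i) x" and kc: "fn k (fn (c' i) x) = fn (c i) x"
    if "i \<in> Ob J" "x \<in> omap D i" for i x
    using that fn_cmp_set[OF c, of i x h] fn_cmp_set[OF c', of i x k] h(2) k(2) by auto
  show "kernel_zigzag J D c"
    using l'(3) hc unfolding kernel_zigzag_def by metis
  note id = category_idn[OF category_set, of l]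
  have l_ob: "l \<in> Ob (set_cat U)" using cocone unfolding is_cocone_def by blast
  have "cmp (set_cat U) (cmp (set_cat U) k h) (c i) = c i" if i: "i \<in> Ob J" for i
    using category_assoc[OF category_set c[OF i] h(1) k(1)] h(2) k(2) i by simp
  moreover have "cmp (set_cat U) (idn (set_cat U) l) (c i) = c i" if i: "i \<in> Ob J" for i
    by (rule category_unit(2)[OF category_set c[OF i]])
  moreover have "\<exists>!e. e \<in> hom (set_cat U) l l \<and> (\<forall>i\<in>Ob J. cmp (set_cat U) e (c i) = c i)"
    using l cocone unfolding is_colimit_def by blast
  ultimately have kh: "cmp (set_cat U) k h = idn (set_cat U) l"
    using category_cmp[OF category_set h(1) k(1)] id[OF l_ob] by blast
  show "jointly_surjective J D l c"
    unfolding jointly_surjective_def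
  proof
    fix p assume p: "p \<in> l"
    then have "fn h p \<in> l'" by (rule hom_setD(3)[OF h(1)])
    then obtain i x where ix: "i \<in> Ob J" "x \<in> omap D i" "fn (c' i) x = fn h p"
      using l'(2) unfolding jointly_surjective_def by blast
    have "fn k (fn h p) = p" using kh fn_cmp_set[OF h(1) p, of k] p by (simp add: idn_set)
    then show "\<exists>i\<in>Ob J. \<exists>x\<in>omap D i. fn (c i) x = p" using ix kc by metis
  qed
qed

section \<open>Colimits of games\<close>

lemma game_cocone_forgetful:
  assumes D: "is_functor J (game_cat U) D" and l: "is_cocone J (game_cat U) D l c"
  shows "is_cocone J (set_cat U) (comp_func forgetful D) (fst l) (\<lambda>i. amap forgetful (c i))"
  using functor_cocone[OF D functor_forgetful l] by simp

lemma game_cocone_step: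
  assumes "is_functor J (game_cat U) D" "is_cocone J (game_cat U) D l c"
    and "u \<in> hom J i j" "x \<in> fst (omap D i)"
  shows "fn (c j) (fn (amap D u) x) = fn (c i) x"
  using set_cocone_step[OF functor_comp[OF assms(1) functor_forgetful]
      game_cocone_forgetful[OF assms(1,2)] assms(3)] assms(4) by simp

text \<open>The mediating function of sets is automatically a morphism: the legs cover
  \<open>l\<close>, and its composites with them are the legs of the other cocone.\<close>

lemma game_colimitI:
  assumes D: "is_functor J (game_cat U) D" and l: "is_cocone J (game_cat U) D l c"
    and surj: "jointly_surjective J (comp_func forgetful D) (fst l) (\<lambda>i. amap forgetful (c i))"
    and colim: "is_colimit J (set_cat U) (comp_func forgetful D) (fst l) (\<lambda>i. amap forgetful (c i))"
  shows "is_colimit J (game_cat U) D l c"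
  unfolding is_colimit_def
proof (intro conjI allI impI l)
  fix m d assume m: "is_cocone J (game_cat U) D m d"
  have c: "c i \<in> hom (game_cat U) (omap D i) l" and d: "d i \<in> hom (game_cat U) (omap D i) m"
    if "i \<in> Ob J" for i
    using that l m unfolding is_cocone_def by auto
  have ob: "Game_ob l" "Game_ob m" using l m unfolding is_cocone_def Ob_game by auto
  obtain k where k: "k \<in> hom (set_cat U) (fst l) (fst m)"
    "\<And>i. i \<in> Ob J \<Longrightarrow> cmp (set_cat U) k (amap forgetful (c i)) = amap forgetful (d i)"
    using colim game_cocone_forgetful[OF D m] unfolding is_colimit_def by blast
  have kc: "fn k (fn (c i) x) = fn (d i) x" if "i \<in> Ob J" "x \<in> fst (omap D i)" for i x
    using k(2)[OF that(1)] fn_cmp_set[OF forgetful_hom[OF c[OF that(1)]] that(2), of k] by simp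
  have cover: "\<exists>i\<in>Ob J. \<exists>x\<in>fst (omap D i). fn (c i) x = p" if "p \<in> fst l" for p
    using that surj unfolding jointly_surjective_def by simp
  have "gmor l m (fn k)"
  proof (rule gmor_jointly_surjective[OF Game_obD(1)[OF ob(1)]])
    fix p assume "p \<in> fst l"
    then obtain i x where ix: "i \<in> Ob J" "x \<in> fst (omap D i)" "fn (c i) x = p" using cover by blast
    have "gmor (omap D i) m (\<lambda>x. fn k (fn (c i) x))"
      by (rule gmor_cong[OF Game_obD(1)[OF hom_gameD(1)[OF d[OF ix(1)]]] _ hom_gameD(3)[OF d[OF ix(1)]]])
        (simp add: kc ix(1))
    then show "\<exists>(F :: 'u game) f x. gmor F l f \<and> gmor F m (\<lambda>x. fn k (f x)) \<and> x \<in> fst F \<and> f x = p"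
      using ix hom_gameD(3)[OF c[OF ix(1)]] by blast
  qed
  then have h: "garr l m (fn k) \<in> hom (game_cat U) l m" by (rule garr_hom[OF ob])
  have "cmp (game_cat U) (garr l m (fn k)) (c i) = d i" if i: "i \<in> Ob J" for i
    by (rule hom_game_eqI[OF cmp_game_hom[OF c[OF i] h] d[OF i]])
      (simp add: fn_cmp_game[OF c[OF i]] kc i hom_gameD(4)[OF c[OF i]])
  moreover have "h' = garr l m (fn k)" if h': "h' \<in> hom (game_cat U) l m"
    and eq: "\<forall>i\<in>Ob J. cmp (game_cat U) h' (c i) = d i" for h'
  proof (rule hom_game_eqI[OF h' h])
    fix p assume p: "p \<in> fst l"
    then obtain i x where ix: "i \<in> Ob J" "x \<in> fst (omap D i)" "fn (c i) x = p" using cover by blast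
    then have "fn h' p = fn (d i) x" using eq fn_cmp_game[OF c[OF ix(1)] ix(2), of h'] by simp
    then show "fn h' p = fn (garr l m (fn k)) p" using kc[OF ix(1,2)] ix(3) p by simp
  qed
  ultimately show "\<exists>!h. h \<in> hom (game_cat U) l m \<and> (\<forall>i\<in>Ob J. cmp (game_cat U) h (c i) = d i)"
    using h by blast
qed

text \<open>Zigzags are bisimulations, so their classes inherit the moves of their members.\<close>

lemma game_colimit_lift:
  assumes D: "is_functor J (game_cat U) D"
    and m: "is_cocone J (set_cat U) (comp_func forgetful D) m d"
    and surj: "jointly_surjective J (comp_func forgetful D) m d"
    and ker: "kernel_zigzag J (comp_func forgetful D) d"
  shows "\<exists>R. Game_ob (m, R) \<and> (\<forall>i\<in>Ob J. gmor (omap D i) (m, R) (fn (d i)))"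
proof -
  \<comment> \<open>The only candidate: the legs must preserve edges, and path-lifting along legs
    that cover \<open>m\<close> admits no further edge.\<close>
  define R where "R = (\<Union>i\<in>Ob J. map_prod (fn (d i)) (fn (d i)) ` snd (omap D i))"
  have R_I: "(fn (d i) x, fn (d i) x') \<in> R" if "i \<in> Ob J" "(x, x') \<in> snd (omap D i)" for i x x'
    using that by (force simp: R_def)
  have J: "category J" using functor_category(1)[OF D] .
  have UD: "is_functor J (set_cat U) (comp_func forgetful D)"
    by (rule functor_comp[OF D functor_forgetful])
  have Dob: "Game_ob (omap D i)" if "i \<in> Ob J" for i
    using functor_Ob[OF D that] by (simp add: Ob_game)
  have d: "fn (d i) x \<in> m" if "i \<in> Ob J" "x \<in> fst (omap D i)" for i x
    using that m hom_setD(3) unfolding is_cocone_def by fastforce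
  \<comment> \<open>Targets are matched only up to their class in \<open>m\<close>; this is the
    invariant that survives both directions of a diagram arrow.\<close>
  have bisim: "\<exists>x'. (x, x') \<in> snd (omap D i) \<and> fn (d i) x' = fn (d j) y'"
    if zz: "((i, x), (j, y)) \<in> zigzag J (comp_func forgetful D)" and y': "(y, y') \<in> snd (omap D j)"
    for i x j y y'
  proof -
    have "\<forall>y'. (y, y') \<in> snd (omap D j) \<longrightarrow>
        (\<exists>x'. (x, x') \<in> snd (omap D i) \<and> fn (d i) x' = fn (d j) y')"
      using zz
    proof (induct rule: zigzag_induct)
      case (fwd j y k u)
      show ?case
      proof (intro allI impI)
        fix z assume "(fn (amap (comp_func forgetful D) u) y, z) \<in> snd (omap D k)"
        then obtain y' where y': "(y, y') \<in> snd (omap D j)" "fn (amap D u) y' = z"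
          using gmor_lift[OF hom_gameD(3)[OF functor_hom[OF D fwd(2)]]] fwd(3) by auto
        have "fn (d k) z = fn (d j) y'"
          using set_cocone_step[OF UD m fwd(2), of y'] y' game_edge(2)[OF Game_obD(1)[OF Dob] y'(1)]
            category_hom_Ob[OF J fwd(2)] by simp
        then show "\<exists>x'. (x, x') \<in> snd (omap D i) \<and> fn (d i) x' = fn (d k) z"
          using fwd(1) y'(1) by auto
      qed
    next
      case (bwd j k z u)
      show ?case
      proof (intro allI impI)
        fix z' assume z': "(z, z') \<in> snd (omap D k)"
        then have "(fn (amap D u) z, fn (amap D u) z') \<in> snd (omap D j)"
          using gmor_edge[OF hom_gameD(3)[OF functor_hom[OF D bwd(2)]]] by blast
        moreover have "fn (d j) (fn (amap D u) z') = fn (d k) z'"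
          using set_cocone_step[OF UD m bwd(2), of z'] game_edge(2)[OF Game_obD(1)[OF Dob] z']
            category_hom_Ob[OF J bwd(2)] by simp
        ultimately show "\<exists>x'. (x, x') \<in> snd (omap D i) \<and> fn (d i) x' = fn (d k) z'"
          using bwd(1) by fastforce
      qed
    qed blast
    then show ?thesis using y' by blast
  qed
  have lift: "\<exists>x'. (x, x') \<in> snd (omap D i) \<and> fn (d i) x' = q"
    if i: "i \<in> Ob J" "x \<in> fst (omap D i)" and q: "(fn (d i) x, q) \<in> R" for i x q
  proof -
    obtain j y y' where j: "j \<in> Ob J" "(y, y') \<in> snd (omap D j)" "fn (d j) y = fn (d i) x" "q = fn (d j) y'"
      using q by (auto simp: R_def)
    have "((i, x), (j, y)) \<in> zigzag J (comp_func forgetful D)"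
      using ker i j game_edge(1)[OF Game_obD(1)[OF Dob] j(2)] unfolding kernel_zigzag_def by simp
    then show ?thesis using bisim j by blast
  qed
  have cover: "\<exists>i\<in>Ob J. \<exists>x\<in>fst (omap D i). fn (d i) x = p" if "p \<in> m" for p
    using that surj unfolding jointly_surjective_def by simp
  have gmor: "gmor (omap D i) (m, R) (fn (d i))" if "i \<in> Ob J" for i
    using that d R_I lift by (intro gmorI) auto
  have "R \<subseteq> m \<times> m"
    using d game_edge[OF Game_obD(1)[OF Dob]] by (fastforce simp: R_def)
  moreover have "finite {q. (p, q) \<in> R}" if "p \<in> m" for p
  proof -
    obtain i x where ix: "i \<in> Ob J" "x \<in> fst (omap D i)" "fn (d i) x = p" using cover[OF \<open>p \<in> m\<close>] by blast
    have "{q. (p, q) \<in> R} \<subseteq> fn (d i) ` {x'. (x, x') \<in> snd (omap D i)}"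
      using lift[OF ix(1,2)] ix(3) by blast
    then show ?thesis
      using game_finite[OF Game_obD(1)[OF Dob[OF ix(1)]]] finite_subset finite_imageI by metis
  qed
  \<comment> \<open>By \<open>lift\<close>, every play from \<open>fn (d i) x\<close> comes from a
    play from \<open>x\<close> in the single game \<open>omap D i\<close>, so induction in that game
    is enough.\<close>
  moreover have "wf (R\<inverse>)"
  proof (rule wfUNIVI)
    fix P p assume step: "\<forall>p. (\<forall>q. (q, p) \<in> R\<inverse> \<longrightarrow> P q) \<longrightarrow> P p"
    have im: "P (fn (d i) x)" if i: "i \<in> Ob J" and x: "x \<in> fst (omap D i)" for i x
      using Game_obD(1)[OF Dob[OF i]] x
    proof (induct x rule: game_induct)
      case (step x)
      then show ?case using lift[OF i step(1)] \<open>\<forall>p. _ p \<longrightarrow> P p\<close> by blast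
    qed
    show "P p"
    proof (cases "p \<in> m")
      case True
      then show ?thesis using cover im by blast
    next
      case False
      then show ?thesis using step \<open>R \<subseteq> m \<times> m\<close> by blast
    qed
  qed
  moreover have "small U m" using m by (simp add: is_cocone_def Ob_set)
  ultimately have "Game_ob (m, R)" by (simp add: Game_ob_def is_game_iff)
  then show ?thesis using gmor by blast
qed

text \<open>Existence combines the lifted edges with \<open>game_colimitI\<close>. For uniqueness,
  two lifts share their vertices and leg functions, so the identity is a morphism between them, and
  this leaves no freedom in the edges.\<close>

lemma strictly_creates_forgetful:
  assumes J: "small_category U J"
  shows "strictly_creates_colimits J (game_cat U) (set_cat U) forgetful"
  unfolding strictly_creates_colimits_def
proof (intro allI impI, elim conjE)
  fix D m d assume D: "is_functor J (game_cat U) D"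
    and m: "is_colimit J (set_cat U) (comp_func forgetful D) m d"
  note UD = functor_comp[OF D functor_forgetful]
  have cocone: "is_cocone J (set_cat U) (comp_func forgetful D) m d"
    using m unfolding is_colimit_def by blast
  then have d: "d i \<in> hom (set_cat U) (fst (omap D i)) m" if "i \<in> Ob J" for i
    using that unfolding is_cocone_def by simp
  note surj = set_colimitD(1)[OF J UD m] and ker = set_colimitD(2)[OF J UD m]
  obtain R where R: "Game_ob (m, R)" "\<And>i. i \<in> Ob J \<Longrightarrow> gmor (omap D i) (m, R) (fn (d i))"
    using game_colimit_lift[OF D cocone surj ker] by blast
  define c where "c i = garr (omap D i) (m, R) (fn (d i))" for i
  have Dob: "Game_ob (omap D i)" if "i \<in> Ob J" for i
    using functor_Ob[OF D that] by (simp add: Ob_game)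
  have c: "c i \<in> hom (game_cat U) (omap D i) (m, R)" if "i \<in> Ob J" for i
    unfolding c_def by (rule garr_hom[OF Dob R(1) R(2)]) (rule that)+
  have Uc: "amap forgetful (c i) = d i" if i: "i \<in> Ob J" for i
    using d[OF i] unfolding c_def forgetful_garr hom_set sarr_def
    by (metis PiE_restrict fst_conv)
  have l: "is_cocone J (game_cat U) D (m, R) c"
    unfolding is_cocone_def
  proof (intro conjI ballI allI)
    fix i j u assume u: "u \<in> hom J i j"
    then have ij: "i \<in> Ob J" "j \<in> Ob J" using category_hom_Ob functor_category(1)[OF D] by metis+
    note Du = functor_hom[OF D u]
    show "cmp (game_cat U) (c j) (amap D u) = c i"
    proof (rule hom_game_eqI[OF cmp_game_hom[OF Du c[OF ij(2)]] c[OF ij(1)]])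
      fix x assume x: "x \<in> fst (omap D i)"
      then show "fn (cmp (game_cat U) (c j) (amap D u)) x = fn (c i) x"
        using set_cocone_step[OF UD cocone u] hom_gameD(4)[OF Du x]
        by (simp add: fn_cmp_game[OF Du x] c_def)
    qed
  qed (simp_all add: c R(1) Ob_game)
  have "is_colimit J (set_cat U) (comp_func forgetful D) (fst (m, R)) (\<lambda>i. amap forgetful (c i))"
    using m Uc unfolding is_colimit_def is_cocone_def
    by (simp add: cong: ball_cong) (metis category_hom_Ob functor_category(1)[OF D])
  moreover have "jointly_surjective J (comp_func forgetful D) (fst (m, R)) (\<lambda>i. amap forgetful (c i))"
    using surj Uc by (simp add: jointly_surjective_def)
  ultimately have colim: "is_colimit J (game_cat U) D (m, R) c"
    using game_colimitI[OF D l] by blast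
  have "l' = (m, R) \<and> (\<forall>i\<in>Ob J. c' i = c i)"
    if l': "is_cocone J (game_cat U) D l' c'" and fst: "omap forgetful l' = m"
      and Uc': "\<forall>i\<in>Ob J. amap forgetful (c' i) = d i" for l' c'
  proof -
    have c': "c' i \<in> hom (game_cat U) (omap D i) l'" if "i \<in> Ob J" for i
      using that l' unfolding is_cocone_def by blast
    have ob': "Game_ob l'" using l' by (simp add: is_cocone_def Ob_game)
    have fn: "fn (c' i) = fn (d i)" if "i \<in> Ob J" for i using Uc' that by (metis fn_forgetful)
    have "gmor l' (m, R) (\<lambda>x. x)"
    proof (rule gmor_jointly_surjective[OF Game_obD(1)[OF ob']])
      fix p assume "p \<in> fst l'"
      then obtain i x where ix: "i \<in> Ob J" "x \<in> fst (omap D i)" "fn (d i) x = p"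
        using surj fst by (auto simp: jointly_surjective_def)
      then show "\<exists>(F :: 'u game) f x. gmor F l' f \<and> gmor F (m, R) (\<lambda>x. f x) \<and> x \<in> fst F \<and> f x = p"
        using hom_gameD(3)[OF c'[OF ix(1)]] R(2)[OF ix(1)] fn by metis
    qed
    then have "l' = (m, R)"
      using gmor_unique_edges[OF Game_obD(1)[OF ob'] Game_obD(1)[OF R(1)]] fst by simp
    moreover have "c' i = c i" if i: "i \<in> Ob J" for i
      using hom_game_eqI[OF c'[OF i, unfolded calculation] c[OF i]] fn[OF i] by (simp add: c_def)
    ultimately show ?thesis by blast
  qed
  then show "\<exists>l c. is_colimit J (game_cat U) D l c \<and> omap forgetful l = m \<and>
      (\<forall>i\<in>Ob J. amap forgetful (c i) = d i) \<and>
      (\<forall>l' c'. is_cocone J (game_cat U) D l' c' \<and> omap forgetful l' = m \<and>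
         (\<forall>i\<in>Ob J. amap forgetful (c' i) = d i) \<longrightarrow> l' = l \<and> (\<forall>i\<in>Ob J. c' i = c i))"
    using colim Uc by (intro exI[of _ "(m, R)"] exI[of _ c]) auto
qed

lemma has_small_colimits_game: "has_small_colimits U (game_cat U)"
  unfolding has_small_colimits_def
proof (intro allI impI, elim conjE)
  fix J D assume J: "small_category U J" and D: "is_functor J (game_cat U) D"
  note UD = functor_comp[OF D functor_forgetful]
  obtain l c where "is_colimit J (set_cat U) (comp_func forgetful D) l c"
    using ex_set_colimit[OF J UD] set_colimitI[OF UD] by blast
  then show "\<exists>l c. is_colimit J (game_cat U) D l c"
    using strictly_creates_forgetful[OF J] D unfolding strictly_creates_colimits_def by meson
qed

lemma reflects_forgetful:
  assumes J: "small_category U J"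
  shows "reflects_colimits J (game_cat U) (set_cat U) forgetful"
  unfolding reflects_colimits_def
proof (intro allI impI, elim conjE)
  fix D l c
  assume D: "is_functor J (game_cat U) D" and l: "is_cocone J (game_cat U) D l c"
    and colim: "is_colimit J (set_cat U) (comp_func forgetful D) (omap forgetful l) (\<lambda>i. amap forgetful (c i))"
  have "jointly_surjective J (comp_func forgetful D) (fst l) (\<lambda>i. amap forgetful (c i))"
    using set_colimitD(1)[OF J functor_comp[OF D functor_forgetful] colim] by simp
  then show "is_colimit J (game_cat U) D l c" using game_colimitI[OF D l] colim by simp
qed

text \<open>Comparison with the created colimit, whose underlying cocone is a colimit of sets. As
  for sets, \<open>h\<close> gives the kernel and its left inverse \<open>k\<close> the
  surjectivity; preservation follows.\<close>

lemma game_colimitD: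
  assumes J: "small_category U J" and D: "is_functor J (game_cat U) D"
    and l: "is_colimit J (game_cat U) D l c"
  shows "jointly_surjective J (comp_func forgetful D) (fst l) (\<lambda>i. amap forgetful (c i))"
    and "kernel_zigzag J (comp_func forgetful D) (\<lambda>i. amap forgetful (c i))"
proof -
  note UD = functor_comp[OF D functor_forgetful]
  obtain m d where m: "is_colimit J (set_cat U) (comp_func forgetful D) m d"
    using ex_set_colimit[OF J UD] set_colimitI[OF UD] by blast
  note surj = set_colimitD(1)[OF J UD m] and ker = set_colimitD(2)[OF J UD m]
  obtain l' c' where l': "is_colimit J (game_cat U) D l' c'" "fst l' = m"
      "\<forall>i\<in>Ob J. amap forgetful (c' i) = d i"
    using strictly_creates_forgetful[OF J] D m unfolding strictly_creates_colimits_def by fastforce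
  have fn': "fn (c' i) = fn (d i)" if "i \<in> Ob J" for i using l'(3) that by (metis fn_forgetful)
  have cocone: "is_cocone J (game_cat U) D l c" "is_cocone J (game_cat U) D l' c'"
    using l l'(1) unfolding is_colimit_def by blast+
  have c: "c i \<in> hom (game_cat U) (omap D i) l" and c': "c' i \<in> hom (game_cat U) (omap D i) l'"
    if "i \<in> Ob J" for i
    using that cocone unfolding is_cocone_def by auto
  obtain h where h: "h \<in> hom (game_cat U) l l'" "\<forall>i\<in>Ob J. cmp (game_cat U) h (c i) = c' i"
    using l cocone unfolding is_colimit_def by blast
  obtain k where k: "k \<in> hom (game_cat U) l' l" "\<forall>i\<in>Ob J. cmp (game_cat U) k (c' i) = c i"
    using l'(1) cocone unfolding is_colimit_def by blast
  have hc: "fn h (fn (c i) x) = fn (c' i) x" and kc: "fn k (fn (c' i) x) = fn (c i) x"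
    if "i \<in> Ob J" "x \<in> fst (omap D i)" for i x
    using that fn_cmp_game[OF c, of i x h] fn_cmp_game[OF c', of i x k] h(2) k(2) by auto
  show "kernel_zigzag J (comp_func forgetful D) (\<lambda>i. amap forgetful (c i))"
    using ker hc fn' unfolding kernel_zigzag_def by simp metis
  have l_ob: "l \<in> Ob (game_cat U)" using cocone unfolding is_cocone_def by blast
  have "cmp (game_cat U) (cmp (game_cat U) k h) (c i) = c i" if i: "i \<in> Ob J" for i
    using category_assoc[OF category_game c[OF i] h(1) k(1)] h(2) k(2) i by simp
  moreover have "cmp (game_cat U) (idn (game_cat U) l) (c i) = c i" if i: "i \<in> Ob J" for i
    by (rule category_unit(2)[OF category_game c[OF i]])
  moreover have "\<exists>!e. e \<in> hom (game_cat U) l l \<and> (\<forall>i\<in>Ob J. cmp (game_cat U) e (c i) = c i)"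
    using l cocone unfolding is_colimit_def by blast
  ultimately have kh: "cmp (game_cat U) k h = idn (game_cat U) l"
    using category_cmp[OF category_game h(1) k(1)] category_idn[OF category_game l_ob] by blast
  have "\<exists>i\<in>Ob J. \<exists>x\<in>fst (omap D i). fn (c i) x = p" if p: "p \<in> fst l" for p
  proof -
    have "fn h p \<in> m" using hom_gameD(4)[OF h(1) p] l'(2) by simp
    then obtain i x where ix: "i \<in> Ob J" "x \<in> fst (omap D i)" "fn (d i) x = fn h p"
      using surj unfolding jointly_surjective_def by auto
    have "fn k (fn h p) = p" using kh fn_cmp_game[OF h(1) p, of k] p by (simp add: idn_game)
    then show ?thesis using ix kc fn' by metis
  qed
  then show "jointly_surjective J (comp_func forgetful D) (fst l) (\<lambda>i. amap forgetful (c i))"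
    by (simp add: jointly_surjective_def)
qed

lemma preserves_forgetful:
  assumes J: "small_category U J"
  shows "preserves_colimits J (game_cat U) (set_cat U) forgetful"
  unfolding preserves_colimits_def
proof (intro allI impI, elim conjE)
  fix D l c assume D: "is_functor J (game_cat U) D" and l: "is_colimit J (game_cat U) D l c"
  have "is_cocone J (game_cat U) D l c" using l unfolding is_colimit_def by blast
  then show "is_colimit J (set_cat U) (comp_func forgetful D) (omap forgetful l) (\<lambda>i. amap forgetful (c i))"
    using set_colimitI[OF functor_comp[OF D functor_forgetful] game_cocone_forgetful[OF D]]
      game_colimitD[OF J D l] by simp
qed

end

section \<open>Comonadicity\<close>

lemma functor_id: "category C \<Longrightarrow> is_functor C C id_func"
  by (rule functorI) (auto simp: id_func_def category_idn)

text \<open>\<open>R\<close> on arrows and the unit are defined as transposes, which makes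
  \<open>c\<close> natural at once. Each remaining equation between arrows into some
  \<open>r y\<close> is checked after applying \<open>L\<close> and composing with
  \<open>c y\<close>, where \<open>uniq\<close> applies.\<close>

lemma adjunction_of_universal_arrows:
  assumes L: "is_functor C D L"
    and r: "\<And>y. y \<in> Ob D \<Longrightarrow> r y \<in> Ob C"
    and c: "\<And>y. y \<in> Ob D \<Longrightarrow> c y \<in> hom D (omap L (r y)) y"
    and ex: "\<And>x y f. x \<in> Ob C \<Longrightarrow> y \<in> Ob D \<Longrightarrow> f \<in> hom D (omap L x) y \<Longrightarrow>
      \<exists>g\<in>hom C x (r y). cmp D (c y) (amap L g) = f"
    and uniq: "\<And>x y g g'. x \<in> Ob C \<Longrightarrow> y \<in> Ob D \<Longrightarrow> g \<in> hom C x (r y) \<Longrightarrow> g' \<in> hom C x (r y) \<Longrightarrow>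
      cmp D (c y) (amap L g) = cmp D (c y) (amap L g') \<Longrightarrow> g = g'"
  obtains R e where "is_adjunction C D L R e c" "omap R = r"
proof -
  note C = functor_category(1)[OF L] and D = functor_category(2)[OF L]
  define tr where "tr x y f = (SOME g. g \<in> hom C x (r y) \<and> cmp D (c y) (amap L g) = f)" for x y f
  have tr: "tr x y f \<in> hom C x (r y)" "cmp D (c y) (amap L (tr x y f)) = f"
    if "x \<in> Ob C" "y \<in> Ob D" "f \<in> hom D (omap L x) y" for x y f
  proof -
    have "\<exists>g. g \<in> hom C x (r y) \<and> cmp D (c y) (amap L g) = f" using ex[OF that] by blast
    from someI_ex[OF this] show "tr x y f \<in> hom C x (r y)" "cmp D (c y) (amap L (tr x y f)) = f"
      unfolding tr_def by blast+
  qed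
  define R where "R = \<lparr>omap = r, amap = (\<lambda>f. tr (r (src D f)) (tgt D f) (cmp D f (c (src D f))))\<rparr>"
  define e where "e x = tr x (omap L x) (idn D (omap L x))" for x
  have Rob: "omap R = r" by (simp add: R_def)
  have R: "amap R f \<in> hom C (r y) (r z)" "cmp D (c z) (amap L (amap R f)) = cmp D f (c y)"
    if f: "f \<in> hom D y z" for f y z
  proof -
    have yz: "src D f = y" "tgt D f = z" using f by (auto simp: hom_def)
    have ob: "y \<in> Ob D" "z \<in> Ob D" using category_hom_Ob[OF D f] by auto
    note * = tr[OF r[OF ob(1)] ob(2) category_cmp[OF D c[OF ob(1)] f]]
    show "amap R f \<in> hom C (r y) (r z)" "cmp D (c z) (amap L (amap R f)) = cmp D f (c y)"
      using * by (simp_all add: R_def yz)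
  qed
  have e: "e x \<in> hom C x (r (omap L x))" "cmp D (c (omap L x)) (amap L (e x)) = idn D (omap L x)"
    if x: "x \<in> Ob C" for x
    using tr[OF x functor_Ob[OF L x] category_idn[OF D functor_Ob[OF L x]]] by (simp_all add: e_def)
  have L_hom: "amap L f \<in> hom D (omap L x) (omap L y)" if "f \<in> hom C x y" for f x y
    using functor_hom[OF L that] .
  have L_cmp: "cmp D (c w) (amap L (cmp C g f)) = cmp D (cmp D (c w) (amap L g)) (amap L f)"
    if "f \<in> hom C x y" "g \<in> hom C y (r w)" "w \<in> Ob D" for f g x y w
    using functor_cmp[OF L that(1,2)] category_assoc[OF D L_hom[OF that(1)] L_hom[OF that(2)] c[OF that(3)]]
    by simp
  have functor_R: "is_functor D C R"
  proof (rule functorI)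
    show "omap R y \<in> Ob C" if "y \<in> Ob D" for y using r that by (simp add: Rob)
    show "amap R f \<in> hom C (omap R y) (omap R z)" if "f \<in> hom D y z" for f y z
      using R(1)[OF that] by (simp add: Rob)
    show "amap R (idn D y) = idn C (omap R y)" if y: "y \<in> Ob D" for y
    proof -
      note id = category_idn[OF D y]
      have "cmp D (c y) (amap L (amap R (idn D y))) = cmp D (c y) (amap L (idn C (r y)))"
        using R(2)[OF id] category_unit[OF D c[OF y]] functor_idn[OF L r[OF y]] by simp
      then show ?thesis
        using uniq[OF r[OF y] y R(1)[OF id] category_idn[OF C r[OF y]]] by (simp add: Rob)
    qed
    show "amap R (cmp D g f) = cmp C (amap R g) (amap R f)"
      if f: "f \<in> hom D x y" and g: "g \<in> hom D y z" for x y z f g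
    proof -
      have ob: "x \<in> Ob D" "y \<in> Ob D" "z \<in> Ob D"
        using category_hom_Ob[OF D f] category_hom_Ob[OF D g] by auto
      note gf = category_cmp[OF D f g]
      have "cmp D (c z) (amap L (cmp C (amap R g) (amap R f))) =
          cmp D (cmp D g (c y)) (amap L (amap R f))"
        using L_cmp[OF R(1)[OF f] R(1)[OF g] ob(3)] R(2)[OF g] by simp
      also have "\<dots> = cmp D g (cmp D f (c x))"
        using category_assoc[OF D L_hom[OF R(1)[OF f]] c[OF ob(2)] g] R(2)[OF f] by simp
      also have "\<dots> = cmp D (c z) (amap L (amap R (cmp D g f)))"
        using category_assoc[OF D c[OF ob(1)] f g] R(2)[OF gf] by simp
      finally show ?thesis
        using uniq[OF r[OF ob(1)] ob(3) R(1)[OF gf] category_cmp[OF C R(1)[OF f] R(1)[OF g]]] by simp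
    qed
  qed (use C D in auto)
  have nat_e: "cmp C (e y) f = cmp C (amap R (amap L f)) (e x)" if f: "f \<in> hom C x y" for f x y
  proof -
    have ob: "x \<in> Ob C" "y \<in> Ob C" using category_hom_Ob[OF C f] by auto
    note Lob = functor_Ob[OF L ob(1)] functor_Ob[OF L ob(2)] and Lf = L_hom[OF f]
    have "cmp D (c (omap L y)) (amap L (cmp C (e y) f)) = amap L f"
      using L_cmp[OF f e(1)[OF ob(2)] Lob(2)] e(2)[OF ob(2)] category_unit[OF D Lf] by simp
    also have "\<dots> = cmp D (amap L f) (cmp D (c (omap L x)) (amap L (e x)))"
      using e(2)[OF ob(1)] category_unit[OF D Lf] by simp
    also have "\<dots> = cmp D (c (omap L y)) (amap L (cmp C (amap R (amap L f)) (e x)))"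
      using L_cmp[OF e(1)[OF ob(1)] R(1)[OF Lf] Lob(2)] R(2)[OF Lf]
        category_assoc[OF D L_hom[OF e(1)[OF ob(1)]] c[OF Lob(1)] Lf] by simp
    finally show ?thesis
      using uniq[OF ob(1) Lob(2) category_cmp[OF C f e(1)[OF ob(2)]]
          category_cmp[OF C e(1)[OF ob(1)] R(1)[OF Lf]]] by simp
  qed
  have triangle: "cmp C (amap R (c y)) (e (omap R y)) = idn C (omap R y)" if y: "y \<in> Ob D" for y
  proof -
    note ry = r[OF y] and cy = c[OF y] and Lry = functor_Ob[OF L r[OF y]]
    have "cmp D (c y) (amap L (cmp C (amap R (c y)) (e (r y)))) =
        cmp D (c y) (cmp D (c (omap L (r y))) (amap L (e (r y))))"
      using L_cmp[OF e(1)[OF ry] R(1)[OF cy] y] R(2)[OF cy]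
        category_assoc[OF D L_hom[OF e(1)[OF ry]] c[OF Lry] cy] by simp
    also have "\<dots> = cmp D (c y) (amap L (idn C (r y)))"
      using e(2)[OF ry] functor_idn[OF L ry] by simp
    finally show ?thesis
      using uniq[OF ry y category_cmp[OF C e(1)[OF ry] R(1)[OF cy]] category_idn[OF C ry]]
      by (simp add: Rob)
  qed
  have "is_adjunction C D L R e c"
    unfolding is_adjunction_def is_nat_trans_def
    using L functor_R functor_id[OF C] functor_id[OF D] functor_comp[OF L functor_R]
      functor_comp[OF functor_R L] e nat_e c R(2) triangle
    by (simp add: id_func_def Rob)
  then show thesis using that Rob by blast
qed

section \<open>Coalgebras and the comparison functor\<close>

lemma hom_coalg:
  "a \<in> hom (coalg_cat D T c d) X Y \<longleftrightarrow>
     a = (X, Y, fn a) \<and> X \<in> Ob (coalg_cat D T c d) \<and> Y \<in> Ob (coalg_cat D T c d) \<and>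
     fn a \<in> hom D (fst X) (fst Y) \<and> cmp D (snd Y) (fn a) = cmp D (amap T (fn a)) (snd X)"
  unfolding hom_def[of "coalg_cat D T c d"]
  by (cases a; cases X; cases Y) (auto simp: coalg_cat_def Let_def)

lemma Ob_coalg:
  "X \<in> Ob (coalg_cat D T c d) \<longleftrightarrow> fst X \<in> Ob D \<and> snd X \<in> hom D (fst X) (omap T (fst X)) \<and>
     cmp D (c (fst X)) (snd X) = idn D (fst X) \<and>
     cmp D (d (fst X)) (snd X) = cmp D (amap T (snd X)) (snd X)"
  by (auto simp: coalg_cat_def Let_def case_prod_beta)

lemma coalg_simps:
  "idn (coalg_cat D T c d) X = (X, X, idn D (fst X))"
  "cmp (coalg_cat D T c d) (Y', Z, g) (X, Y, f) = (X, Z, cmp D g f)"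
  by (simp_all add: coalg_cat_def Let_def)

lemma category_coalg:
  assumes T: "is_functor D D T" shows "category (coalg_cat D T c d)" (is "category ?K")
proof (rule categoryI)
  note D = functor_category(1)[OF T]
  show "src ?K f \<in> Ob ?K \<and> tgt ?K f \<in> Ob ?K" if "f \<in> Ar ?K" for f
    using that by (auto simp: coalg_cat_def Let_def)
  show "idn ?K X \<in> hom ?K X X" if "X \<in> Ob ?K" for X
  proof -
    have X: "fst X \<in> Ob D" "snd X \<in> hom D (fst X) (omap T (fst X))" using that by (auto simp: Ob_coalg)
    then show ?thesis
      using that category_idn[OF D X(1)] category_unit[OF D X(2)] functor_idn[OF T X(1)]
      by (simp add: hom_coalg coalg_simps)
  qed
  show "cmp ?K g f \<in> hom ?K X Z" if f: "f \<in> hom ?K X Y" and g: "g \<in> hom ?K Y Z" for X Y Z f g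
  proof -
    obtain f' g' where fg: "f = (X, Y, f')" "g = (Y, Z, g')" using f g unfolding hom_coalg by metis
    have f': "f' \<in> hom D (fst X) (fst Y)" "cmp D (snd Y) f' = cmp D (amap T f') (snd X)"
      and X: "X \<in> Ob ?K" "Y \<in> Ob ?K"
      using f by (auto simp: fg hom_coalg)
    have g': "g' \<in> hom D (fst Y) (fst Z)" "cmp D (snd Z) g' = cmp D (amap T g') (snd Y)" "Z \<in> Ob ?K"
      using g by (auto simp: fg hom_coalg)
    have h: "snd X \<in> hom D (fst X) (omap T (fst X))" "snd Y \<in> hom D (fst Y) (omap T (fst Y))"
        "snd Z \<in> hom D (fst Z) (omap T (fst Z))"
      using X g'(3) by (auto simp: Ob_coalg)
    have "cmp D (snd Z) (cmp D g' f') = cmp D (cmp D (amap T g') (snd Y)) f'"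
      using category_assoc[OF D f'(1) g'(1) h(3)] g'(2) by simp
    also have "\<dots> = cmp D (amap T g') (cmp D (amap T f') (snd X))"
      using category_assoc[OF D f'(1) h(2) functor_hom[OF T g'(1)]] f'(2) by simp
    also have "\<dots> = cmp D (amap T (cmp D g' f')) (snd X)"
      using category_assoc[OF D h(1) functor_hom[OF T f'(1)] functor_hom[OF T g'(1)]]
        functor_cmp[OF T f'(1) g'(1)] by simp
    finally show ?thesis
      using category_cmp[OF D f'(1) g'(1)] X g'(3) by (simp add: fg coalg_simps hom_coalg)
  qed
  show "cmp ?K f (idn ?K X) = f \<and> cmp ?K (idn ?K Y) f = f" if f: "f \<in> hom ?K X Y" for X Y f
  proof -
    obtain f' where f': "f = (X, Y, f')" "f' \<in> hom D (fst X) (fst Y)" using f unfolding hom_coalg by metis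
    then show ?thesis using category_unit[OF D f'(2)] by (simp add: coalg_simps)
  qed
  show "cmp ?K h (cmp ?K g f) = cmp ?K (cmp ?K h g) f"
    if f: "f \<in> hom ?K W X" and g: "g \<in> hom ?K X Y" and h: "h \<in> hom ?K Y Z" for W X Y Z f g h
  proof -
    obtain f' where f': "f = (W, X, f')" "f' \<in> hom D (fst W) (fst X)" using f unfolding hom_coalg by metis
    obtain g' where g': "g = (X, Y, g')" "g' \<in> hom D (fst X) (fst Y)" using g unfolding hom_coalg by metis
    obtain h' where h': "h = (Y, Z, h')" "h' \<in> hom D (fst Y) (fst Z)" using h unfolding hom_coalg by metis
    show ?thesis using category_assoc[OF D f'(2) g'(2) h'(2)] f'(1) g'(1) h'(1) by (simp add: coalg_simps)
  qed
qed

text \<open>For the coalgebra at \<open>x\<close>, the counit law is a triangle identity, and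
  coassociativity is the image under \<open>L\<close> of naturality of the unit at the arrow
  \<open>e x\<close> itself.\<close>

lemma functor_comparison:
  assumes adj: "is_adjunction C D L R e c"
  shows "is_functor C (coalg_cat D (comp_func L R) c (\<lambda>y. amap L (e (omap R y)))) (comparison_func C L e)"
    (is "is_functor C ?K ?F")
proof -
  have L: "is_functor C D L" and R: "is_functor D C R" and e: "is_nat_trans C C id_func (comp_func R L) e"
    and tri: "\<And>x. x \<in> Ob C \<Longrightarrow> cmp D (c (omap L x)) (amap L (e x)) = idn D (omap L x)"
    using adj unfolding is_adjunction_def by blast+
  note C = functor_category(1)[OF L] and D = functor_category(2)[OF L]
  have e_hom: "e x \<in> hom C x (omap R (omap L x))" if "x \<in> Ob C" for x
    using e that unfolding is_nat_trans_def by (simp add: id_func_def)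
  have e_nat: "cmp C (e y) f = cmp C (amap R (amap L f)) (e x)" if "f \<in> hom C x y" for f x y
    using e that unfolding is_nat_trans_def by (simp add: id_func_def)
  have Le_nat: "cmp D (amap L (e y)) (amap L f) = cmp D (amap L (amap R (amap L f))) (amap L (e x))"
    if f: "f \<in> hom C x y" for f x y
  proof -
    have ob: "x \<in> Ob C" "y \<in> Ob C" using category_hom_Ob[OF C f] by auto
    show ?thesis
      using functor_cmp[OF L f e_hom[OF ob(2)]] e_nat[OF f]
        functor_cmp[OF L e_hom[OF ob(1)] functor_hom[OF R functor_hom[OF L f]]] by simp
  qed
  have ob: "omap ?F x \<in> Ob ?K" if x: "x \<in> Ob C" for x
    using functor_Ob[OF L x] functor_hom[OF L e_hom[OF x]] tri[OF x] Le_nat[OF e_hom[OF x]]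
    by (simp add: Ob_coalg comparison_func_def Let_def)
  have F_arr: "amap ?F f = (omap ?F x, omap ?F y, amap L f)" if "f \<in> hom C x y" for f x y
    using that by (simp add: comparison_func_def Let_def hom_def)
  have F_ob: "fst (omap ?F x) = omap L x" "snd (omap ?F x) = amap L (e x)" for x
    by (simp_all add: comparison_func_def Let_def)
  show ?thesis
  proof (rule functorI)
    show "amap ?F f \<in> hom ?K (omap ?F x) (omap ?F y)" if f: "f \<in> hom C x y" for x y f
      using category_hom_Ob[OF C f] functor_hom[OF L f] Le_nat[OF f]
      by (simp add: F_arr[OF f] hom_coalg ob F_ob)
    show "amap ?F (idn C x) = idn ?K (omap ?F x)" if x: "x \<in> Ob C" for x
      using functor_idn[OF L x] by (simp add: F_arr[OF category_idn[OF C x]] coalg_simps F_ob)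
    show "amap ?F (cmp C g f) = cmp ?K (amap ?F g) (amap ?F f)"
      if f: "f \<in> hom C x y" and g: "g \<in> hom C y z" for x y z f g
      using functor_cmp[OF L f g] F_arr[OF category_cmp[OF C f g]] F_arr[OF f] F_arr[OF g]
      by (simp add: coalg_simps)
  qed (use C ob category_coalg[OF functor_comp[OF R L]] in auto)
qed

text \<open>Bijectivity on objects permits a strict inverse, so identity arrows serve as components
  of both natural isomorphisms.\<close>

lemma equivalence_of_bijective_functor:
  assumes F: "is_functor C D F" and ob: "bij_betw (omap F) (Ob C) (Ob D)"
    and faithful: "\<And>x y. x \<in> Ob C \<Longrightarrow> y \<in> Ob C \<Longrightarrow> inj_on (amap F) (hom C x y)"
    and full: "\<And>x y g. x \<in> Ob C \<Longrightarrow> y \<in> Ob C \<Longrightarrow> g \<in> hom D (omap F x) (omap F y) \<Longrightarrow>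
      \<exists>f\<in>hom C x y. amap F f = g"
  shows "is_equivalence C D F"
proof -
  note C = functor_category(1)[OF F] and D = functor_category(2)[OF F]
  define I where "I = inv_into (Ob C) (omap F)"
  have I: "I y \<in> Ob C" "omap F (I y) = y" if "y \<in> Ob D" for y
    using that ob unfolding I_def by (auto simp: bij_betw_def inv_into_into f_inv_into_f)
  have IF: "I (omap F x) = x" if "x \<in> Ob C" for x
    using that ob unfolding I_def by (simp add: bij_betw_def)
  define G where "G = \<lparr>omap = I, amap = (\<lambda>g. SOME f. f \<in> hom C (I (src D g)) (I (tgt D g)) \<and> amap F f = g)\<rparr>"
  have G_ob: "omap G = I" by (simp add: G_def)
  have G: "amap G g \<in> hom C (I x) (I y) \<and> amap F (amap G g) = g" if g: "g \<in> hom D x y" for x y g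
  proof -
    have xy: "x \<in> Ob D" "y \<in> Ob D" "src D g = x" "tgt D g = y"
      using category_hom_Ob[OF D g] g by (auto simp: hom_def)
    have "\<exists>f. f \<in> hom C (I x) (I y) \<and> amap F f = g" using full[of "I x" "I y" g] I xy(1,2) g by auto
    from someI_ex[OF this] show ?thesis by (simp add: G_def xy(3,4))
  qed
  have eqI: "f = f'" if "f \<in> hom C x y" "f' \<in> hom C x y" "amap F f = amap F f'" for f f' x y
    using faithful[of x y] category_hom_Ob[OF C that(1)] that by (auto dest: inj_onD)
  have GF: "amap G (amap F f) = f" if f: "f \<in> hom C x y" for f x y
    using eqI[OF _ f] G[OF functor_hom[OF F f]] category_hom_Ob[OF C f] IF by simp
  have functor_G: "is_functor D C G"
  proof (rule functorI)
    show "amap G (idn D y) = idn C (omap G y)" if y: "y \<in> Ob D" for y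
      using eqI[OF conjunct1[OF G[OF category_idn[OF D y]]] category_idn[OF C I(1)[OF y]]]
        G[OF category_idn[OF D y]] functor_idn[OF F I(1)[OF y]] I(2)[OF y] by (simp add: G_ob)
    show "amap G (cmp D g f) = cmp C (amap G g) (amap G f)"
      if f: "f \<in> hom D x y" and g: "g \<in> hom D y z" for x y z f g
    proof (rule eqI)
      show "amap G (cmp D g f) \<in> hom C (I x) (I z)" using G[OF category_cmp[OF D f g]] by blast
      show "cmp C (amap G g) (amap G f) \<in> hom C (I x) (I z)"
        using category_cmp[OF C] G[OF f] G[OF g] by blast
      show "amap F (amap G (cmp D g f)) = amap F (cmp C (amap G g) (amap G f))"
        using functor_cmp[OF F conjunct1[OF G[OF f]] conjunct1[OF G[OF g]]]
          G[OF f] G[OF g] G[OF category_cmp[OF D f g]] by simp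
    qed
  qed (use C D I G G_ob in auto)
  have iso: "is_iso C (idn C x)" if C: "category C" and x: "x \<in> Ob C"
    for C :: "('x, 'y) cat" and x
    using category_idn[OF C x] category_unit[OF C category_idn[OF C x]] unfolding is_iso_def hom_def by auto
  have "is_nat_iso C C id_func (comp_func G F) (idn C)"
    unfolding is_nat_iso_def is_nat_trans_def
    using functor_id[OF C] functor_comp[OF F functor_G] iso[OF C] GF IF category_idn[OF C] category_unit[OF C]
    by (auto simp: id_func_def G_ob)
  moreover have "is_nat_iso D D (comp_func F G) id_func (idn D)"
    unfolding is_nat_iso_def is_nat_trans_def
    using functor_id[OF D] functor_comp[OF functor_G F] iso[OF D] G I category_idn[OF D] category_unit[OF D]
    by (auto simp: id_func_def G_ob)
  ultimately show ?thesis unfolding is_equivalence_def using F functor_G by blast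
qed

context small_universe
begin

section \<open>The cofree comonad and its coalgebras\<close>

lemma cofreeD:
  assumes "cofree A G c"
  shows "Game_ob G" "\<And>t. t \<in> fst G \<Longrightarrow> c t \<in> A"
    and "\<And>Y f. Game_ob Y \<Longrightarrow> (\<And>y. y \<in> fst Y \<Longrightarrow> f y \<in> A) \<Longrightarrow>
      \<exists>u. gmor Y G u \<and> (\<forall>y\<in>fst Y. c (u y) = f y)"
    and "\<And>Y u v y. Game_ob Y \<Longrightarrow> gmor Y G u \<Longrightarrow> gmor Y G v \<Longrightarrow>
      (\<And>y. y \<in> fst Y \<Longrightarrow> c (u y) = c (v y)) \<Longrightarrow> y \<in> fst Y \<Longrightarrow> u y = v y"
  using assms unfolding cofree_def by blast+

text \<open>Besides the adjunction, the elementwise universal property is kept for the chosen right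
  adjoint; it is needed to identify the unit of a reconstructed game.\<close>

lemma ex_cofree_adjunction:
  obtains R e c where "is_adjunction (game_cat U) (set_cat U) forgetful R e c"
    and "\<And>A. small U A \<Longrightarrow> cofree A (omap R A) (fn (c A))"
proof -
  obtain r c' where rc: "cofree A (r A) (c' A)" if "small U A" for A using ex_cofree by metis
  define c where "c A = sarr (fst (r A)) A (c' A)" for A
  have r: "r A \<in> Ob (game_cat U)" if "A \<in> Ob (set_cat U)" for A
    using that cofreeD(1)[OF rc] by (simp add: Ob_set Ob_game)
  have c: "c A \<in> hom (set_cat U) (omap forgetful (r A)) A" if "A \<in> Ob (set_cat U)" for A
    using that cofreeD(1,2)[OF rc] by (auto simp: Ob_set c_def Game_obD intro!: sarr_hom)
  have fn_c: "fn (cmp (set_cat U) (c A) (amap forgetful g)) x = c' A (fn g x)"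
    if "g \<in> hom (game_cat U) X (r A)" "x \<in> fst X" for A g X x
    using that fn_cmp_set[OF forgetful_hom] hom_gameD(4) by (simp add: c_def)
  have ex: "\<exists>g\<in>hom (game_cat U) X (r A). cmp (set_cat U) (c A) (amap forgetful g) = f"
    if X: "X \<in> Ob (game_cat U)" and A: "A \<in> Ob (set_cat U)"
      and f: "f \<in> hom (set_cat U) (omap forgetful X) A" for X A f
  proof -
    have ob: "Game_ob X" "small U A" using X A by (simp_all add: Ob_game Ob_set)
    obtain u where u: "gmor X (r A) u" "\<forall>y\<in>fst X. c' A (u y) = fn f y"
      using cofreeD(3)[OF rc[OF ob(2)] ob(1), of "fn f"] hom_setD(3)[OF f] by auto
    have g: "garr X (r A) u \<in> hom (game_cat U) X (r A)"
      by (rule garr_hom[OF ob(1) cofreeD(1)[OF rc[OF ob(2)]] u(1)])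
    moreover have "cmp (set_cat U) (c A) (amap forgetful (garr X (r A) u)) = f"
      by (rule hom_set_eqI[OF cmp_set_hom[OF forgetful_hom[OF g] c[OF A, unfolded omap_forgetful]]])
        (use f fn_c[OF g] u(2) in auto)
    ultimately show ?thesis by blast
  qed
  have uniq: "g = g'"
    if X: "X \<in> Ob (game_cat U)" and A: "A \<in> Ob (set_cat U)"
      and g: "g \<in> hom (game_cat U) X (r A)" "g' \<in> hom (game_cat U) X (r A)"
      and eq: "cmp (set_cat U) (c A) (amap forgetful g) = cmp (set_cat U) (c A) (amap forgetful g')"
    for X A g g'
  proof (rule hom_game_eqI[OF g])
    fix x assume x: "x \<in> fst X"
    have ob: "Game_ob X" "small U A" using X A by (simp_all add: Ob_game Ob_set)
    have "c' A (fn g y) = c' A (fn g' y)" if "y \<in> fst X" for y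
      using fn_c[OF g(1) that] fn_c[OF g(2) that] eq by simp
    then show "fn g x = fn g' x"
      using cofreeD(4)[OF rc[OF ob(2)] ob(1) hom_gameD(3)[OF g(1)] hom_gameD(3)[OF g(2)] _ x] by blast
  qed
  obtain R e where R: "is_adjunction (game_cat U) (set_cat U) forgetful R e c" "omap R = r"
    by (rule adjunction_of_universal_arrows[OF functor_forgetful, of r c])
      (erule r, erule c, erule (2) ex, erule (4) uniq, blast)
  have "cofree A (omap R A) (fn (c A))" if "small U A" for A
  proof -
    have "fn (c A) = c' A"
      using rc[OF that] unfolding cofree_def c_def sarr_def by (metis PiE_restrict snd_conv)
    then show ?thesis using rc[OF that] R(2) by simp
  qed
  then show thesis using that R(1) by blast
qed

text \<open>The unit sends a position to its unfolding, each node being labelled by the position it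
  came from. Since labels recover positions, the edges of a game can be read off its coalgebra, and
  the comparison functor is bijective.\<close>

lemma comonadic_forgetful: "comonadic (game_cat U) (set_cat U) forgetful"
proof -
  obtain R e c where adj: "is_adjunction (game_cat U) (set_cat U) forgetful R e c"
    and cofree: "\<And>A. small U A \<Longrightarrow> cofree A (omap R A) (fn (c A))"
    using ex_cofree_adjunction by blast
  let ?T = "comp_func forgetful R"
  let ?d = "\<lambda>A. amap forgetful (e (omap R A))"
  let ?K = "coalg_cat (set_cat U) ?T c ?d"
  let ?F = "comparison_func (game_cat U) forgetful e"
  have R: "is_functor (set_cat U) (game_cat U) R"
    and e_nat: "is_nat_trans (game_cat U) (game_cat U) id_func (comp_func R forgetful) e"
    and c_nat: "is_nat_trans (set_cat U) (set_cat U) (comp_func forgetful R) id_func c"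
    and tri: "\<And>X. X \<in> Ob (game_cat U) \<Longrightarrow>
      cmp (set_cat U) (c (omap forgetful X)) (amap forgetful (e X)) = idn (set_cat U) (omap forgetful X)"
    using adj unfolding is_adjunction_def by blast+
  have e: "e X \<in> hom (game_cat U) X (omap R (fst X))" if "Game_ob X" for X
    using e_nat that by (simp add: is_nat_trans_def id_func_def Ob_game del: split_paired_All)
  have c: "c A \<in> hom (set_cat U) (fst (omap R A)) A" if "small U A" for A
    using c_nat that unfolding is_nat_trans_def by (simp add: id_func_def Ob_set)
  have ce: "fn (c (fst X)) (fn (e X) x) = x" if X: "Game_ob X" and x: "x \<in> fst X" for X x
    using tri[of X] fn_cmp_set[OF forgetful_hom[OF e[OF X]] x, of "c (fst X)"] X x by (simp add: Ob_game)
  have cR: "fn (c B) (fn (amap R f) t) = fn f (fn (c A) t)"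
    if f: "f \<in> hom (set_cat U) A B" and t: "t \<in> fst (omap R A)" for A B f t
  proof -
    have "cmp (set_cat U) (c B) (amap forgetful (amap R f)) = cmp (set_cat U) f (c A)"
      using c_nat f unfolding is_nat_trans_def by (simp add: id_func_def)
    then show ?thesis
      using fn_cmp_set[OF forgetful_hom[OF functor_hom[OF R f]] t, of "c B"]
        fn_cmp_set[OF c[OF hom_setD(1)[OF f]] t, of f] by simp
  qed
  have F_ob: "omap ?F X = (fst X, amap forgetful (e X))" for X
    by (simp add: comparison_func_def Let_def)
  have F_arr: "amap ?F f = (omap ?F X, omap ?F Y, amap forgetful f)"
    if "f \<in> hom (game_cat U) X Y" for f X Y
    using that by (simp add: comparison_func_def Let_def hom_def)
  have functor_F: "is_functor (game_cat U) ?K ?F" by (rule functor_comparison[OF adj])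
  \<comment> \<open>An edge between unfoldings lifts to an edge of \<open>X\<close>; its endpoint is
    \<open>x'\<close> because \<open>e X\<close> is injective by \<open>ce\<close>.\<close>
  have e_reflect: "(x, x') \<in> snd X"
    if X: "Game_ob X" and x: "x \<in> fst X" "x' \<in> fst X"
      and edge: "(fn (e X) x, fn (e X) x') \<in> snd (omap R (fst X))" for X x x'
  proof -
    obtain y where y: "(x, y) \<in> snd X" "fn (e X) y = fn (e X) x'"
      using gmor_lift[OF hom_gameD(3)[OF e[OF X]] x(1) edge] by blast
    then have "y = x'" using ce[OF X] game_edge(2)[OF Game_obD(1)[OF X] y(1)] x(2) by metis
    then show ?thesis using y by simp
  qed
  have "is_equivalence (game_cat U) ?K ?F"
  proof (rule equivalence_of_bijective_functor[OF functor_F])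
    fix X Y
    show "inj_on (amap ?F) (hom (game_cat U) X Y)"
    proof (rule inj_onI)
      fix f g assume f: "f \<in> hom (game_cat U) X Y" and g: "g \<in> hom (game_cat U) X Y"
        and "amap ?F f = amap ?F g"
      then have "amap forgetful f = amap forgetful g" by (simp add: F_arr[OF f] F_arr[OF g])
      then have "fn f = fn g" by (metis fn_forgetful)
      then show "f = g" using hom_game_eqI[OF f g] by simp
    qed
  next
    fix X Y g assume X: "X \<in> Ob (game_cat U)" and Y: "Y \<in> Ob (game_cat U)"
      and g: "g \<in> hom ?K (omap ?F X) (omap ?F Y)"
    note ob = X[unfolded Ob_game, simplified] Y[unfolded Ob_game, simplified]
    define f where "f = fn g"
    have f: "f \<in> hom (set_cat U) (fst X) (fst Y)"
      and coalg: "cmp (set_cat U) (amap forgetful (e Y)) f =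
        cmp (set_cat U) (amap forgetful (amap R f)) (amap forgetful (e X))"
      using g unfolding hom_coalg f_def by (simp_all add: F_ob)
    note eX = e[OF ob(1)] and eY = e[OF ob(2)] and Rf = functor_hom[OF R f]
    have ef: "fn (e Y) (fn f x) = fn (amap R f) (fn (e X) x)" if x: "x \<in> fst X" for x
      using coalg fn_cmp_set[OF f x, of "amap forgetful (e Y)"]
        fn_cmp_set[OF forgetful_hom[OF eX] x, of "amap forgetful (amap R f)"] by simp
    have fx: "fn f x \<in> fst Y" if "x \<in> fst X" for x using hom_setD(3)[OF f that] .
    \<comment> \<open>A coalgebra map commutes with unfolding. Moves are therefore carried to trees
      by the units, across \<open>amap R f\<close>, and back by \<open>e_reflect\<close> or by
      reading labels.\<close>
    have "gmor X Y (fn f)"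
    proof (rule gmorI[OF fx])
      fix x x' assume xx': "(x, x') \<in> snd X"
      note in_X = game_edge[OF Game_obD(1)[OF ob(1)] xx']
      have "(fn (amap R f) (fn (e X) x), fn (amap R f) (fn (e X) x')) \<in> snd (omap R (fst Y))"
        using gmor_edge[OF hom_gameD(3)[OF Rf]] gmor_edge[OF hom_gameD(3)[OF eX] xx'] by blast
      then show "(fn f x, fn f x') \<in> snd Y"
        using e_reflect[OF ob(2)] ef in_X fx by simp
    next
      fix x y assume x: "x \<in> fst X" and y: "(fn f x, y) \<in> snd Y"
      note y_in = game_edge(2)[OF Game_obD(1)[OF ob(2)] y]
      have "(fn (amap R f) (fn (e X) x), fn (e Y) y) \<in> snd (omap R (fst Y))"
        using gmor_edge[OF hom_gameD(3)[OF eY] y] ef[OF x] by simp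
      then obtain t where t: "(fn (e X) x, t) \<in> snd (omap R (fst X))" "fn (amap R f) t = fn (e Y) y"
        using gmor_lift[OF hom_gameD(3)[OF Rf]] hom_gameD(4)[OF eX x] by metis
      then obtain x' where x': "(x, x') \<in> snd X" "fn (e X) x' = t"
        using gmor_lift[OF hom_gameD(3)[OF eX] x] by metis
      note x'_in = game_edge(2)[OF Game_obD(1)[OF ob(1)] x'(1)]
      have "fn (e Y) (fn f x') = fn (e Y) y" using ef[OF x'_in] x' t by simp
      then have "fn f x' = y" using ce[OF ob(2)] fx[OF x'_in] y_in by metis
      then show "\<exists>x'. (x, x') \<in> snd X \<and> fn f x' = y" using x' by blast
    qed
    then have h: "garr X Y (fn f) \<in> hom (game_cat U) X Y" by (rule garr_hom[OF ob])
    moreover have "amap forgetful (garr X Y (fn f)) = f"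
      by (rule hom_set_eqI[OF forgetful_hom[OF h] f]) simp
    then have "amap ?F (garr X Y (fn f)) = g"
      using g F_arr[OF h] unfolding f_def hom_coalg by metis
    ultimately show "\<exists>f\<in>hom (game_cat U) X Y. amap ?F f = g" by blast
  next
    have "inj_on (omap ?F) (Ob (game_cat U))"
    proof (rule inj_onI)
      fix X Y assume "X \<in> Ob (game_cat U)" "Y \<in> Ob (game_cat U)" and eq: "omap ?F X = omap ?F Y"
      then have ob: "Game_ob X" "Game_ob Y" by (simp_all add: Ob_game)
      have fst: "fst X = fst Y" and fn: "fn (e X) = fn (e Y)"
        using eq by (simp_all add: F_ob) (metis fn_forgetful)
      have "(x, x') \<in> snd Y" if X: "Game_ob X" "Game_ob Y" "fst X = fst Y" "fn (e X) = fn (e Y)"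
        and x: "(x, x') \<in> snd X" for X Y x x'
        using gmor_edge[OF hom_gameD(3)[OF e[OF X(1)]] x] e_reflect[OF X(2), of x x']
          game_edge[OF Game_obD(1)[OF X(1)] x] X(3,4) by simp
      from this[OF ob fst fn] this[OF ob(2,1) fst[symmetric] fn[symmetric]]
      show "X = Y" using fst by (auto simp: prod_eq_iff)
    qed
    moreover have "\<exists>X\<in>Ob (game_cat U). omap ?F X = P" if P: "P \<in> Ob ?K" for P
    proof -
      obtain A h where Ah: "P = (A, h)" by (cases P)
      have A: "small U A" and h: "h \<in> hom (set_cat U) A (fst (omap R A))"
        and counit: "cmp (set_cat U) (c A) h = idn (set_cat U) A"
        and coassoc: "cmp (set_cat U) (amap forgetful (e (omap R A))) h =
          cmp (set_cat U) (amap forgetful (amap R h)) h"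
        using P unfolding Ob_coalg Ah by (simp_all add: Ob_set)
      let ?G = "omap R A"
      note G = cofreeD(1)[OF cofree[OF A]] and Rh = functor_hom[OF R h]
      have ch: "fn (c A) (fn h a) = a" if "a \<in> A" for a
        using counit fn_cmp_set[OF h that, of "c A"] that by simp
      have eh: "fn (e ?G) (fn h a) = fn (amap R h) (fn h a)" if "a \<in> A" for a
        using coassoc fn_cmp_set[OF h that, of "amap forgetful (e ?G)"]
          fn_cmp_set[OF h that, of "amap forgetful (amap R h)"] by simp
      \<comment> \<open>The game encoded by \<open>h\<close>: \<open>a'\<close> is an option of
        \<open>a\<close> when the tree \<open>h a'\<close> is an option of the tree
        \<open>h a\<close>. Branching is finite because \<open>c A\<close> is a left inverse of
        \<open>h\<close>.\<close>
      define X where "X = (A, {(a, a') \<in> A \<times> A. (fn h a, fn h a') \<in> snd ?G})"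
      have "is_game X"
        unfolding X_def
      proof (rule is_game_over[OF Game_obD(1)[OF G], where f = "fn h"])
        fix a
        have "{a'. (a, a') \<in> {(a, a') \<in> A \<times> A. (fn h a, fn h a') \<in> snd ?G}} \<subseteq>
            fn (c A) ` {t. (fn h a, t) \<in> snd ?G}"
          using ch by force
        then show "finite {a'. (a, a') \<in> {(a, a') \<in> A \<times> A. (fn h a, fn h a') \<in> snd ?G}}"
          by (rule finite_subset[OF _ finite_imageI[OF game_finite[OF Game_obD(1)[OF G]]]])
      qed auto
      then have X: "Game_ob X" using A by (simp add: Game_ob_def X_def)
      have gmor: "gmor X ?G (fn h)"
      proof (rule gmorI)
        fix a s assume "a \<in> fst X" and s: "(fn h a, s) \<in> snd ?G"
        then have a: "a \<in> A" by (simp add: X_def)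
        note s_in = game_edge(2)[OF Game_obD(1)[OF G] s]
        \<comment> \<open>Coassociativity identifies the unfolding of the tree \<open>h a\<close>
          with its relabelling by \<open>h\<close>. The move to \<open>s\<close> thus lifts to an
          option \<open>t\<close> of \<open>h a\<close> whose relabelling is the unfolding of
          \<open>s\<close>; comparing root labels gives \<open>s = h a'\<close>, where
          \<open>a'\<close> is the label of \<open>t\<close>.\<close>
        have "(fn (amap R h) (fn h a), fn (e ?G) s) \<in> snd (omap R (fst ?G))"
          using gmor_edge[OF hom_gameD(3)[OF e[OF G]] s] eh[OF a] by simp
        then obtain t where t: "(fn h a, t) \<in> snd ?G" "fn (amap R h) t = fn (e ?G) s"
          using gmor_lift[OF hom_gameD(3)[OF Rh]] hom_setD(3)[OF h a] by metis
        note t_in = game_edge(2)[OF Game_obD(1)[OF G] t(1)]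
        have "s = fn h (fn (c A) t)" using ce[OF G s_in] cR[OF h t_in] t(2) by simp
        moreover have "fn (c A) t \<in> A" using hom_setD(3)[OF c[OF A] t_in] .
        ultimately show "\<exists>a'. (a, a') \<in> snd X \<and> fn h a' = s" using a s by (auto simp: X_def)
      qed (use hom_setD(3)[OF h] in \<open>auto simp: X_def\<close>)
      have fst_X: "fst X = A" by (simp add: X_def)
      note eX = e[OF X, unfolded fst_X]
      \<comment> \<open>Both are morphisms into the cofree game that label \<open>a\<close> by
        itself.\<close>
      have "fn (e X) a = fn h a" if "a \<in> A" for a
        by (rule cofreeD(4)[OF cofree[OF A] X hom_gameD(3)[OF eX] gmor])
          (use that ce[OF X] ch fst_X in auto)
      then have "amap forgetful (e X) = h"
        using hom_set_eqI[OF forgetful_hom[OF eX], unfolded fst_X, OF h] by simp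
      then have "omap ?F X = P" by (simp add: F_ob fst_X Ah)
      then show ?thesis using X by (intro bexI[of _ X]) (simp_all add: Ob_game)
    qed
    ultimately show "bij_betw (omap ?F) (Ob (game_cat U)) (Ob ?K)"
      using functor_Ob[OF functor_F] unfolding bij_betw_def by blast
  qed
  then show ?thesis using adj unfolding comonadic_def by blast
qed


section \<open>Limits\<close>

text \<open>
  A limit of games is carved out of the cofree game on the limit of the underlying sets: it is the
  largest closed part on which all projections are path-lifting.
\<close>

lemma has_small_limits_game: "has_small_limits U (game_cat U)"
  unfolding has_small_limits_def
proof (intro allI impI, elim conjE)
  fix J D assume J: "small_category U J" and D: "is_functor J (game_cat U) D"
  have JC: "category J" using functor_category(1)[OF D] .
  have Dob: "Game_ob (omap D i)" if "i \<in> Ob J" for i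
    using functor_Ob[OF D that] by (simp add: Ob_game)
  \<comment> \<open>The limit of the underlying sets, as compatible families. Trees will be labelled
    by codes of such families, and \<open>p i\<close> reads component \<open>i\<close> of the
    label.\<close>
  define L where "L = {z \<in> Pi\<^sub>E (Ob J) (\<lambda>i. fst (omap D i)).
    \<forall>i j. \<forall>u\<in>hom J i j. fn (amap D u) (z i) = z j}"
  have "small U (Pi\<^sub>E (Ob J) (\<lambda>i. fst (omap D i)))"
    using J Dob by (intro small_PiE) (auto simp: small_category_def Game_obD)
  then have "small U L" by (rule small_subset[rotated]) (auto simp: L_def)
  then obtain \<phi> :: "('u \<Rightarrow> 'u) \<Rightarrow> 'u" where \<phi>: "inj_on \<phi> L" using ex_small_inj by blast
  obtain G c where G: "cofree (\<phi> ` L) G c" using ex_cofree[OF small_image[OF \<open>small U L\<close>]] by blast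
  note Gob = cofreeD(1)[OF G]
  define p where "p i t = inv_into L \<phi> (c t) i" for i t
  have z: "inv_into L \<phi> (c t) \<in> L" if "t \<in> fst G" for t
    using inv_into_into[OF cofreeD(2)[OF G that]] .
  have p_in: "p i t \<in> fst (omap D i)" if "t \<in> fst G" "i \<in> Ob J" for i t
    using z[OF that(1)] that(2) unfolding p_def L_def by auto
  have p_compat: "fn (amap D u) (p i t) = p j t" if "t \<in> fst G" "u \<in> hom J i j" for i j u t
    using z[OF that(1)] that(2) unfolding p_def L_def by blast
  \<comment> \<open>Preservation and lifting of moves at \<open>t\<close>, for all projections at
    once, as a single equality of option sets.\<close>
  define good where "good t \<longleftrightarrow>
    (\<forall>i\<in>Ob J. p i ` {s. (t, s) \<in> snd G} = {y. (p i t, y) \<in> snd (omap D i)})" for t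
  \<comment> \<open>Requiring goodness of everything reachable yields the largest closed set of good
    trees.\<close>
  define E where "E = {t \<in> fst G. \<forall>s. (t, s) \<in> (snd G)\<^sup>* \<longrightarrow> good s}"
  have closed: "closed_in G E"
    unfolding closed_in_def E_def
    using game_edge(2)[OF Game_obD(1)[OF Gob]] by (auto intro: converse_rtrancl_into_rtrancl)
  let ?l = "subgame G E"
  have l: "Game_ob ?l"
    using is_game_subgame[OF Game_obD(1)[OF Gob] closed] closed small_subset[OF _ Game_obD(2)[OF Gob]]
    by (simp add: Game_ob_def closed_in_def)
  have E_G: "t \<in> fst G" and E_good: "good t" if "t \<in> E" for t
    using that by (auto simp: E_def)
  have p_gmor: "gmor ?l (omap D i) (p i)" if i: "i \<in> Ob J" for i
  proof (rule gmorI)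
    fix t s assume "(t, s) \<in> snd ?l"
    then show "(p i t, p i s) \<in> snd (omap D i)"
      using E_good[of t] i unfolding good_def subgame_def by auto
  next
    fix t y assume "t \<in> fst ?l" "(p i t, y) \<in> snd (omap D i)"
    then have t: "t \<in> E" and "y \<in> p i ` {s. (t, s) \<in> snd G}"
      using E_good[of t] i unfolding good_def by auto
    then show "\<exists>s. (t, s) \<in> snd ?l \<and> p i s = y" by (auto simp: subgame_def)
  qed (use p_in i E_G in auto)
  define P where "P i = garr ?l (omap D i) (p i)" for i
  have P: "P i \<in> hom (game_cat U) ?l (omap D i)" if "i \<in> Ob J" for i
    unfolding P_def by (rule garr_hom[OF l Dob[OF that] p_gmor[OF that]])
  have fn_P: "fn (P i) t = p i t" if "t \<in> E" for i t
    using that by (simp add: P_def)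
  have cone: "is_cone J (game_cat U) D ?l P"
    unfolding is_cone_def
  proof (intro conjI ballI allI)
    fix i j u assume u: "u \<in> hom J i j"
    then have ij: "i \<in> Ob J" "j \<in> Ob J" using category_hom_Ob[OF JC] by auto
    show "cmp (game_cat U) (amap D u) (P i) = P j"
      by (rule hom_game_eqI[OF cmp_game_hom[OF P[OF ij(1)] functor_hom[OF D u]] P[OF ij(2)]])
        (use p_compat[OF E_G u] in \<open>simp add: fn_cmp_game[OF P[OF ij(1)]] fn_P\<close>)
  qed (use l P in \<open>simp_all add: Ob_game\<close>)
  have "is_limit J (game_cat U) D ?l P"
    unfolding is_limit_def
  proof (intro conjI allI impI cone)
    fix M d assume "is_cone J (game_cat U) D M d"
    then have M: "Game_ob M" and d: "\<And>i. i \<in> Ob J \<Longrightarrow> d i \<in> hom (game_cat U) M (omap D i)"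
      and d_compat: "\<And>i j u. u \<in> hom J i j \<Longrightarrow> cmp (game_cat U) (amap D u) (d i) = d j"
      by (auto simp: is_cone_def Ob_game)
    define w where "w x = (\<lambda>i\<in>Ob J. fn (d i) x)" for x
    have w: "w x \<in> L" if x: "x \<in> fst M" for x
    proof -
      have "fn (amap D u) (w x i) = w x j" if u: "u \<in> hom J i j" for i j u
        using category_hom_Ob[OF JC u] fn_cmp_game[OF d x, of i "amap D u"] d_compat[OF u]
        by (simp add: w_def)
      then show ?thesis using hom_gameD(4)[OF d] x by (auto simp: L_def w_def)
    qed
    obtain u where u: "gmor M G u" "\<And>x. x \<in> fst M \<Longrightarrow> c (u x) = \<phi> (w x)"
      using cofreeD(3)[OF G M, of "\<lambda>x. \<phi> (w x)"] w by blast
    have pu: "p i (u x) = fn (d i) x" if "x \<in> fst M" "i \<in> Ob J" for i x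
      using that u(2)[OF that(1)] \<phi> w by (simp add: p_def w_def)
    have good: "good (u x)" if x: "x \<in> fst M" for x
      unfolding good_def
    proof (intro ballI)
      fix i assume i: "i \<in> Ob J"
      have succ: "{s. (u x, s) \<in> snd G} = u ` {x'. (x, x') \<in> snd M}"
        using gmor_edge[OF u(1)] gmor_lift[OF u(1) x] by blast
      have "p i ` {s. (u x, s) \<in> snd G} = fn (d i) ` {x'. (x, x') \<in> snd M}"
        unfolding succ image_image
        by (rule image_cong) (use pu i game_edge(2)[OF Game_obD(1)[OF M]] in auto)
      also have "\<dots> = {y. (fn (d i) x, y) \<in> snd (omap D i)}"
        using gmor_edge[OF hom_gameD(3)[OF d[OF i]]] gmor_lift[OF hom_gameD(3)[OF d[OF i]] x] by blast
      finally show "p i ` {s. (u x, s) \<in> snd G} = {y. (p i (u x), y) \<in> snd (omap D i)}"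
        using pu[OF x i] by simp
    qed
    \<comment> \<open>Whatever is reachable from \<open>u x\<close> is again a value of
      \<open>u\<close>, and all such values are good because the legs of the given cone are
      morphisms.\<close>
    have "u x \<in> E" if x: "x \<in> fst M" for x
    proof -
      have "\<exists>x'\<in>fst M. s = u x'" if "(u x, s) \<in> (snd G)\<^sup>*" for s
        using gmor_lift_rtrancl[OF Game_obD(1)[OF M] u(1) x that] by blast
      then show ?thesis using good gmor_in[OF u(1) x] by (auto simp: E_def)
    qed
    then have "gmor M ?l u" using gmor_into_subgame[OF Game_obD(1)[OF M] u(1)] by blast
    then have h: "garr M ?l u \<in> hom (game_cat U) M ?l" by (rule garr_hom[OF M l])
    have "cmp (game_cat U) (P i) (garr M ?l u) = d i" if i: "i \<in> Ob J" for i
      by (rule hom_game_eqI[OF cmp_game_hom[OF h P[OF i]] d[OF i]])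
        (use hom_gameD(4)[OF h] pu i in \<open>simp add: fn_cmp_game[OF h] fn_P\<close>)
    moreover have "k = garr M ?l u" if k: "k \<in> hom (game_cat U) M ?l"
      and kd: "\<forall>i\<in>Ob J. cmp (game_cat U) (P i) k = d i" for k
    proof (rule hom_game_eqI[OF k h])
      fix x assume x: "x \<in> fst M"
      \<comment> \<open>The projections determine the family coded by a label, hence the label;
        cofreeness then determines the tree.\<close>
      have "c (fn k x) = c (u x)" if x: "x \<in> fst M" for x
      proof -
        have kx: "fn k x \<in> E" using hom_gameD(4)[OF k x] by simp
        have "p i (fn k x) = w x i" if i: "i \<in> Ob J" for i
          using fn_cmp_game[OF k x, of "P i"] kd i kx by (simp add: fn_P w_def)
        then have "inv_into L \<phi> (c (fn k x)) = w x"
          using z[OF E_G[OF kx]] w[OF x] unfolding p_def L_def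
          by (intro PiE_ext[of _ "Ob J" "\<lambda>i. fst (omap D i)"]) auto
        then show ?thesis
          using u(2)[OF x] f_inv_into_f[OF cofreeD(2)[OF G E_G[OF kx]]] by simp
      qed
      then have "fn k x = u x"
        using cofreeD(4)[OF G M gmor_comp[OF hom_gameD(3)[OF k] gmor_subgame[OF closed]] u(1) _ x]
        by blast
      then show "fn k x = fn (garr M ?l u) x" using x by simp
    qed
    ultimately show "\<exists>!h. h \<in> hom (game_cat U) M ?l \<and> (\<forall>i\<in>Ob J. cmp (game_cat U) (P i) h = d i)"
      using h by blast
  qed
  then show "\<exists>l c. is_limit J (game_cat U) D l c" by blast
qed

end

section \<open>The subobject classifier\<close>

text \<open>The corners bound existentially in \<open>is_pullback\<close> are forced by the sources
  and targets of \<open>p\<close> and \<open>q\<close>, so the universal property becomes usable at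
  known objects.\<close>

lemma pullbackD:
  assumes pb: "is_pullback C p q f g" and p: "p \<in> hom C w x" and q: "q \<in> hom C w y"
  shows "cmp C f p = cmp C g q"
    and "\<And>v a b. a \<in> hom C v x \<Longrightarrow> b \<in> hom C v y \<Longrightarrow> cmp C f a = cmp C g b \<Longrightarrow>
      \<exists>h. h \<in> hom C v w \<and> cmp C p h = a"
proof -
  obtain w' x' y' where "p \<in> hom C w' x'" "q \<in> hom C w' y'" "cmp C f p = cmp C g q"
    and univ: "\<forall>v. \<forall>a\<in>hom C v x'. \<forall>b\<in>hom C v y'. cmp C f a = cmp C g b \<longrightarrow>
      (\<exists>!h. h \<in> hom C v w' \<and> cmp C p h = a \<and> cmp C q h = b)"
    using pb unfolding is_pullback_def by blast
  then have "w' = w" "x' = x" "y' = y" "cmp C f p = cmp C g q" using p q by (auto simp: hom_def)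
  then show "cmp C f p = cmp C g q"
    and "\<And>v a b. a \<in> hom C v x \<Longrightarrow> b \<in> hom C v y \<Longrightarrow> cmp C f a = cmp C g b \<Longrightarrow>
      \<exists>h. h \<in> hom C v w \<and> cmp C p h = a"
    using univ by blast+
qed

lemma is_game_product:
  assumes X: "is_game X"
  shows "is_game (K, {((x, x'), (y, y')). (x, x') \<in> K \<and> (y, y') \<in> K \<and> (x, y) \<in> snd X \<and> (x', y') \<in> snd X})"
    (is "is_game (K, ?R)")
proof (rule is_game_over[OF X, where f = fst])
  fix p
  have "{q. (p, q) \<in> ?R} \<subseteq> {y. (fst p, y) \<in> snd X} \<times> {y'. (snd p, y') \<in> snd X}" by auto
  then show "finite {q. (p, q) \<in> ?R}"
    by (rule finite_subset) (simp add: game_finite[OF X])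
qed auto

text \<open>An injective morphism reflects edges: a lift of the move from \<open>m (h z)\<close> to
  \<open>m (h z')\<close> can only end in \<open>h z'\<close>. Hence a factorisation of functions is
  already one of games.\<close>

lemma gmor_factor_inj:
  assumes "is_game V" "gmor X Y m" "inj_on m (fst X)" "gmor V Y f"
    and h: "\<And>z. z \<in> fst V \<Longrightarrow> h z \<in> fst X \<and> m (h z) = f z"
    and X: "is_game X"
  shows "gmor V X h"
proof (rule gmorI)
  fix z z' assume zz': "(z, z') \<in> snd V"
  note in_V = game_edge[OF assms(1) zz']
  have "(m (h z), m (h z')) \<in> snd Y" using gmor_edge[OF assms(4) zz'] h in_V by simp
  then obtain x where x: "(h z, x) \<in> snd X" "m x = m (h z')"
    using gmor_lift[OF assms(2)] h in_V by metis
  then have "x = h z'" using inj_onD[OF assms(3) x(2)] h[OF in_V(2)] game_edge(2)[OF X x(1)] by blast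
  then show "(h z, h z') \<in> snd X" using x by simp
next
  fix z x assume z: "z \<in> fst V" and x: "(h z, x) \<in> snd X"
  then have "(f z, m x) \<in> snd Y" using gmor_edge[OF assms(2) x] h by simp
  then obtain z' where z': "(z, z') \<in> snd V" "f z' = m x" using gmor_lift[OF assms(4) z] by metis
  then have "h z' = x"
    using assms(3) h game_edge(2)[OF X x] game_edge(2)[OF assms(1) z'(1)] by (metis inj_on_eq_iff)
  then show "\<exists>z'. (z, z') \<in> snd V \<and> h z' = x" using z' by blast
qed (use h in blast)

context small_universe
begin

text \<open>The kernel pair of a morphism, taken in the category of sets, is a game.\<close>

lemma mono_game_inj_on:
  assumes m: "m \<in> hom (game_cat U) X Y" and mono: "is_mono (game_cat U) m"
  shows "inj_on (fn m) (fst X)"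
proof (rule inj_onI)
  fix a a' assume a: "a \<in> fst X" "a' \<in> fst X" "fn m a = fn m a'"
  note X = hom_gameD(1)[OF m] and gmor_m = hom_gameD(3)[OF m]
  define K where "K = {(x, x') \<in> fst X \<times> fst X. fn m x = fn m x'}"
  define KG where
    "KG = (K, {((x, x'), (y, y')). (x, x') \<in> K \<and> (y, y') \<in> K \<and> (x, y) \<in> snd X \<and> (x', y') \<in> snd X})"
  have KG: "is_game KG" unfolding KG_def by (rule is_game_product[OF Game_obD(1)[OF X]])
  \<comment> \<open>A move of one coordinate is pushed forward by \<open>m\<close> and lifted at the
    other coordinate, which has the same value. So a move in either coordinate extends to a move of
    pairs, and both projections are path-lifting.\<close>
  have lift: "\<exists>y'. (y, y') \<in> K \<and> (x', y') \<in> snd X"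
    if K: "(x, x') \<in> K" and edge: "(x, y) \<in> snd X" for x x' y
  proof -
    have "(fn m x', fn m y) \<in> snd Y" using gmor_edge[OF gmor_m edge] K by (simp add: K_def)
    then obtain y' where y': "(x', y') \<in> snd X" "fn m y' = fn m y"
      using gmor_lift[OF gmor_m] K unfolding K_def by blast
    have "(y, y') \<in> K"
      using y' edge game_edge(2)[OF Game_obD(1)[OF X] edge] game_edge(2)[OF Game_obD(1)[OF X] y'(1)]
      by (simp add: K_def)
    then show ?thesis using y'(1) by blast
  qed
  have K_sym: "(x', x) \<in> K" if "(x, x') \<in> K" for x x' using that by (auto simp: K_def)
  have fst: "gmor KG X fst"
  proof (rule gmorI)
    fix p y assume "p \<in> fst KG" "(fst p, y) \<in> snd X"
    then obtain x x' y' where p: "p = (x, x')" "(x, x') \<in> K" "(x, y) \<in> snd X"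
      and y': "(y, y') \<in> K" "(x', y') \<in> snd X"
      using lift[of "fst p" "snd p" y] by (cases p) (auto simp: KG_def)
    then have "(p, (y, y')) \<in> snd KG" by (simp add: KG_def)
    then show "\<exists>p'. (p, p') \<in> snd KG \<and> fst p' = y" by (intro exI[of _ "(y, y')"]) simp
  qed (auto simp: KG_def K_def)
  have snd: "gmor KG X snd"
  proof (rule gmorI)
    fix p y assume "p \<in> fst KG" "(snd p, y) \<in> snd X"
    then obtain x x' y' where p: "p = (x, x')" "(x, x') \<in> K" "(x', y) \<in> snd X"
      and y': "(y, y') \<in> K" "(x, y') \<in> snd X"
      using lift[of "snd p" "fst p" y] K_sym by (cases p) (auto simp: KG_def)
    then have "(p, (y', y)) \<in> snd KG" using K_sym by (simp add: KG_def)
    then show "\<exists>p'. (p, p') \<in> snd KG \<and> snd p' = y" by (intro exI[of _ "(y', y)"]) simp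
  qed (auto simp: KG_def K_def)
  have "small U (fst X \<times> fst X)" by (intro small_Sigma Game_obD(2)[OF X])
  then have small: "small U (fst KG)" by (rule small_subset[rotated]) (auto simp: KG_def K_def)
  then obtain \<phi> :: "'u \<times> 'u \<Rightarrow> 'u" where \<phi>: "inj_on \<phi> (fst KG)" using ex_small_inj by blast
  let ?K = "image_game \<phi> KG" and ?inv = "inv_into (fst KG) \<phi>"
  have K_ob: "Game_ob ?K"
    using small_image[OF small] is_game_image_game[OF KG \<phi>] by (simp add: Game_ob_def)
  note inv = gmor_image_game_inv[OF KG \<phi>]
  define f where "f = garr ?K X (\<lambda>p. fst (?inv p))"
  define g where "g = garr ?K X (\<lambda>p. snd (?inv p))"
  have f: "f \<in> hom (game_cat U) ?K X" and g: "g \<in> hom (game_cat U) ?K X"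
    unfolding f_def g_def by (rule garr_hom[OF K_ob X gmor_comp[OF inv fst]],
        rule garr_hom[OF K_ob X gmor_comp[OF inv snd]])
  have fn_fg: "fn f p = fst (?inv p)" "fn g p = snd (?inv p)" if "p \<in> fst ?K" for p
    using that by (simp_all add: f_def g_def)
  have "cmp (game_cat U) m f = cmp (game_cat U) m g"
  proof (rule hom_game_eqI[OF cmp_game_hom[OF f m] cmp_game_hom[OF g m]])
    fix p assume p: "p \<in> fst ?K"
    then have "?inv p \<in> K" using inv_into_into[of p \<phi> "fst KG"] by (simp add: KG_def)
    then show "fn (cmp (game_cat U) m f) p = fn (cmp (game_cat U) m g) p"
      using fn_cmp_game[OF f p, of m] fn_cmp_game[OF g p, of m] fn_fg[OF p]
      by (simp add: K_def case_prod_beta)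
  qed
  moreover have "src (game_cat U) m = X" using m by (simp add: hom_def)
  ultimately have "f = g" using mono f g unfolding is_mono_def by blast
  \<comment> \<open>The given pair is itself a position of the kernel pair, and there the two
    projections return \<open>a\<close> and \<open>a'\<close>.\<close>
  have aa': "(a, a') \<in> fst KG" using a by (simp add: KG_def K_def)
  then have "\<phi> (a, a') \<in> fst ?K" "?inv (\<phi> (a, a')) = (a, a')" using \<phi> by auto
  then show "a = a'" using arg_cong[OF \<open>f = g\<close>, of "\<lambda>h. fn h (\<phi> (a, a'))"] fn_fg[of "\<phi> (a, a')"] by simp
qed

text \<open>
  The classifier consists of the hereditarily finite trees with labels \<open>a\<close> (true) and \<open>b\<close> (false)
  in which every option of a true node is true. The terminal game is its part of trees without
  false nodes, because a vertex of a subgame has all its options in the subgame.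
\<close>

lemma has_subobject_classifier_game: "has_subobject_classifier (game_cat U)"
proof -
  obtain a b :: 'u where "a \<noteq> b"
    using infinite_UNIV by (metis (full_types) UNIV_I ex_new_if_finite finite.intros insert_iff)
  obtain G c where G: "cofree {a, b} G c" using ex_cofree[OF small_finite, of "{a, b}"] by auto
  note Gob = cofreeD(1)[OF G]
  \<comment> \<open>The condition ranges over all reachable nodes, since options of false nodes must
    obey it as well; this also makes \<open>E\<close> closed.\<close>
  define E where "E = {t \<in> fst G. \<forall>s s'. (t, s) \<in> (snd G)\<^sup>* \<longrightarrow> (s, s') \<in> snd G \<longrightarrow> c s = a \<longrightarrow> c s' = a}"
  define T where "T = {t \<in> fst G. \<forall>s. (t, s) \<in> (snd G)\<^sup>* \<longrightarrow> c s = a}"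
  have E_closed: "closed_in G E"
    unfolding closed_in_def E_def using game_edge(2)[OF Game_obD(1)[OF Gob]]
    by (blast intro: converse_rtrancl_into_rtrancl)
  have T_closed: "closed_in G T"
    unfolding closed_in_def T_def using game_edge(2)[OF Game_obD(1)[OF Gob]]
    by (blast intro: converse_rtrancl_into_rtrancl)
  have T_E: "T \<subseteq> E" unfolding T_def E_def by (blast intro: rtrancl_into_rtrancl)
  have T_label: "c t = a" if "t \<in> T" for t using that by (auto simp: T_def)
  have E_label: "t \<in> T" if t: "t \<in> E" and "c t = a" for t
  proof -
    have "c s = a" if "(t, s) \<in> (snd G)\<^sup>*" for s
      using that by (induct rule: rtrancl_induct) (use t \<open>c t = a\<close> in \<open>auto simp: E_def\<close>)
    then show ?thesis using t by (simp add: T_def E_def)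
  qed
  let ?O = "subgame G E" and ?T = "subgame G T"
  have ob: "Game_ob ?O" "Game_ob ?T"
    using is_game_subgame[OF Game_obD(1)[OF Gob]] E_closed T_closed small_subset[OF _ Game_obD(2)[OF Gob]]
    by (simp_all add: Game_ob_def closed_in_def)
  have T_uniq: "f = g" if f: "f \<in> hom (game_cat U) Y ?T" and g: "g \<in> hom (game_cat U) Y ?T" for Y f g
  proof (rule hom_game_eqI[OF f g])
    fix y assume y: "y \<in> fst Y"
    have "c (fn f y) = c (fn g y)" if "y \<in> fst Y" for y
      using hom_gameD(4)[OF f that] hom_gameD(4)[OF g that] T_label by simp
    then show "fn f y = fn g y"
      using cofreeD(4)[OF G hom_gameD(1)[OF f] gmor_comp[OF hom_gameD(3)[OF f] gmor_subgame[OF T_closed]]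
          gmor_comp[OF hom_gameD(3)[OF g] gmor_subgame[OF T_closed]] _ y] by blast
  qed
  have T_ex: "\<exists>f. f \<in> hom (game_cat U) Y ?T" if Y: "Game_ob Y" for Y
  proof -
    obtain u where u: "gmor Y G u" "\<And>y. y \<in> fst Y \<Longrightarrow> c (u y) = a"
      using cofreeD(3)[OF G Y, of "\<lambda>_. a"] by blast
    have "u y \<in> T" if y: "y \<in> fst Y" for y
      unfolding T_def using gmor_in[OF u(1) y] gmor_lift_rtrancl[OF Game_obD(1)[OF Y] u(1) y] u(2) by blast
    then have "gmor Y ?T u" by (rule gmor_into_subgame[OF Game_obD(1)[OF Y] u(1)])
    then show ?thesis using garr_hom[OF Y ob(2)] by blast
  qed
  have terminal: "is_terminal (game_cat U) ?T"
    unfolding is_terminal_def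
  proof (intro conjI ballI ex_ex1I)
    show "?T \<in> Ob (game_cat U)" using ob(2) by (simp add: Ob_game)
    show "\<exists>f. f \<in> hom (game_cat U) Y ?T" if "Y \<in> Ob (game_cat U)" for Y
      using T_ex that by (simp add: Ob_game)
  qed (rule T_uniq)
  define tru where "tru = garr ?T ?O (\<lambda>t. t)"
  have "gmor ?T ?O (\<lambda>t. t)"
    by (rule gmor_into_subgame[OF Game_obD(1)[OF ob(2)] gmor_subgame[OF T_closed]]) (use T_E in auto)
  then have tru: "tru \<in> hom (game_cat U) ?T ?O" unfolding tru_def by (rule garr_hom[OF ob(2,1)])
  have fn_tru: "fn tru t = t" if "t \<in> T" for t using that by (simp add: tru_def)
  have "\<exists>!chi. chi \<in> hom (game_cat U) Y ?O \<and>
      (\<exists>q\<in>hom (game_cat U) X ?T. is_pullback (game_cat U) m q chi tru)"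
    if m: "m \<in> hom (game_cat U) X Y" and mono: "is_mono (game_cat U) m" for X Y m
  proof -
    note inj = mono_game_inj_on[OF m mono] and X = hom_gameD(1)[OF m] and Y = hom_gameD(2)[OF m]
      and gmor_m = hom_gameD(3)[OF m]
    define A where "A = fn m ` fst X"
    have A: "closed_in Y A" unfolding A_def by (rule closed_in_image[OF Game_obD(1)[OF X] gmor_m])
    \<comment> \<open>The unfolding of the characteristic function of the image. It stays in
      \<open>E\<close> because the image is closed under options.\<close>
    have "\<exists>w. gmor Y G w \<and> (\<forall>y\<in>fst Y. c (w y) = (if y \<in> A then a else b))"
      by (rule cofreeD(3)[OF G Y]) auto
    then obtain w where w: "gmor Y G w" "\<And>y. y \<in> fst Y \<Longrightarrow> c (w y) = (if y \<in> A then a else b)"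
      by blast
    have w_E: "w y \<in> E" if y: "y \<in> fst Y" for y
      unfolding E_def
    proof (intro CollectI conjI allI impI)
      fix s s' assume s: "(w y, s) \<in> (snd G)\<^sup>*" "(s, s') \<in> snd G" "c s = a"
      obtain y' where y': "y' \<in> fst Y" "s = w y'"
        using gmor_lift_rtrancl[OF Game_obD(1)[OF Y] w(1) y s(1)] by blast
      obtain y'' where y'': "(y', y'') \<in> snd Y" "w y'' = s'"
        using gmor_lift[OF w(1) y'(1)] s(2) y'(2) by blast
      have "y' \<in> A" using s(3) w(2)[OF y'(1)] y'(2) \<open>a \<noteq> b\<close> by (auto split: if_splits)
      then have "y'' \<in> A" using A y''(1) unfolding closed_in_def by blast
      then show "c s' = a" using w(2) game_edge(2)[OF Game_obD(1)[OF Y] y''(1)] y''(2) by auto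
    qed (rule gmor_in[OF w(1) y])
    define chi where "chi = garr Y ?O w"
    have chi: "chi \<in> hom (game_cat U) Y ?O"
      unfolding chi_def
      by (rule garr_hom[OF Y ob(1) gmor_into_subgame[OF Game_obD(1)[OF Y] w(1) w_E]])
    have fn_chi: "fn chi y = w y" if "y \<in> fst Y" for y using that by (simp add: chi_def)
    obtain q where q: "q \<in> hom (game_cat U) X ?T" using T_ex[OF X] by blast
    have square: "cmp (game_cat U) chi m = cmp (game_cat U) tru q"
    proof (rule hom_game_eqI[OF cmp_game_hom[OF m chi] cmp_game_hom[OF q tru]])
      fix x assume x: "x \<in> fst X"
      have q_T: "fn q x \<in> T" if "x \<in> fst X" for x using hom_gameD(4)[OF q that] by simp
      have "c (w (fn m x)) = c (fn q x)" if "x \<in> fst X" for x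
        using w(2) hom_gameD(4)[OF m that] T_label[OF q_T[OF that]] that by (simp add: A_def)
      then have "w (fn m x) = fn q x"
        using cofreeD(4)[OF G X gmor_comp[OF gmor_m w(1)]
            gmor_comp[OF hom_gameD(3)[OF q] gmor_subgame[OF T_closed]] _ x] by blast
      then show "fn (cmp (game_cat U) chi m) x = fn (cmp (game_cat U) tru q) x"
        using fn_cmp_game[OF m x] fn_cmp_game[OF q x] fn_chi hom_gameD(4)[OF m x] fn_tru[OF q_T[OF x]]
        by simp
    qed
    have pullback: "is_pullback (game_cat U) m q chi tru"
      unfolding is_pullback_def
    proof (intro exI conjI allI ballI impI)
      fix V f g assume f: "f \<in> hom (game_cat U) V Y" and g: "g \<in> hom (game_cat U) V ?T"
        and eq: "cmp (game_cat U) chi f = cmp (game_cat U) tru g"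
      note V = hom_gameD(1)[OF f]
      have f_A: "fn f z \<in> A" if z: "z \<in> fst V" for z
      proof -
        have "w (fn f z) = fn g z"
          using arg_cong[OF eq, of "\<lambda>h. fn h z"] fn_cmp_game[OF f z] fn_cmp_game[OF g z]
            fn_chi hom_gameD(4)[OF f z] fn_tru hom_gameD(4)[OF g z] by simp
        then have "c (w (fn f z)) = a" using T_label hom_gameD(4)[OF g z] by simp
        then show ?thesis using w(2)[OF hom_gameD(4)[OF f z]] \<open>a \<noteq> b\<close> by (auto split: if_splits)
      qed
      \<comment> \<open>Membership in \<open>A\<close> gives a preimage under \<open>m\<close>, and
        injectivity makes the resulting factorisation path-lifting.\<close>
      let ?h = "\<lambda>z. inv_into (fst X) (fn m) (fn f z)"
      have h_m: "?h z \<in> fst X \<and> fn m (?h z) = fn f z" if "z \<in> fst V" for z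
        using f_A[OF that] unfolding A_def by (simp add: inv_into_into f_inv_into_f)
      have h: "garr V X ?h \<in> hom (game_cat U) V X"
        by (rule garr_hom[OF V X gmor_factor_inj[OF Game_obD(1)[OF V] gmor_m inj hom_gameD(3)[OF f] h_m Game_obD(1)[OF X]]])
      have mh: "cmp (game_cat U) m (garr V X ?h) = f"
        by (rule hom_game_eqI[OF cmp_game_hom[OF h m] f]) (simp add: fn_cmp_game[OF h] h_m)
      have "cmp (game_cat U) q (garr V X ?h) = g" by (rule T_uniq[OF cmp_game_hom[OF h q] g])
      moreover have "k = garr V X ?h"
        if k: "k \<in> hom (game_cat U) V X" and kf: "cmp (game_cat U) m k = f" for k
      proof -
        have "src (game_cat U) m = X" using m by (simp add: hom_def)
        then show ?thesis
          using mono[unfolded is_mono_def, THEN conjunct2, rule_format, of k V "garr V X ?h"] k h kf mh by simp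
      qed
      ultimately show "\<exists>!h. h \<in> hom (game_cat U) V X \<and> cmp (game_cat U) m h = f \<and> cmp (game_cat U) q h = g"
        using h mh by blast
    qed (fact m q chi tru square)+
    have "chi' = chi" if chi': "chi' \<in> hom (game_cat U) Y ?O" and q': "q' \<in> hom (game_cat U) X ?T"
      and pb: "is_pullback (game_cat U) m q' chi' tru" for chi' q'
    proof (rule hom_game_eqI[OF chi' chi])
      note square' = pullbackD(1)[OF pb m q'] and univ = pullbackD(2)[OF pb m q']
      have chi'_E: "fn chi' y \<in> E" if "y \<in> fst Y" for y using hom_gameD(4)[OF chi' that] by simp
      \<comment> \<open>A map into the cofree game is determined by its labels, so it remains to see
        that the pullback property forces \<open>a\<close> exactly on \<open>A\<close>.\<close>
      have label: "c (fn chi' y) = (if y \<in> A then a else b)" if y: "y \<in> fst Y" for y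
      proof (cases "y \<in> A")
        case True
        then obtain x where x: "x \<in> fst X" "y = fn m x" by (auto simp: A_def)
        have "fn q' x \<in> T" using hom_gameD(4)[OF q' x(1)] by simp
        moreover have "fn chi' y = fn tru (fn q' x)"
          using arg_cong[OF square', of "\<lambda>h. fn h x"] fn_cmp_game[OF m x(1)] fn_cmp_game[OF q' x(1)] x(2)
          by simp
        ultimately show ?thesis using True T_label fn_tru by simp
      next
        case False
        have "c (fn chi' y) \<noteq> a"
        proof
          assume "c (fn chi' y) = a"
          then have y_T: "fn chi' y \<in> T" using E_label[OF chi'_E[OF y]] by blast
          \<comment> \<open>One position need not be the value of a morphism from a one-point game,
            so the universal property is tested on the closed part generated by \<open>y\<close>.
            There \<open>chi'\<close> stays in \<open>T\<close>, so the inclusion factors through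
            \<open>m\<close>, which puts \<open>y\<close> into \<open>A\<close>.\<close>
          define V where "V = {y'. (y, y') \<in> (snd Y)\<^sup>*}"
          have V_Y: "V \<subseteq> fst Y"
          proof
            fix y' assume "y' \<in> V"
            then have "(y, y') \<in> (snd Y)\<^sup>*" by (simp add: V_def)
            then show "y' \<in> fst Y"
              by (induct rule: rtrancl_induct) (use y game_edge(2)[OF Game_obD(1)[OF Y]] in auto)
          qed
          then have V: "closed_in Y V" by (auto simp: closed_in_def V_def)
          have V_ob: "Game_ob (subgame Y V)"
            using is_game_subgame[OF Game_obD(1)[OF Y] V] small_subset[OF V_Y Game_obD(2)[OF Y]]
            by (simp add: Game_ob_def)
          note gmor_chi' = gmor_comp[OF hom_gameD(3)[OF chi'] gmor_subgame[OF E_closed]]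
          have V_T: "fn chi' y' \<in> T" if "y' \<in> V" for y'
          proof -
            have "(y, y') \<in> (snd Y)\<^sup>*" using that by (simp add: V_def)
            then show ?thesis
              by (induct rule: rtrancl_induct)
                (use y_T T_closed gmor_edge[OF gmor_chi'] in \<open>auto simp: closed_in_def\<close>)
          qed
          define f where "f = garr (subgame Y V) Y (\<lambda>y. y)"
          have f: "f \<in> hom (game_cat U) (subgame Y V) Y"
            unfolding f_def by (rule garr_hom[OF V_ob Y gmor_subgame[OF V]])
          define g where "g = garr (subgame Y V) ?T (fn chi')"
          have "gmor (subgame Y V) ?T (fn chi')"
            by (rule gmor_into_subgame[OF Game_obD(1)[OF V_ob] gmor_comp[OF gmor_subgame[OF V] gmor_chi']])
              (simp add: V_T)
          then have g: "g \<in> hom (game_cat U) (subgame Y V) ?T"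
            unfolding g_def by (rule garr_hom[OF V_ob ob(2)])
          have fn_fg: "fn f y' = y'" "fn g y' = fn chi' y'" if "y' \<in> V" for y'
            using that by (simp_all add: f_def g_def)
          have "cmp (game_cat U) chi' f = cmp (game_cat U) tru g"
            by (rule hom_game_eqI[OF cmp_game_hom[OF f chi'] cmp_game_hom[OF g tru]])
              (simp add: fn_cmp_game[OF f] fn_cmp_game[OF g] fn_fg fn_tru V_T)
          then obtain h where h: "h \<in> hom (game_cat U) (subgame Y V) X" "cmp (game_cat U) m h = f"
            using univ[OF f g] by blast
          have "y \<in> V" by (simp add: V_def)
          then have "y = fn m (fn h y)"
            using fn_cmp_game[OF h(1), of y m] h(2) fn_fg(1)[of y] by simp
          moreover have "fn h y \<in> fst X" using hom_gameD(4)[OF h(1)] \<open>y \<in> V\<close> by simp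
          ultimately show False using False by (auto simp: A_def)
        qed
        then show ?thesis using False cofreeD(2)[OF G] chi'_E[OF y] by (auto simp: E_def)
      qed
      fix y assume y: "y \<in> fst Y"
      have "fn chi' y = w y"
        by (rule cofreeD(4)[OF G Y gmor_comp[OF hom_gameD(3)[OF chi'] gmor_subgame[OF E_closed]] w(1) _ y])
          (simp add: label w(2))
      then show "fn chi' y = fn chi y" using fn_chi[OF y] by simp
    qed
    then show ?thesis using chi q pullback by blast
  qed
  then have "is_subobject_classifier (game_cat U) ?T ?O tru"
    unfolding is_subobject_classifier_def using terminal tru ob(1) by (simp add: Ob_game del: split_paired_All split_paired_Ex)
  then show ?thesis unfolding has_subobject_classifier_def by blast
qed

end

section \<open>Local finite presentability\<close>

lemma filtered_span:
  assumes J: "category J" "filtered J" and u: "u \<in> hom J i j" and v: "v \<in> hom J i k"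
  obtains m a b where "a \<in> hom J j m" "b \<in> hom J k m" "cmp J a u = cmp J b v"
proof -
  have jk: "j \<in> Ob J" "k \<in> Ob J" using category_hom_Ob[OF J(1)] u v by auto
  obtain n a b where n: "a \<in> hom J j n" "b \<in> hom J k n"
    using J(2) jk unfolding filtered_def by blast
  note au = category_cmp[OF J(1) u n(1)] and bv = category_cmp[OF J(1) v n(2)]
  obtain m w where w: "w \<in> hom J n m" "cmp J w (cmp J a u) = cmp J w (cmp J b v)"
    using J(2) au bv unfolding filtered_def by blast
  show thesis
  proof (rule that)
    show "cmp J (cmp J w a) u = cmp J (cmp J w b) v"
      using w(2) category_assoc[OF J(1) u n(1) w(1)] category_assoc[OF J(1) v n(2) w(1)] by simp
  qed (use category_cmp[OF J(1)] n w(1) in blast)+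
qed

lemma filtered_upper_bound:
  assumes J: "category J" "filtered J" and "finite S" "\<And>x. x \<in> S \<Longrightarrow> f x \<in> Ob J"
  shows "\<exists>k\<in>Ob J. \<forall>x\<in>S. hom J (f x) k \<noteq> {}"
  using assms(3,4)
proof (induct S rule: finite_induct)
  case empty
  then show ?case using J(2) unfolding filtered_def by blast
next
  case (insert x S)
  then obtain k where k: "k \<in> Ob J" "\<forall>x\<in>S. hom J (f x) k \<noteq> {}" by auto
  obtain m where m: "m \<in> Ob J" "hom J k m \<noteq> {}" "hom J (f x) m \<noteq> {}"
    using J(2) k(1) insert.prems[of x] unfolding filtered_def by blast
  then have "\<forall>x\<in>S. hom J (f x) m \<noteq> {}" using k(2) category_cmp[OF J(1)] by blast
  then show ?case using m by blast
qed

context small_universe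
begin

lemma locally_small_game: "locally_small U (game_cat U)"
  unfolding locally_small_def
proof (intro ballI)
  fix G H assume "G \<in> Ob (game_cat U)" "H \<in> Ob (game_cat U)"
  then have "small U ((\<lambda>f. (G, H, f)) ` (fst G \<rightarrow>\<^sub>E fst H))"
    by (intro small_image small_PiE) (auto simp: Ob_game Game_obD)
  moreover have "hom (game_cat U) G H \<subseteq> (\<lambda>f. (G, H, f)) ` (fst G \<rightarrow>\<^sub>E fst H)"
  proof
    fix a assume a: "a \<in> hom (game_cat U) G H"
    then have "a = (G, H, fn a)" "fn a \<in> fst G \<rightarrow>\<^sub>E fst H"
      using hom_gameD(4)[OF a] unfolding hom_game by (auto simp: PiE_def)
    then show "a \<in> (\<lambda>f. (G, H, f)) ` (fst G \<rightarrow>\<^sub>E fst H)" by (rule image_eqI)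
  qed
  ultimately show "small U (hom (game_cat U) G H)" by (rule small_subset[rotated])
qed

lemma functor_hom_func:
  assumes C: "category C" "locally_small U C" and k: "k \<in> Ob C"
  shows "is_functor C (set_cat U) (hom_func C k)"
proof -
  have small: "small U (hom C k x)" if "x \<in> Ob C" for x
    using that C(2) k unfolding locally_small_def by blast
  have am: "amap (hom_func C k) f = sarr (hom C k x) (hom C k y) (cmp C f)" if "f \<in> hom C x y" for f x y
    using that by (simp add: hom_func_def sarr_def hom_def[of C x y])
  have om: "omap (hom_func C k) x = hom C k x" for x by (simp add: hom_func_def)
  have hom: "amap (hom_func C k) f \<in> hom (set_cat U) (hom C k x) (hom C k y)" if f: "f \<in> hom C x y" for f x y
    unfolding am[OF f] using small category_hom_Ob[OF C(1) f] category_cmp[OF C(1) _ f]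
    by (intro sarr_hom) auto
  show ?thesis
  proof (rule functorI)
    show "amap (hom_func C k) (idn C x) = idn (set_cat U) (omap (hom_func C k) x)" if x: "x \<in> Ob C" for x
    proof (rule hom_set_eqI)
      show "amap (hom_func C k) (idn C x) \<in> hom (set_cat U) (hom C k x) (hom C k x)"
        by (rule hom[OF category_idn[OF C(1) x]])
      show "idn (set_cat U) (omap (hom_func C k) x) \<in> hom (set_cat U) (hom C k x) (hom C k x)"
        using category_idn[OF category_set] small[OF x] by (simp add: om Ob_set)
    qed (use category_unit(2)[OF C(1)] in \<open>simp add: am[OF category_idn[OF C(1) x]] om\<close>)
    show "amap (hom_func C k) (cmp C g f) =
        cmp (set_cat U) (amap (hom_func C k) g) (amap (hom_func C k) f)"
      if f: "f \<in> hom C x y" and g: "g \<in> hom C y z" for x y z f g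
    proof (rule hom_set_eqI[OF hom[OF category_cmp[OF C(1) f g]] cmp_set_hom[OF hom[OF f] hom[OF g]]])
      fix a assume a: "a \<in> hom C k x"
      show "fn (amap (hom_func C k) (cmp C g f)) a =
          fn (cmp (set_cat U) (amap (hom_func C k) g) (amap (hom_func C k) f)) a"
        using fn_cmp_set[OF hom[OF f] a, of "amap (hom_func C k) g"] a
          category_cmp[OF C(1) a f] category_assoc[OF C(1) a f g]
        by (simp add: am[OF f] am[OF g] am[OF category_cmp[OF C(1) f g]])
    qed
  qed (use C(1) category_set hom small in \<open>auto simp: om Ob_set\<close>)
qed

lemma fn_functor_cmp:
  assumes D: "is_functor J (set_cat U) D" and u: "u \<in> hom J i j" and v: "v \<in> hom J j k"
    and x: "x \<in> omap D i"
  shows "fn (amap D (cmp J v u)) x = fn (amap D v) (fn (amap D u) x)"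
  using functor_cmp[OF D u v] fn_cmp_set[OF functor_hom[OF D u] x] by simp

context
  fixes J :: "('i, 'j) cat" and D :: "('i, 'j, 'x set, 'x set \<times> 'x set \<times> ('x \<Rightarrow> 'x)) func"
  assumes D: "is_functor J (set_cat U) D" and filt: "filtered J"
begin

text \<open>A forward step is absorbed by completing a span, a backward step by precomposition; a
  whole zigzag collapses to one cospan.\<close>

lemma zigzag_filtered:
  assumes zz: "((i, x), (j, y)) \<in> zigzag J D" and i: "i \<in> Ob J" "x \<in> omap D i"
  shows "\<exists>k u v. u \<in> hom J i k \<and> v \<in> hom J j k \<and> fn (amap D u) x = fn (amap D v) y"
proof -
  note J = functor_category(1)[OF D]
  have "y \<in> omap D j \<and> (\<exists>k u v. u \<in> hom J i k \<and> v \<in> hom J j k \<and> fn (amap D u) x = fn (amap D v) y)"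
    using zz
  proof (induct rule: zigzag_induct)
    case refl
    then show ?case using i category_idn[OF J i(1)] by blast
  next
    case (fwd j y m w)
    then obtain k u v where kuv: "u \<in> hom J i k" "v \<in> hom J j k" "fn (amap D u) x = fn (amap D v) y"
      by blast
    obtain n a b where n: "a \<in> hom J k n" "b \<in> hom J m n" "cmp J a v = cmp J b w"
      using filtered_span[OF J filt kuv(2) fwd(2)] by blast
    have "fn (amap D (cmp J a u)) x = fn (amap D b) (fn (amap D w) y)"
      using fn_functor_cmp[OF D kuv(1) n(1) i(2)] fn_functor_cmp[OF D kuv(2) n(1) fwd(3)]
        fn_functor_cmp[OF D fwd(2) n(2) fwd(3)] kuv(3) n(3) by simp
    then show ?case
      using category_cmp[OF J kuv(1) n(1)] n(2) hom_setD(3)[OF functor_hom[OF D fwd(2)] fwd(3)] by blast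
  next
    case (bwd j m z w)
    then obtain k u v where kuv: "u \<in> hom J i k" "v \<in> hom J j k"
      "fn (amap D u) x = fn (amap D v) (fn (amap D w) z)"
      by blast
    then have "fn (amap D u) x = fn (amap D (cmp J v w)) z"
      using fn_functor_cmp[OF D bwd(2) kuv(2) bwd(3)] by simp
    then show ?case using kuv(1) category_cmp[OF J bwd(2) kuv(2)] bwd(3) by blast
  qed
  then show ?thesis by blast
qed

text \<open>One pair at a time: the zigzag gives parallel arrows out of \<open>i\<close>, which are
  coequalised at a later stage, and completing a span merges the result with the arrow found for the
  earlier pairs.\<close>

lemma filtered_identify:
  assumes ker: "kernel_zigzag J D c" and i: "i \<in> Ob J" and "finite Q"
    and "\<And>x y. (x, y) \<in> Q \<Longrightarrow> x \<in> omap D i \<and> y \<in> omap D i \<and> fn (c i) x = fn (c i) y"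
  shows "\<exists>k. \<exists>u\<in>hom J i k. \<forall>(x, y)\<in>Q. fn (amap D u) x = fn (amap D u) y"
  using assms(3,4)
proof (induct Q rule: finite_induct)
  case empty
  then show ?case using category_idn[OF functor_category(1)[OF D] i] by blast
next
  case (insert p Q)
  note J = functor_category(1)[OF D]
  obtain x y where p: "p = (x, y)" by (cases p)
  have xy: "x \<in> omap D i" "y \<in> omap D i" "fn (c i) x = fn (c i) y" using insert.prems[of x y] p by auto
  obtain k u where u: "u \<in> hom J i k" "\<And>x y. (x, y) \<in> Q \<Longrightarrow> fn (amap D u) x = fn (amap D u) y"
    using insert.hyps(3) insert.prems by blast
  have "((i, x), (i, y)) \<in> zigzag J D" using ker i xy unfolding kernel_zigzag_def by blast
  then obtain m v w where m: "v \<in> hom J i m" "w \<in> hom J i m" "fn (amap D v) x = fn (amap D w) y"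
    using zigzag_filtered i xy(1) by blast
  obtain n a where n: "a \<in> hom J m n" "cmp J a v = cmp J a w"
    using filt m(1,2) unfolding filtered_def by blast
  note av = category_cmp[OF J m(1) n(1)]
  have avx: "fn (amap D (cmp J a v)) x = fn (amap D (cmp J a v)) y"
    using fn_functor_cmp[OF D m(1) n(1) xy(1)] fn_functor_cmp[OF D m(2) n(1) xy(2)] m(3) n(2) by simp
  obtain q b d where q: "b \<in> hom J k q" "d \<in> hom J n q" "cmp J b u = cmp J d (cmp J a v)"
    using filtered_span[OF J filt u(1) av] by blast
  have "fn (amap D (cmp J b u)) x = fn (amap D (cmp J b u)) y"
    using fn_functor_cmp[OF D av q(2)] xy avx q(3) by simp
  moreover have "fn (amap D (cmp J b u)) x' = fn (amap D (cmp J b u)) y'" if "(x', y') \<in> Q" for x' y'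
    using fn_functor_cmp[OF D u(1) q(1)] insert.prems[of x' y'] that u(2)[OF that] by simp
  ultimately show ?case using category_cmp[OF J u(1) q(1)] p by blast
qed

end

text \<open>By the elementwise criterion, an arrow from \<open>K\<close> into the colimit must
  factor through a stage, and two factorisations must be joined by a zigzag. Both reduce to finitely
  many equalities in the colimit.\<close>

lemma finitely_presentable_game:
  assumes K: "Game_ob K" "finite (fst K)"
  shows "finitely_presentable U (game_cat U) K"
  unfolding finitely_presentable_def preserves_colimits_def
proof (intro conjI allI impI; (elim conjE)?)
  show K_ob: "K \<in> Ob (game_cat U)" using K by (simp add: Ob_game)
  fix J D l c
  assume J: "small_category U J" and filt: "filtered J"
    and D: "is_functor J (game_cat U) D" and l: "is_colimit J (game_cat U) D l c"
  let ?H = "hom_func (game_cat U) K" and ?UD = "comp_func forgetful D"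
  have JC: "category J" by (rule functor_category(1)[OF D])
  have H: "is_functor (game_cat U) (set_cat U) ?H"
    by (rule functor_hom_func[OF category_game locally_small_game K_ob])
  note UD = functor_comp[OF D functor_forgetful] and HD = functor_comp[OF D H]
  have cocone: "is_cocone J (game_cat U) D l c" using l unfolding is_colimit_def by blast
  then have c: "c i \<in> hom (game_cat U) (omap D i) l" if "i \<in> Ob J" for i
    using that unfolding is_cocone_def by blast
  have surj: "\<exists>i\<in>Ob J. \<exists>x\<in>fst (omap D i). fn (c i) x = p" if "p \<in> fst l" for p
    using that game_colimitD(1)[OF J D l] unfolding jointly_surjective_def by simp
  note ker = game_colimitD(2)[OF J D l]
  have Dob: "Game_ob (omap D i)" if "i \<in> Ob J" for i
    using functor_Ob[OF D that] by (simp add: Ob_game)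
  have identify: "\<exists>k. \<exists>u\<in>hom J i k. \<forall>(x, y)\<in>Q. fn (amap D u) x = fn (amap D u) y"
    if "i \<in> Ob J" "finite Q" and "\<And>x y. (x, y) \<in> Q \<Longrightarrow> x \<in> fst (omap D i) \<and> y \<in> fst (omap D i) \<and> fn (c i) x = fn (c i) y"
    for i Q
    using filtered_identify[OF UD filt ker that(1,2)] that(3) by simp
  have step: "fn (c j) (fn (amap D u) x) = fn (c i) x" if "u \<in> hom J i j" "x \<in> fst (omap D i)" for i j u x
    by (rule game_cocone_step[OF D cocone that])
  have H_ob: "omap ?H X = hom (game_cat U) K X" for X by (simp add: hom_func_def)
  have H_fn: "fn (amap ?H f) a = cmp (game_cat U) f a"
    if "f \<in> hom (game_cat U) X Y" "a \<in> hom (game_cat U) K X" for f a X Y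
    using that by (simp add: hom_func_def hom_def[of _ X Y])
  have "jointly_surjective J (comp_func ?H D) (omap ?H l) (\<lambda>i. amap ?H (c i))"
    unfolding jointly_surjective_def
  proof
    fix g assume "g \<in> omap ?H l"
    then have g: "g \<in> hom (game_cat U) K l" by (simp add: H_ob)
    \<comment> \<open>Each value of \<open>g\<close> is represented at some stage:
      \<open>fst q\<close> is the stage and \<open>snd q\<close> the representative. Filteredness
      then moves all of them to one stage \<open>i\<close>.\<close>
    have "\<forall>x\<in>fst K. \<exists>q. fst q \<in> Ob J \<and> snd q \<in> fst (omap D (fst q)) \<and> fn (c (fst q)) (snd q) = fn g x"
      using surj[OF hom_gameD(4)[OF g]] by fastforce
    from bchoice[OF this] obtain q where q: "\<forall>x\<in>fst K. fst (q x) \<in> Ob J \<and> snd (q x) \<in> fst (omap D (fst (q x))) \<and>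
        fn (c (fst (q x))) (snd (q x)) = fn g x"
      by (elim exE)
    define I where "I x = fst (q x)" for x
    define X where "X x = snd (q x)" for x
    have IX: "I x \<in> Ob J \<and> X x \<in> fst (omap D (I x)) \<and> fn (c (I x)) (X x) = fn g x" if "x \<in> fst K" for x
      using bspec[OF q that] by (simp add: I_def X_def)
    obtain i where i: "i \<in> Ob J" "\<forall>x\<in>fst K. hom J (I x) i \<noteq> {}"
      using filtered_upper_bound[OF JC filt K(2), of I] IX by blast
    have "\<forall>x\<in>fst K. \<exists>v. v \<in> hom J (I x) i" using i(2) by blast
    from bchoice[OF this] obtain V where V: "V x \<in> hom J (I x) i" if "x \<in> fst K" for x by blast
    define a where "a x = fn (amap D (V x)) (X x)" for x
    have a: "a x \<in> fst (omap D i)" "fn (c i) (a x) = fn g x" if "x \<in> fst K" for x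
      using hom_gameD(4)[OF functor_hom[OF D V[OF that]]] step[OF V[OF that]] IX[OF that]
      by (simp_all add: a_def)
    txt \<open>
      The function \<open>a\<close> need not preserve or lift moves, but it does so up to finitely many pairs
      that are identified in the colimit, hence already at a later stage.
    \<close>
    define Q where "Q = (\<Union>x\<in>fst K. \<Union>x'\<in>{x'. (x, x') \<in> snd K}. \<Union>b\<in>{b. (a x, b) \<in> snd (omap D i)}.
      if fn (c i) b = fn (c i) (a x') then {(b, a x')} else {})"
    have "finite Q"
      unfolding Q_def using K(2) game_finite[OF Game_obD(1)[OF K(1)]] game_finite[OF Game_obD(1)[OF Dob[OF i(1)]]]
      by (intro finite_UN_I) auto
    moreover have "b \<in> fst (omap D i) \<and> b' \<in> fst (omap D i) \<and> fn (c i) b = fn (c i) b'"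
      if "(b, b') \<in> Q" for b b'
      using that a game_edge(2)[OF Game_obD(1)[OF K(1)]] game_edge(2)[OF Game_obD(1)[OF Dob[OF i(1)]]]
      unfolding Q_def by (fastforce split: if_splits)
    ultimately obtain k u where u: "u \<in> hom J i k" "\<forall>(x, y)\<in>Q. fn (amap D u) x = fn (amap D u) y"
      using identify[OF i(1)] by blast
    have Q: "fn (amap D u) b = fn (amap D u) (a x')"
      if "x \<in> fst K" "(x, x') \<in> snd K" "(a x, b) \<in> snd (omap D i)" "fn (c i) b = fn (c i) (a x')" for x x' b
    proof -
      have "(b, a x') \<in> Q" using that unfolding Q_def by force
      then show ?thesis using u(2) by blast
    qed
    note Du = functor_hom[OF D u(1)] and k = conjunct2[OF category_hom_Ob[OF JC u(1)]]
    have "gmor K (omap D k) (\<lambda>x. fn (amap D u) (a x))"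
    proof (rule gmorI)
      fix x assume "x \<in> fst K"
      then show "fn (amap D u) (a x) \<in> fst (omap D k)" using a(1) hom_gameD(4)[OF Du] by blast
    next
      fix x x' assume xx': "(x, x') \<in> snd K"
      note in_K = game_edge[OF Game_obD(1)[OF K(1)] xx']
      have "(fn (c i) (a x), fn (c i) (a x')) \<in> snd l"
        using gmor_edge[OF hom_gameD(3)[OF g] xx'] a(2) in_K by simp
      then obtain b where b: "(a x, b) \<in> snd (omap D i)" "fn (c i) b = fn (c i) (a x')"
        using gmor_lift[OF hom_gameD(3)[OF c[OF i(1)]] a(1)[OF in_K(1)]] by metis
      show "(fn (amap D u) (a x), fn (amap D u) (a x')) \<in> snd (omap D k)"
        using gmor_edge[OF hom_gameD(3)[OF Du] b(1)] Q[OF in_K(1) xx' b] by simp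
    next
      fix x y assume x: "x \<in> fst K" and y: "(fn (amap D u) (a x), y) \<in> snd (omap D k)"
      obtain b where b: "(a x, b) \<in> snd (omap D i)" "fn (amap D u) b = y"
        using gmor_lift[OF hom_gameD(3)[OF Du] a(1)[OF x] y] by blast
      have "(fn g x, fn (c i) b) \<in> snd l"
        using gmor_edge[OF hom_gameD(3)[OF c[OF i(1)]] b(1)] a(2)[OF x] by simp
      then obtain x' where x': "(x, x') \<in> snd K" "fn g x' = fn (c i) b"
        using gmor_lift[OF hom_gameD(3)[OF g] x] by metis
      then have "fn (c i) b = fn (c i) (a x')" using a(2) game_edge(2)[OF Game_obD(1)[OF K(1)]] by simp
      then show "\<exists>x'. (x, x') \<in> snd K \<and> fn (amap D u) (a x') = y"
        using Q[OF x x'(1) b(1)] x'(1) b(2) by auto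
    qed
    then have h: "garr K (omap D k) (\<lambda>x. fn (amap D u) (a x)) \<in> hom (game_cat U) K (omap D k)" (is "?h \<in> _")
      by (rule garr_hom[OF K(1) Dob[OF k]])
    have "cmp (game_cat U) (c k) ?h = g"
      by (rule hom_game_eqI[OF cmp_game_hom[OF h c[OF k]] g])
        (simp add: fn_cmp_game[OF h] step[OF u(1)] a)
    then have "fn (amap ?H (c k)) ?h = g" using H_fn[OF c[OF k] h] by simp
    then show "\<exists>i\<in>Ob J. \<exists>h\<in>omap (comp_func ?H D) i. fn (amap ?H (c i)) h = g"
      using k h H_ob by auto
  qed
  moreover have "kernel_zigzag J (comp_func ?H D) (\<lambda>i. amap ?H (c i))"
    unfolding kernel_zigzag_def
  proof (intro ballI impI)
    fix i j a b assume i: "i \<in> Ob J" and j: "j \<in> Ob J"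
      and "a \<in> omap (comp_func ?H D) i" "b \<in> omap (comp_func ?H D) j"
      and "fn (amap ?H (c i)) a = fn (amap ?H (c j)) b"
    then have a: "a \<in> hom (game_cat U) K (omap D i)" and b: "b \<in> hom (game_cat U) K (omap D j)"
      and "cmp (game_cat U) (c i) a = cmp (game_cat U) (c j) b"
      using H_fn[OF c] by (simp_all add: H_ob)
    then have eq: "fn (c i) (fn a x) = fn (c j) (fn b x)" if "x \<in> fst K" for x
      using fn_cmp_game[OF a that, of "c i"] fn_cmp_game[OF b that, of "c j"] by simp
    obtain k u v where u: "u \<in> hom J i k" and v: "v \<in> hom J j k" and k: "k \<in> Ob J"
      using filt i j unfolding filtered_def by blast
    note Du = functor_hom[OF D u] and Dv = functor_hom[OF D v]
    \<comment> \<open>At the common stage the two arrows differ by finitely many pairs that become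
      equal in the colimit, so one later stage equates them.\<close>
    let ?Q = "(\<lambda>x. (fn (amap D u) (fn a x), fn (amap D v) (fn b x))) ` fst K"
    have "p \<in> fst (omap D k) \<and> q \<in> fst (omap D k) \<and> fn (c k) p = fn (c k) q" if "(p, q) \<in> ?Q" for p q
      using that hom_gameD(4)[OF Du] hom_gameD(4)[OF Dv] hom_gameD(4)[OF a] hom_gameD(4)[OF b]
        step[OF u] step[OF v] eq by auto
    then obtain n w where w: "w \<in> hom J k n"
      and "\<forall>(p, q)\<in>?Q. fn (amap D w) p = fn (amap D w) q"
      using identify[OF k finite_imageI[OF K(2)]] by blast
    then have weq: "fn (amap D w) (fn (amap D u) (fn a x)) = fn (amap D w) (fn (amap D v) (fn b x))"
      if "x \<in> fst K" for x
      using that by blast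
    note wu = category_cmp[OF JC u w] and wv = category_cmp[OF JC v w]
    note Dwu = functor_hom[OF D wu] and Dwv = functor_hom[OF D wv]
    have "cmp (game_cat U) (amap D (cmp J w u)) a = cmp (game_cat U) (amap D (cmp J w v)) b"
    proof (rule hom_game_eqI[OF cmp_game_hom[OF a Dwu] cmp_game_hom[OF b Dwv]])
      fix x assume x: "x \<in> fst K"
      show "fn (cmp (game_cat U) (amap D (cmp J w u)) a) x = fn (cmp (game_cat U) (amap D (cmp J w v)) b) x"
        using fn_cmp_game[OF a x] fn_cmp_game[OF b x] weq[OF x]
          fn_functor_cmp[OF UD u w] fn_functor_cmp[OF UD v w] hom_gameD(4)[OF a x] hom_gameD(4)[OF b x]
        by simp
    qed
    then have "fn (amap (comp_func ?H D) (cmp J w u)) a = fn (amap (comp_func ?H D) (cmp J w v)) b"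
      using H_fn[OF Dwu a] H_fn[OF Dwv b] by simp
    moreover have "((i, a), (n, fn (amap (comp_func ?H D) (cmp J w u)) a)) \<in> zigzag J (comp_func ?H D)"
      by (rule zigzag_arrow[OF wu]) (simp add: H_ob a)
    moreover have "((j, b), (n, fn (amap (comp_func ?H D) (cmp J w v)) b)) \<in> zigzag J (comp_func ?H D)"
      by (rule zigzag_arrow[OF wv]) (simp add: H_ob b)
    ultimately show "((i, a), (j, b)) \<in> zigzag J (comp_func ?H D)"
      by (simp only:) (rule zigzag_trans[OF _ zigzag_sym])
  qed
  ultimately show "is_colimit J (set_cat U) (comp_func ?H D) (omap ?H l) (\<lambda>i. amap ?H (c i))"
    using set_colimitI[OF HD functor_cocone[OF D H cocone]] by blast
qed

text \<open>A \<open>small_category\<close> has its arrows in \<open>'u\<close>, so the unique arrow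
  between comparable objects is an injective code of the pair of its ends.\<close>

lemma ex_preorder_category:
  fixes I :: "'u set"
  assumes I: "small U I" and refl: "\<And>i. i \<in> I \<Longrightarrow> le i i"
    and trans: "\<And>i j k. le i j \<Longrightarrow> le j k \<Longrightarrow> le i k"
  obtains J p where "small_category U J" "Ob J = I"
    and "\<And>i j. hom J i j = (if i \<in> I \<and> j \<in> I \<and> le i j then {p i j} else {})"
proof -
  obtain \<pi> :: "'u \<times> 'u \<Rightarrow> 'u" where \<pi>: "inj_on \<pi> (I \<times> I)"
    using ex_small_inj[OF small_Sigma[OF I I]] by blast
  let ?inv = "inv_into (I \<times> I) \<pi>"
  define J where "J = \<lparr>Ob = I, Ar = \<pi> ` {(i, j) \<in> I \<times> I. le i j}, src = (\<lambda>a. fst (?inv a)),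
    tgt = (\<lambda>a. snd (?inv a)), idn = (\<lambda>i. \<pi> (i, i)), cmp = (\<lambda>b a. \<pi> (fst (?inv a), snd (?inv b)))\<rparr>"
  have inv: "?inv (\<pi> (i, j)) = (i, j)" if "i \<in> I" "j \<in> I" for i j using that \<pi> by simp
  have hom: "hom J i j = (if i \<in> I \<and> j \<in> I \<and> le i j then {\<pi> (i, j)} else {})" for i j
    using inv by (auto simp: hom_def J_def)
  have homD: "i \<in> I \<and> j \<in> I \<and> le i j \<and> a = \<pi> (i, j)" if "a \<in> hom J i j" for i j a
    using that by (auto simp: hom split: if_splits)
  have cmp: "cmp J (\<pi> (j, k)) (\<pi> (i, j)) = \<pi> (i, k)" if "i \<in> I" "j \<in> I" "k \<in> I" for i j k
    using that inv by (simp add: J_def)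
  have Ob: "Ob J = I" and idn: "idn J i = \<pi> (i, i)" for i by (simp_all add: J_def)
  have "category J"
  proof (rule categoryI)
    show "src J f \<in> Ob J \<and> tgt J f \<in> Ob J" if "f \<in> Ar J" for f
      using that inv by (auto simp: J_def)
    show "cmp J g f \<in> hom J x z" if "f \<in> hom J x y" "g \<in> hom J y z" for x y z f g
      using homD[OF that(1)] homD[OF that(2)] cmp trans by (auto simp: hom)
    show "cmp J f (idn J x) = f \<and> cmp J (idn J y) f = f" if "f \<in> hom J x y" for x y f
      using homD[OF that] cmp by (auto simp: idn)
    show "cmp J h (cmp J g f) = cmp J (cmp J h g) f"
      if "f \<in> hom J w x" "g \<in> hom J x y" "h \<in> hom J y z" for w x y z f g h
      using homD[OF that(1)] homD[OF that(2)] homD[OF that(3)] cmp by auto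
  qed (use refl in \<open>auto simp: hom Ob idn\<close>)
  moreover have "small U (Ar J)"
  proof -
    have "small U (\<pi> ` (I \<times> I))" by (intro small_image small_Sigma I)
    then show ?thesis by (rule small_subset[rotated]) (auto simp: J_def)
  qed
  ultimately have "small_category U J" using I by (simp add: small_category_def Ob)
  then show thesis using that[of J "\<lambda>i j. \<pi> (i, j)"] Ob hom by blast
qed

text \<open>Induction along moves: the finitely many options have finite closed covers, and adding
  \<open>x\<close> to their union keeps it finite and closed.\<close>

lemma finite_closed_cover:
  assumes X: "is_game X" and x: "x \<in> fst X"
  shows "\<exists>F. finite F \<and> closed_in X F \<and> x \<in> F"
  using X x
proof (induct x rule: game_induct)
  case (step x)
  then obtain F where F: "\<And>y. (x, y) \<in> snd X \<Longrightarrow> finite (F y) \<and> closed_in X (F y) \<and> y \<in> F y" by metis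
  let ?F = "insert x (\<Union>y\<in>{y. (x, y) \<in> snd X}. F y)"
  have "finite ?F" using F game_finite[OF X] by auto
  moreover have "closed_in X ?F" using F step(1) unfolding closed_in_def by blast
  ultimately show ?case by blast
qed

text \<open>Copies on a fixed \<open>N\<close> allow the diagrams of all games to take objects from one small set.\<close>

lemma game_filtered_colimit:
  assumes X: "Game_ob X" and N: "infinite N"
  shows "\<exists>J D c. small_category U J \<and> filtered J \<and> is_functor J (game_cat U) D \<and>
    (\<forall>i\<in>Ob J. finite (fst (omap D i)) \<and> fst (omap D i) \<subseteq> N) \<and> is_colimit J (game_cat U) D X c"
proof -
  note X_game = Game_obD(1)[OF X]
  define P where "P = {F. finite F \<and> closed_in X F}"
  have "small U (Pow (fst X))" by (rule small_Pow[OF Game_obD(2)[OF X]])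
  then have P_small: "small U P" by (rule small_subset[rotated]) (auto simp: P_def closed_in_def)
  \<comment> \<open>The finite closed parts index the diagram; \<iota> names them by elements of
    \<open>'u\<close>, and \<open>F\<close> decodes the names.\<close>
  then obtain \<iota> :: "'u set \<Rightarrow> 'u" where \<iota>: "inj_on \<iota> P" using ex_small_inj by blast
  define I where "I = \<iota> ` P"
  define F where "F = inv_into P \<iota>"
  have F: "finite (F i)" "closed_in X (F i)" "F i \<subseteq> fst X" if "i \<in> I" for i
    using inv_into_into[of i \<iota> P] that unfolding I_def F_def P_def closed_in_def by auto
  have F\<iota>: "F (\<iota> A) = A" "\<iota> A \<in> I" if "finite A" "closed_in X A" for A
    using that \<iota> by (simp_all add: F_def I_def P_def)
  obtain J p where J: "small_category U J" and Ob: "Ob J = I"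
    and hom: "\<And>i j. hom J i j = (if i \<in> I \<and> j \<in> I \<and> F i \<subseteq> F j then {p i j} else {})"
  proof (rule ex_preorder_category[of I "\<lambda>i j. F i \<subseteq> F j"])
    show "small U I" unfolding I_def by (rule small_image[OF P_small])
  qed (auto intro: that)
  have JC: "category J" using J by (simp add: small_category_def)
  have homD: "i \<in> I" "j \<in> I" "F i \<subseteq> F j" if "u \<in> hom J i j" for i j u
    using that by (auto simp: hom split: if_splits)
  have upper: "\<exists>k\<in>I. F i \<subseteq> F k \<and> F j \<subseteq> F k" if "i \<in> I" "j \<in> I" for i j
  proof -
    have "finite (F i \<union> F j)" "closed_in X (F i \<union> F j)"
      using F[OF that(1)] F[OF that(2)] by (auto simp: closed_in_def)
    then show ?thesis using F\<iota>[of "F i \<union> F j"] by (intro bexI[of _ "\<iota> (F i \<union> F j)"]) auto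
  qed
  have filt: "filtered J"
    unfolding filtered_def
  proof (intro conjI ballI allI)
    show "Ob J \<noteq> {}" using F\<iota>(2)[of "{}"] by (auto simp: Ob closed_in_def)
    show "\<exists>k\<in>Ob J. hom J i k \<noteq> {} \<and> hom J j k \<noteq> {}" if "i \<in> Ob J" "j \<in> Ob J" for i j
      using upper[of i j] that by (auto simp: Ob hom)
    show "\<exists>k\<in>Ob J. \<exists>w\<in>hom J j k. cmp J w u = cmp J w v" if "u \<in> hom J i j" "v \<in> hom J i j" for i j u v
    proof -
      have "u = v" using that by (auto simp: hom split: if_splits)
      then show ?thesis using category_idn[OF JC] category_hom_Ob[OF JC that(1)] by blast
    qed
  qed
  have "\<exists>b. inj_on b (F i) \<and> b ` F i \<subseteq> N" if "i \<in> I" for i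
  proof -
    \<comment> \<open>An infinite \<open>N\<close> has subsets of every finite size, so each finite
      part has a copy inside \<open>N\<close>.\<close>
    obtain T where T: "T \<subseteq> N" "finite T" "card T = card (F i)"
      using infinite_arbitrarily_large[OF N] by metis
    then obtain b where "bij_betw b (F i) T" using finite_same_card_bij F(1)[OF \<open>i \<in> I\<close>] by metis
    then show ?thesis using T(1) by (auto simp: bij_betw_def)
  qed
  then obtain b where b: "\<And>i. i \<in> I \<Longrightarrow> inj_on (b i) (F i)" "\<And>i. i \<in> I \<Longrightarrow> b i ` F i \<subseteq> N" by metis
  define r where "r i = inv_into (F i) (b i)" for i
  have r: "r i q \<in> F i" "b i (r i q) = q" if "q \<in> b i ` F i" for i q
    using that by (simp_all add: r_def inv_into_into f_inv_into_f)
  have rb: "r i (b i x) = x" if "i \<in> I" "x \<in> F i" for i x using that b(1) by (simp add: r_def)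
  define G where "G i = image_game (b i) (subgame X (F i))" for i
  have fst_G: "fst (G i) = b i ` F i" for i by (simp add: G_def)
  have sub: "is_game (subgame X (F i))" if "i \<in> I" for i by (rule is_game_subgame[OF X_game F(2)[OF that]])
  have inj: "inj_on (b i) (fst (subgame X (F i)))" if "i \<in> I" for i using b(1)[OF that] by simp
  have G: "Game_ob (G i)" if "i \<in> I" for i
    using is_game_image_game[OF sub inj] that F(1) by (simp add: Game_ob_def G_def small_finite)
  have to_sub: "gmor (G i) (subgame X (F i)) (r i)" if "i \<in> I" for i
    using gmor_image_game_inv[OF sub[OF that] inj[OF that]] by (simp add: G_def r_def)
  have from_sub: "gmor (subgame X (F i)) (G i) (b i)" if "i \<in> I" for i
    using gmor_image_game[OF sub[OF that] inj[OF that]] by (simp add: G_def)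
  \<comment> \<open>The transition maps are the inclusions of finite parts conjugated by the
    renamings: \<open>r\<close> leads back into \<open>X\<close>, and \<open>b\<close> into the next
    copy.\<close>
  define D where "D = \<lparr>omap = G, amap = (\<lambda>u. garr (G (src J u)) (G (tgt J u)) (\<lambda>q. b (tgt J u) (r (src J u) q)))\<rparr>"
  have D_ob: "omap D i = G i" for i by (simp add: D_def)
  have D_am: "amap D u = garr (G i) (G j) (\<lambda>q. b j (r i q))" if "u \<in> hom J i j" for u i j
    using that by (simp add: D_def hom_def)
  have D_hom: "amap D u \<in> hom (game_cat U) (G i) (G j)" if u: "u \<in> hom J i j" for u i j
  proof -
    note ij = homD[OF u]
    have "gmor (subgame X (F i)) (subgame X (F j)) (\<lambda>x. x)"
      by (rule gmor_into_subgame[OF sub[OF ij(1)] gmor_subgame[OF F(2)[OF ij(1)]]]) (use ij(3) in auto)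
    then have "gmor (G i) (G j) (\<lambda>q. b j (r i q))"
      using gmor_comp[OF to_sub[OF ij(1)]] gmor_comp[OF _ from_sub[OF ij(2)]] by blast
    then show ?thesis unfolding D_am[OF u] by (rule garr_hom[OF G[OF ij(1)] G[OF ij(2)]])
  qed
  have D_fn: "fn (amap D u) q = b j (r i q)" if "u \<in> hom J i j" "q \<in> fst (G i)" for u i j q
    using that by (simp add: D_am)
  have D: "is_functor J (game_cat U) D"
  proof (rule functorI)
    show "amap D (idn J i) = idn (game_cat U) (omap D i)" if i: "i \<in> Ob J" for i
    proof (rule hom_game_eqI)
      show "amap D (idn J i) \<in> hom (game_cat U) (G i) (G i)" by (rule D_hom[OF category_idn[OF JC i]])
      show "idn (game_cat U) (omap D i) \<in> hom (game_cat U) (G i) (G i)"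
        using category_idn[OF category_game] G i by (simp add: Ob_game Ob D_ob)
    qed (use r in \<open>simp add: D_fn[OF category_idn[OF JC i]] D_ob fst_G\<close>)
    show "amap D (cmp J v u) = cmp (game_cat U) (amap D v) (amap D u)"
      if u: "u \<in> hom J i j" and v: "v \<in> hom J j k" for i j k u v
    proof (rule hom_game_eqI[OF D_hom[OF category_cmp[OF JC u v]] cmp_game_hom[OF D_hom[OF u] D_hom[OF v]]])
      fix q assume q: "q \<in> fst (G i)"
      have "r i q \<in> F j" using q r(1) homD(3)[OF u] by (auto simp: fst_G)
      then show "fn (amap D (cmp J v u)) q = fn (cmp (game_cat U) (amap D v) (amap D u)) q"
        using fn_cmp_game[OF D_hom[OF u] q, of "amap D v"] D_fn[OF category_cmp[OF JC u v] q] D_fn[OF u q]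
          D_fn[OF v, of "b j (r i q)"] rb[OF homD(2)[OF u]] by (simp add: fst_G)
    qed
  qed (use JC category_game G D_hom in \<open>auto simp: D_ob Ob Ob_game\<close>)
  define c where "c i = garr (G i) X (r i)" for i
  have c: "c i \<in> hom (game_cat U) (G i) X" if "i \<in> I" for i
    unfolding c_def
    by (rule garr_hom[OF G[OF that] X gmor_comp[OF to_sub[OF that] gmor_subgame[OF F(2)[OF that]]]])
  have fn_c: "fn (c i) q = r i q" if "q \<in> fst (G i)" for i q using that by (simp add: c_def)
  have cocone: "is_cocone J (game_cat U) D X c"
    unfolding is_cocone_def
  proof (intro conjI ballI allI)
    fix i j u assume u: "u \<in> hom J i j"
    show "cmp (game_cat U) (c j) (amap D u) = c i"
    proof (rule hom_game_eqI[OF cmp_game_hom[OF D_hom[OF u] c[OF homD(2)[OF u]]] c[OF homD(1)[OF u]]])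
      fix q assume q: "q \<in> fst (G i)"
      have "r i q \<in> F j" using q r(1) homD(3)[OF u] by (auto simp: fst_G)
      then show "fn (cmp (game_cat U) (c j) (amap D u)) q = fn (c i) q"
        using fn_cmp_game[OF D_hom[OF u] q, of "c j"] D_fn[OF u q] fn_c[of _ j] fn_c[OF q]
          rb[OF homD(2)[OF u]] by (simp add: fst_G)
    qed
  qed (use c X in \<open>simp_all add: Ob Ob_game D_ob\<close>)
  have surj: "jointly_surjective J (comp_func forgetful D) (fst X) (\<lambda>i. amap forgetful (c i))"
    unfolding jointly_surjective_def
  proof
    fix x assume "x \<in> fst X"
    then obtain A where A: "finite A" "closed_in X A" "x \<in> A" using finite_closed_cover[OF X_game] by blast
    let ?i = "\<iota> A"
    have "x \<in> F ?i" "?i \<in> I" using F\<iota>[OF A(1,2)] A(3) by auto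
    then show "\<exists>i\<in>Ob J. \<exists>q\<in>omap (comp_func forgetful D) i. fn (amap forgetful (c i)) q = x"
      using rb[of ?i x] fn_c[of "b ?i x" ?i]
      by (intro bexI[of _ ?i] bexI[of _ "b ?i x"]) (simp_all add: Ob D_ob fst_G)
  qed
  have ker: "kernel_zigzag J (comp_func forgetful D) (\<lambda>i. amap forgetful (c i))"
    unfolding kernel_zigzag_def
  proof (intro ballI impI)
    fix i j q s
    assume ij: "i \<in> Ob J" "j \<in> Ob J"
      and q: "q \<in> omap (comp_func forgetful D) i" and s: "s \<in> omap (comp_func forgetful D) j"
      and eq: "fn (amap forgetful (c i)) q = fn (amap forgetful (c j)) s"
    have qs: "q \<in> fst (G i)" "s \<in> fst (G j)" using q s by (simp_all add: D_ob)
    \<comment> \<open>The two elements name the same vertex of \<open>X\<close>; in the union of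
      their finite parts both receive the same copy.\<close>
    obtain k where k: "k \<in> I" "F i \<subseteq> F k" "F j \<subseteq> F k" using upper[OF ij[unfolded Ob]] by blast
    then have u: "p i k \<in> hom J i k" and v: "p j k \<in> hom J j k" using ij by (simp_all add: hom Ob)
    have "fn (amap (comp_func forgetful D) (p i k)) q = fn (amap (comp_func forgetful D) (p j k)) s"
      using D_fn[OF u qs(1)] D_fn[OF v qs(2)] fn_c[OF qs(1)] fn_c[OF qs(2)] eq by simp
    then show "((i, q), (j, s)) \<in> zigzag J (comp_func forgetful D)"
      using zigzag_trans[OF zigzag_arrow[OF u q] zigzag_sym] zigzag_arrow[OF v s] by simp
  qed
  have "is_colimit J (game_cat U) D X c"
    by (rule game_colimitI[OF D cocone surj
          set_colimitI[OF functor_comp[OF D functor_forgetful] game_cocone_forgetful[OF D cocone] surj ker]])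
  moreover have "\<forall>i\<in>Ob J. finite (fst (omap D i)) \<and> fst (omap D i) \<subseteq> N"
    using F(1) b(2) by (simp add: Ob D_ob fst_G)
  ultimately show ?thesis using J filt D by blast
qed

text \<open>Finite games with vertices anywhere in \<open>'u\<close> would be too many for a small
  set. Those on subsets of one small infinite \<open>N\<close> are few enough, being contained in
  \<open>Pow N \<times> Pow (N \<times> N)\<close>, and still contain a copy of every finite
  game.\<close>

lemma locally_finitely_presentable_game: "locally_finitely_presentable U (game_cat U)"
proof -
  obtain N :: "'u set" where N: "infinite N" "small U N"
    using universe unfolding universe_def by blast
  define S where "S = {G. Game_ob G \<and> finite (fst G) \<and> fst G \<subseteq> N}"
  have "small U (Pow N \<times> Pow (N \<times> N))" by (intro small_Sigma small_Pow N(2))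
  then have "small U S"
    by (rule small_subset[rotated]) (auto simp: S_def Game_ob_def is_game_iff)
  moreover have "finitely_presentable U (game_cat U) k" if "k \<in> S" for k
    using that finitely_presentable_game by (simp add: S_def)
  moreover have "\<exists>J D c. small_category U J \<and> filtered J \<and> is_functor J (game_cat U) D \<and>
      (\<forall>i\<in>Ob J. omap D i \<in> S) \<and> is_colimit J (game_cat U) D X c"
    if "X \<in> Ob (game_cat U)" for X
  proof -
    obtain J D c where J: "small_category U J" "filtered J" "is_functor J (game_cat U) D"
        "\<forall>i\<in>Ob J. finite (fst (omap D i)) \<and> fst (omap D i) \<subseteq> N" "is_colimit J (game_cat U) D X c"
      using game_filtered_colimit[OF _ N(1), of X] \<open>X \<in> Ob (game_cat U)\<close> by (auto simp: Ob_game)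
    moreover have "\<forall>i\<in>Ob J. omap D i \<in> S"
      using J(4) functor_Ob[OF J(3)] by (simp add: S_def Ob_game)
    ultimately show ?thesis by blast
  qed
  ultimately show ?thesis
    unfolding locally_finitely_presentable_def
    using category_game locally_small_game has_small_colimits_game by blast
qed

end

theorem theorem3p15:
  fixes U :: "'u itself"
  assumes "universe U"
  shows "(locally_finitely_presentable U (game_cat U) \<and>
          has_small_limits U (game_cat U) \<and>
          has_small_colimits U (game_cat U)) \<and>
         (comonadic (game_cat U) (set_cat U) forgetful \<and>
          (\<forall>J. small_category U J \<longrightarrow>
             preserves_colimits J (game_cat U) (set_cat U) forgetful \<and>
             reflects_colimits J (game_cat U) (set_cat U) forgetful \<and>
             strictly_creates_colimits J (game_cat U) (set_cat U) forgetful)) \<and>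
         has_subobject_classifier (game_cat U)"
proof -
  interpret small_universe U by unfold_locales (rule assms)
  show ?thesis
    using locally_finitely_presentable_game has_small_limits_game has_small_colimits_game
      comonadic_forgetful preserves_forgetful reflects_forgetful strictly_creates_forgetful
      has_subobject_classifier_game
    by blast
qed

end
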